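(* Let $1\le p\le n$. The operator $\tilde N:A^2_{(p,0)}(\mathbb C^n,e^{-|z|^2})\to A^2_{(p,0)}(\mathbb C^n,e^{-|z|^2})$ is compact.
   Context: $A^2(\mathbb C^n,e^{-|z|^2})$ is the Fock space of entire functions $f$ with $\|f\|^2=\int_{\mathbb C^n}|f|^2e^{-|z|^2}\,d\lambda<\infty$, a Hilbert space. $A^2_{(p,0)}(\mathbb C^n,e^{-|z|^2})$ is the Hilbert space of $(p,0)$-forms $f=\sum'_{|J|=p}f_J\,dz_J$ (sum over strictly increasing multi-indices $J$ of length $p$) with coefficients $f_J\in A^2(\mathbb C^n,e^{-|z|^2})$ and $\|f\|^2=\sum'_{|J|=p}\|f_J\|^2$. The densely defined operator $\partial f=\sum'_{|J|=p}\sum_{j=1}^n\frac{\partial f_J}{\partial z_j}\,dz_j\wedge dz_J$ has domain $\mathrm{dom}(\partial)=\{f\in A^2_{(p,0)}(\mathbb C^n,e^{-|z|^2}):\partial f\in A^2_{(p+1,0)}(\mathbb C^n,e^{-|z|^2})\}$ (and $\partial=0$ on $(n,0)$-forms), and $\partial^*$ is its Hilbert space adjoint. On $(p,0)$-forms, $\tilde\Box_p=\partial^*\partial+\partial\partial^*$ with $\mathrm{dom}(\tilde\Box_p)=\{f\in\mathrm{dom}(\partial)\cap\mathrm{dom}(\partial^* ):\partial f\in\mathrm{dom}(\partial^* )\text{ and }\partial^*f\in\mathrm{dom}(\partial)\}$; for $p=n$ this is $\tilde\Box_n=\partial\partial^*$. For $1\le p\le n$, $\tilde N=\tilde N_p$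 denotes the bounded inverse of the bijective operator $\tilde\Box_p:\mathrm{dom}(\tilde\Box_p)\to A^2_{(p,0)}(\mathbb C^n,e^{-|z|^2})$, regarded as an operator into $A^2_{(p,0)}(\mathbb C^n,e^{-|z|^2})$. *)

theory Defs
  imports "HOL-Analysis.Analysis"
begin

text \<open>
  The space $\mathbf{C}^n$ is \<^typ>\<open>complex ^ 'n\<close>, where the index type is finite and linearly
  ordered, so that $n$ is the cardinality of the index type and the variables
  $z_j$ come in a fixed order. The measure \<^term>\<open>lborel\<close> on this type is Lebesgue measure on
  $\mathbf{R}^{2n}$, and \<^term>\<open>norm z\<close> is the Euclidean norm.
\<close>

definition entire :: "(complex ^ 'n::finite \<Rightarrow> complex) \<Rightarrow> bool" where
  "entire f \<longleftrightarrow>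
     (\<forall>z. \<exists>D. (f has_derivative D) (at z) \<and> (\<forall>c v. D (c *s v) = c * D v))"

definition partial_z :: "'n::finite \<Rightarrow> (complex ^ 'n \<Rightarrow> complex) \<Rightarrow> complex ^ 'n \<Rightarrow> complex" where
  "partial_z j f z = deriv (\<lambda>w. f (\<chi> i. if i = j then w else z $ i)) (z $ j)"

definition fock_space :: "(complex ^ 'n::finite \<Rightarrow> complex) set" where
  "fock_space =
     {f. entire f \<and> integrable lborel (\<lambda>z. (cmod (f z))\<^sup>2 * exp (- (norm z)\<^sup>2))}"

definition fock_inner ::
    "(complex ^ 'n::finite \<Rightarrow> complex) \<Rightarrow> (complex ^ 'n \<Rightarrow> complex) \<Rightarrow> complex" where
  "fock_inner f g = (LINT z|lborel. f z * cnj (g z) * of_real (exp (- (norm z)\<^sup>2)))"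

definition fock_norm :: "(complex ^ 'n::finite \<Rightarrow> complex) \<Rightarrow> real" where
  "fock_norm f = sqrt (LINT z|lborel. (cmod (f z))\<^sup>2 * exp (- (norm z)\<^sup>2))"

text \<open>
  A strictly increasing multi-index $J$ of length $p$ is identified with the set of its $p$
  entries. A form is the family of its coefficients $f_J$; a $(p,0)$-form has zero coefficients
  at all $J$ with $|J| \neq p$. Entire functions that agree almost everywhere are equal, so no
  quotient is needed.
\<close>

type_synonym 'n form = "'n set \<Rightarrow> complex ^ 'n \<Rightarrow> complex"

definition multi_indices :: "nat \<Rightarrow> 'n::finite set set" where
  "multi_indices p = {J. card J = p}"

definition fock_forms :: "nat \<Rightarrow> ('n::finite) form set" where
  "fock_forms p =
     {f. (\<forall>J\<in>multi_indices p. f J \<in> fock_space) \<and> (\<forall>J. J \<notin> multi_indices p \<longrightarrow> f J = (\<lambda>z. 0))}"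

definition form_inner :: "nat \<Rightarrow> ('n::finite) form \<Rightarrow> 'n form \<Rightarrow> complex" where
  "form_inner p f g = (\<Sum>J\<in>multi_indices p. fock_inner (f J) (g J))"

definition form_norm :: "nat \<Rightarrow> ('n::finite) form \<Rightarrow> real" where
  "form_norm p f = sqrt (\<Sum>J\<in>multi_indices p. (fock_norm (f J))\<^sup>2)"

definition form_dist :: "nat \<Rightarrow> ('n::finite) form \<Rightarrow> 'n form \<Rightarrow> real" where
  "form_dist p f g = form_norm p (\<lambda>J z. f J z - g J z)"

text \<open>
  The coefficient of $dz_K$ in $dz_j \wedge dz_J$: moving $dz_j$ to its place in increasing
  order passes each $dz_i$ with $i \in J$, $i < j$.
\<close>

definition wedge_coeff :: "'n::{finite,linorder} \<Rightarrow> 'n set \<Rightarrow> 'n set \<Rightarrow> complex" where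
  "wedge_coeff j J K =
     (if j \<notin> J \<and> K = insert j J then (-1) ^ card {i\<in>J. i < j} else 0)"

definition del :: "nat \<Rightarrow> ('n::{finite,linorder}) form \<Rightarrow> 'n form" where
  "del p f = (\<lambda>K z. \<Sum>J\<in>multi_indices p. \<Sum>j\<in>UNIV. partial_z j (f J) z * wedge_coeff j J K)"

text \<open>
  There are no multi-indices of length $n+1$, so the only $(n+1,0)$-form is zero and
  \<^term>\<open>del p\<close> vanishes for $p = n$.
\<close>

definition dom_del :: "nat \<Rightarrow> ('n::{finite,linorder}) form set" where
  "dom_del p = {f \<in> fock_forms p. del p f \<in> fock_forms (p + 1)}"

definition dom_del_adj :: "nat \<Rightarrow> ('n::{finite,linorder}) form set" where
  "dom_del_adj p =
     {g \<in> fock_forms (p + 1).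
        \<exists>h\<in>fock_forms p. \<forall>f\<in>dom_del p. form_inner (p + 1) (del p f) g = form_inner p f h}"

text \<open>
  The adjoint of \<^term>\<open>del p\<close>, which maps $(p+1,0)$-forms to $(p,0)$-forms. Since
  \<^term>\<open>del p\<close> is densely defined, the form $h$ is unique.
\<close>

definition del_adj :: "nat \<Rightarrow> ('n::{finite,linorder}) form \<Rightarrow> 'n form" where
  "del_adj p g =
     (THE h. h \<in> fock_forms p \<and>
        (\<forall>f\<in>dom_del p. form_inner (p + 1) (del p f) g = form_inner p f h))"

text \<open>
  The Laplacian and its inverse are meant for $p \geq 1$, because $p - 1$ is truncated
  subtraction. For $p = n$ the summand with \<^term>\<open>del p\<close> is zero, which leaves $\partial\partial^*$.
\<close>

definition dom_laplacian :: "nat \<Rightarrow> ('n::{finite,linorder}) form set" where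
  "dom_laplacian p =
     {f \<in> dom_del p \<inter> dom_del_adj (p - 1).
        del p f \<in> dom_del_adj p \<and> del_adj (p - 1) f \<in> dom_del (p - 1)}"

definition laplacian :: "nat \<Rightarrow> ('n::{finite,linorder}) form \<Rightarrow> 'n form" where
  "laplacian p f = (\<lambda>J z. del_adj p (del p f) J z + del (p - 1) (del_adj (p - 1) f) J z)"

definition inverse_laplacian :: "nat \<Rightarrow> ('n::{finite,linorder}) form \<Rightarrow> 'n form" where
  "inverse_laplacian p = the_inv_into (dom_laplacian p) (laplacian p)"

definition linear_on_forms :: "nat \<Rightarrow> (('n::finite) form \<Rightarrow> 'n form) \<Rightarrow> bool" where
  "linear_on_forms p T \<longleftrightarrow>
     (\<forall>f\<in>fock_forms p. \<forall>g\<in>fock_forms p. \<forall>a b.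
        T (\<lambda>J z. a * f J z + b * g J z) = (\<lambda>J z. a * T f J z + b * T g J z))"

definition compact_operator :: "nat \<Rightarrow> (('n::finite) form \<Rightarrow> 'n form) \<Rightarrow> bool" where
  "compact_operator p T \<longleftrightarrow>
     T \<in> fock_forms p \<rightarrow> fock_forms p \<and> linear_on_forms p T \<and>
     (\<forall>B. Metric_space.mbounded (fock_forms p) (form_dist p) B \<longrightarrow>
        compactin (Metric_space.mtopology (fock_forms p) (form_dist p))
          (Metric_space.mtopology (fock_forms p) (form_dist p) closure_of (T ` B)))"

end

theory Submission
  imports Defs "HOL-Complex_Analysis.Complex_Analysis" "HOL-Probability.Distributions"
begin

text \<open>
  An entire function $f$ is the sum of its homogeneous components $f_k$, which are orthogonal in
  the Fock space because Gaussian measure is invariant under $z \mapsto e^{i\theta} z$. Since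
  $z_j$ is the adjoint of $\partial/\partial z_j$, the adjoint of $\partial$ is contraction with
  $\sum_j z_j\, \partial/\partial z_j$, and the anticommutation relations give
  $\tilde\Box_p = E + p$ coefficientwise, where $E = \sum_j z_j\, \partial/\partial z_j$
  multiplies $f_k$ by $k$. The inverse is therefore
  $\tilde N f (z) = \int_0^1 t^{p-1} f(tz)\, dt$, which multiplies $f_k$ by $1/(k+p)$.
  A bounded sequence of forms is equicontinuous on the unit ball, so a subsequence converges
  uniformly there; this controls the components of low degree, and the factor $1/(k+p)$ makes the
  components of high degree uniformly small.
\<close>

section \<open>Entire functions of several variables\<close>

text \<open>The obstacle is the domains: \<open>del p\<close> and its adjoint are unbounded, and
  integration by parts against the Gaussian is carried out only for functions of polynomial growth.
  A homogeneous component always has such growth, because homogeneity spreads a bound on the unit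
  ball to the whole space. Adjointness is therefore proved degree by degree and summed by Parseval,
  which also handles forms whose contraction leaves the Fock space and so pins down the exact domain
  of the adjoint. Components are extracted by averaging over rotations, so that Cauchy theory on
  complex lines stands in for power series in several variables. In degree k, multiplying by z_j or
  differentiating costs at most a factor k+1 in the squared norm, and the squared gain of the radial
  mean pays for one of each; hence its values lie in the domain of the Laplacian. To pass from
  Cauchy subsequences to compact closures, the space of forms is shown to be complete, by point
  evaluations and Fatou's lemma.\<close>

lemma norm_vector_smult: "norm (c *s v) = cmod c * norm (v :: complex ^ 'n::finite)"
proof -
  have "norm (c *s v) = L2_set (\<lambda>i. cmod c * norm (v $ i)) UNIV"
    by (simp add: norm_vec_def norm_mult)
  then show ?thesis
    by (simp add: L2_set_right_distrib norm_vec_def)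
qed

lemma bounded_bilinear_vector_smult:
  "bounded_bilinear ((*s) :: complex \<Rightarrow> complex ^ 'n::finite \<Rightarrow> complex ^ 'n)"
proof
  show "\<exists>K. \<forall>a b. norm (a *s b :: complex ^ 'n) \<le> norm a * norm b * K"
    by (rule exI[of _ 1]) (simp add: norm_vector_smult)
qed (vector algebra_simps)+

interpretation vector_smult: bounded_bilinear "(*s) :: complex \<Rightarrow> complex ^ 'n::finite \<Rightarrow> complex ^ 'n"
  by (rule bounded_bilinear_vector_smult)

lemmas continuous_on_vector_smult [continuous_intros] = vector_smult.continuous_on

section \<open>Complex directional derivatives and their algebra\<close>

definition dir_deriv :: "(complex ^ 'n::finite \<Rightarrow> complex) \<Rightarrow> complex ^ 'n \<Rightarrow> complex ^ 'n \<Rightarrow> complex" where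
  "dir_deriv f z v = frechet_derivative f (at z) v"

lemma entire_has_derivative:
  assumes "entire f"
  shows "(f has_derivative dir_deriv f z) (at z)"
  using assms unfolding entire_def dir_deriv_def
  by (metis frechet_derivative_at has_derivative_at_within)

lemma dir_deriv_eq:
  assumes "(f has_derivative D) (at z)"
  shows "dir_deriv f z = D"
  using assms unfolding dir_deriv_def by (metis frechet_derivative_at)

lemma dir_deriv_smult:
  assumes "entire f"
  shows "dir_deriv f z (c *s v) = c * dir_deriv f z v"
  using assms dir_deriv_eq unfolding entire_def by metis

lemma entireI:
  assumes "\<And>z. (f has_derivative D z) (at z)" "\<And>z c v. D z (c *s v) = c * D z v"
  shows "entire f"
  using assms unfolding entire_def by blast

lemma entire_continuous_on:
  assumes "entire f"
  shows "continuous_on S f"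
  using entire_has_derivative[OF assms] has_derivative_continuous
  by (metis continuous_at_imp_continuous_on)

lemma entire_measurable [measurable_dest]:
  assumes "entire f"
  shows "f \<in> borel_measurable borel"
  by (rule borel_measurable_continuous_onI) (rule entire_continuous_on[OF assms])

lemma linear_dir_deriv:
  assumes "entire f"
  shows "linear (dir_deriv f z)"
  using entire_has_derivative[OF assms] has_derivative_linear by blast

lemma entire_const [simp]: "entire (\<lambda>z. c)"
  by (rule entireI[where D="\<lambda>_ _. 0"]) auto

lemma has_derivative_nth: "((\<lambda>z. z $ j) has_derivative (\<lambda>v. v $ j)) F"
  by (rule bounded_linear_imp_has_derivative) (rule bounded_linear_vec_nth)

lemma entire_nth [simp]: "entire (\<lambda>z. z $ j)"
  by (rule entireI[where D="\<lambda>_ v. v $ j"]) (auto intro: has_derivative_nth)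

lemma dir_deriv_nth: "dir_deriv (\<lambda>z. z $ j) z v = v $ j"
  by (simp add: dir_deriv_eq[OF has_derivative_nth])

lemma entire_add:
  assumes "entire f" "entire g"
  shows "entire (\<lambda>z. f z + g z)"
  by (rule entireI[where D="\<lambda>z v. dir_deriv f z v + dir_deriv g z v"])
    (auto intro!: derivative_intros entire_has_derivative assms simp: dir_deriv_smult assms algebra_simps)

lemma dir_deriv_add:
  assumes "entire f" "entire g"
  shows "dir_deriv (\<lambda>z. f z + g z) z v = dir_deriv f z v + dir_deriv g z v"
proof -
  have "((\<lambda>z. f z + g z) has_derivative (\<lambda>v. dir_deriv f z v + dir_deriv g z v)) (at z)"
    by (intro derivative_intros entire_has_derivative assms)
  then show ?thesis by (simp add: dir_deriv_eq)
qed

lemma has_derivative_entire_mult: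
  assumes "entire f" "entire g"
  shows "((\<lambda>z. f z * g z) has_derivative (\<lambda>v. f z * dir_deriv g z v + dir_deriv f z v * g z)) (at z)"
  by (intro derivative_intros entire_has_derivative assms)

lemma entire_mult:
  assumes "entire f" "entire g"
  shows "entire (\<lambda>z. f z * g z)"
  by (rule entireI[OF has_derivative_entire_mult[OF assms]])
    (auto simp: dir_deriv_smult assms algebra_simps)

lemma dir_deriv_mult:
  assumes "entire f" "entire g"
  shows "dir_deriv (\<lambda>z. f z * g z) z v = f z * dir_deriv g z v + dir_deriv f z v * g z"
  by (simp add: dir_deriv_eq[OF has_derivative_entire_mult[OF assms]])

lemma dir_deriv_const [simp]: "dir_deriv (\<lambda>z. c) z v = 0"
  by (simp add: dir_deriv_eq[OF has_derivative_const])

lemma entire_cmult: "entire f \<Longrightarrow> entire (\<lambda>z. c * f z)"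
  by (intro entire_mult) auto

lemma dir_deriv_cmult: "entire f \<Longrightarrow> dir_deriv (\<lambda>z. c * f z) z v = c * dir_deriv f z v"
  by (simp add: dir_deriv_mult)

lemma entire_multr: "entire f \<Longrightarrow> entire (\<lambda>z. f z * c)"
  by (intro entire_mult) auto

lemma dir_deriv_multr: "entire f \<Longrightarrow> dir_deriv (\<lambda>z. f z * c) z v = dir_deriv f z v * c"
  by (simp add: dir_deriv_mult)

lemma entire_diff: "entire f \<Longrightarrow> entire g \<Longrightarrow> entire (\<lambda>z. f z - g z)"
  using entire_add[OF _ entire_cmult[of g "-1"], of f] by simp

lemma entire_sum: "(\<And>i. i \<in> I \<Longrightarrow> entire (f i)) \<Longrightarrow> entire (\<lambda>z. \<Sum>i\<in>I. f i z)"
  by (induction I rule: infinite_finite_induct) (auto intro: entire_add)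

lemma dir_deriv_sum:
  "(\<And>i. i \<in> I \<Longrightarrow> entire (f i)) \<Longrightarrow> dir_deriv (\<lambda>z. \<Sum>i\<in>I. f i z) z v = (\<Sum>i\<in>I. dir_deriv (f i) z v)"
  by (induction I rule: infinite_finite_induct) (auto simp: dir_deriv_add entire_sum)

text \<open>Complex linearity of the derivative is what makes the restriction to a complex line
  holomorphic; every use of one-variable complex analysis goes through this restriction.\<close>

lemma entire_line_deriv:
  assumes "entire f"
  shows "((\<lambda>\<zeta>. f (z + \<zeta> *s v)) has_field_derivative dir_deriv f (z + \<zeta> *s v) v) (at \<zeta>)"
proof -
  have "((\<lambda>\<zeta>. z + \<zeta> *s v) has_derivative (\<lambda>h. h *s v)) (at \<zeta>)"
    by (auto intro!: derivative_eq_intros bounded_linear_imp_has_derivative[OF vector_smult.bounded_linear_left])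
  from has_derivative_compose[OF this entire_has_derivative[OF assms]]
  show ?thesis
    by (simp add: dir_deriv_smult[OF assms] has_field_derivative_def mult.commute[of _ "dir_deriv f _ _"])
qed

lemma entire_line_holomorphic:
  assumes "entire f"
  shows "(\<lambda>\<zeta>. f (z + \<zeta> *s v)) holomorphic_on A"
  using entire_line_deriv[OF assms] has_field_derivative_at_within
  by (metis (no_types, lifting) field_differentiable_def holomorphic_onI)

lemma partial_z_eq_dir_deriv:
  assumes "entire f"
  shows "partial_z j f z = dir_deriv f z (axis j 1)"
proof -
  have *: "(\<chi> i. if i = j then w else z $ i) = z + (w - z $ j) *s axis j 1" for w
    by (simp add: vec_eq_iff axis_def)
  have "((\<lambda>w. f (z + (w - z $ j) *s axis j 1)) has_field_derivative dir_deriv f (z + (z $ j - z $ j) *s axis j 1) (axis j 1) * 1) (at (z $ j))"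
    by (rule DERIV_chain2[OF entire_line_deriv[OF assms]]) (auto intro!: derivative_eq_intros)
  then show ?thesis
    unfolding partial_z_def * by (simp add: DERIV_imp_deriv)
qed

lemma dir_deriv_eq_sum:
  assumes "entire f"
  shows "dir_deriv f z v = (\<Sum>j\<in>UNIV. v $ j * partial_z j f z)"
proof -
  have "dir_deriv f z v = dir_deriv f z (\<Sum>j\<in>UNIV. v $ j *s axis j 1)"
    by (simp add: basis_expansion)
  also have "\<dots> = (\<Sum>j\<in>UNIV. v $ j * partial_z j f z)"
    by (simp add: linear_sum[OF linear_dir_deriv[OF assms]] dir_deriv_smult assms partial_z_eq_dir_deriv)
  finally show ?thesis .
qed

section \<open>Cauchy integrals over circles and differentiation under the integral sign\<close>

lemma circle_coefficient:
  assumes "g holomorphic_on UNIV"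
  shows "integral {0..1} (\<lambda>s. cnj (cis (2 * pi * s)) ^ k * g (cis (2 * pi * s))) = (deriv ^^ k) g 0 / fact k"
proof -
  \<comment> \<open>On the unit circle \<open>u = cis (2 * pi * s)\<close> one has
    \<open>du = 2 * pi * \<i> * u ds\<close> and \<open>1 / u = cnj u\<close>, so Cauchy's formula
    for the k-th derivative becomes a Fourier coefficient over [0,1].\<close>
  have "((\<lambda>u. g u / (u - 0) ^ Suc k) has_contour_integral
      (2 * pi * \<i>) / fact k * (deriv ^^ k) g 0) (circlepath 0 1)"
    by (rule Cauchy_has_contour_integral_higher_derivative_circlepath)
      (use assms in \<open>auto intro: holomorphic_on_subset holomorphic_on_imp_continuous_on\<close>)
  then have "((\<lambda>s. g (cis (2 * pi * s)) / cis (2 * pi * s) ^ Suc k * (2 * pi * \<i> * cis (2 * pi * s)))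
       has_integral (2 * pi * \<i>) / fact k * (deriv ^^ k) g 0) {0..1}"
    unfolding has_contour_integral_def
  proof (rule has_integral_eq[rotated])
    fix s :: real
    assume "s \<in> {0..1}"
    then have "0 \<le> s" "s \<le> 1" by auto
    have c: "exp (2 * complex_of_real pi * \<i> * s) = cis (2 * pi * s)"
      by (simp add: cis_conv_exp mult_ac)
    have "vector_derivative (circlepath 0 1) (at s within {0..1}) =
        2 * pi * \<i> * 1 * exp (2 * complex_of_real pi * \<i> * s)"
      using vector_derivative_circlepath01[OF \<open>0 \<le> s\<close> \<open>s \<le> 1\<close>, of 0 1] by (simp only: of_real_1)
    then have v: "vector_derivative (circlepath 0 1) (at s within {0..1}) = 2 * pi * \<i> * cis (2 * pi * s)"
      by (simp only: mult_1_right c)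
    have p: "circlepath 0 1 s = cis (2 * pi * s)"
      unfolding circlepath c by simp
    show "g (circlepath 0 1 s) / (circlepath 0 1 s - 0) ^ Suc k *
        vector_derivative (circlepath 0 1) (at s within {0..1}) =
        g (cis (2 * pi * s)) / cis (2 * pi * s) ^ Suc k * (2 * pi * \<i> * cis (2 * pi * s))"
      unfolding v p diff_zero by (rule refl)
  qed
  from has_integral_mult_right[OF this, of "1 / (2 * pi * \<i>)"]
  have "((\<lambda>s. cnj (cis (2 * pi * s)) ^ k * g (cis (2 * pi * s)))
       has_integral 1 / (2 * pi * \<i>) * ((2 * pi * \<i>) / fact k * (deriv ^^ k) g 0)) {0..1}"
  proof (rule has_integral_eq[rotated])
    fix s :: real
    have "1 / (2 * pi * \<i>) * (g u / u ^ Suc k * (2 * pi * \<i> * u)) = cnj u ^ k * g u" if "u = cis (2 * pi * s)" for u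
    proof -
      have u: "u \<noteq> 0" "cnj u = 1 / u"
        by (simp_all add: that cis_cnj inverse_eq_divide flip: cis_inverse)
      show ?thesis
        unfolding u(2) using u(1) by (simp add: power_one_over)
    qed
    then show "1 / (2 * pi * \<i>) * (g (cis (2 * pi * s)) / cis (2 * pi * s) ^ Suc k * (2 * pi * \<i> * cis (2 * pi * s)))
        = cnj (cis (2 * pi * s)) ^ k * g (cis (2 * pi * s))"
      by blast
  qed
  moreover have "1 / (2 * pi * \<i>) * ((2 * pi * \<i>) / fact k * (deriv ^^ k) g 0) = (deriv ^^ k) g 0 / fact k"
    by simp
  ultimately show ?thesis
    by (simp only: integral_unique)
qed

text \<open>The coefficient \<open>k = 1\<close> on the line through \<open>z\<close>. Writing the
  derivative as an average of values of \<open>f\<close> transfers bounds, continuity and complex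
  differentiability from \<open>f\<close> to its derivatives.\<close>

lemma dir_deriv_circle:
  assumes "entire f"
  shows "dir_deriv f z v = integral {0..1} (\<lambda>s. cnj (cis (2 * pi * s)) * f (z + cis (2 * pi * s) *s v))"
proof -
  have "deriv (\<lambda>\<zeta>. f (z + \<zeta> *s v)) 0 = dir_deriv f z v"
    using DERIV_imp_deriv[OF entire_line_deriv[OF assms, of z v 0]] by simp
  then show ?thesis
    using circle_coefficient[OF entire_line_holomorphic[OF assms, of z v UNIV], of 1] by simp
qed

lemma norm_integral_unit_interval_le:
  fixes f :: "real \<Rightarrow> complex"
  assumes "continuous_on {0..1} f" "\<And>s. s \<in> {0..1} \<Longrightarrow> norm (f s) \<le> B"
  shows "norm (integral {0..1} f) \<le> B"
  using integral_bound[of 0 1 f B] assms by auto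

lemma norm_dir_deriv_le:
  assumes "entire f" "\<And>w. norm (w - z) \<le> norm v \<Longrightarrow> cmod (f w) \<le> B"
  shows "cmod (dir_deriv f z v) \<le> B"
  unfolding dir_deriv_circle[OF assms(1)]
proof (rule norm_integral_unit_interval_le)
  show "continuous_on {0..1} (\<lambda>s. cnj (cis (2 * pi * s)) * f (z + cis (2 * pi * s) *s v))"
    by (intro continuous_intros continuous_on_compose2[OF entire_continuous_on[OF assms(1), of UNIV]]) auto
qed (use assms(2) in \<open>auto simp: norm_mult norm_vector_smult\<close>)

lemma continuous_on_dir_deriv:
  assumes "entire f"
  shows "continuous_on A (\<lambda>z. dir_deriv f z v)"
proof -
  have "continuous_on A (\<lambda>z. integral (cbox 0 1) (\<lambda>s. cnj (cis (2 * pi * s)) * f (z + cis (2 * pi * s) *s v)))"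
    by (rule integral_continuous_on_param)
      (unfold split_beta, intro continuous_intros continuous_on_compose2[OF entire_continuous_on[OF assms, of UNIV]], auto)
  then show ?thesis
    unfolding dir_deriv_circle[OF assms] by simp
qed

text \<open>The affine argument covers the three averages in use: shifts along a circle
  (\<open>\<alpha> = 1\<close>), rotations and dilations (\<open>\<beta> = 0\<close>).\<close>

lemma has_derivative_parametric_integral:
  fixes \<alpha> :: "real \<Rightarrow> complex" and \<beta> :: "real \<Rightarrow> complex ^ 'n::finite"
  assumes f: "entire f"
    and [continuous_intros]: "continuous_on {0..1} \<phi>" "continuous_on {0..1} \<alpha>" "continuous_on {0..1} \<beta>"
  shows "((\<lambda>z. integral {0..1} (\<lambda>s. \<phi> s * f (\<alpha> s *s z + \<beta> s))) has_derivative
     (\<lambda>v. integral {0..1} (\<lambda>s. \<phi> s * \<alpha> s * dir_deriv f (\<alpha> s *s z + \<beta> s) v))) (at z)"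
proof -
  define D where "D z s = (\<lambda>v. \<phi> s * \<alpha> s * dir_deriv f (\<alpha> s *s z + \<beta> s) v)" for z s
  have der: "((\<lambda>z. \<phi> s * f (\<alpha> s *s z + \<beta> s)) has_derivative D z s) (at z)" for z s
  proof -
    have "((\<lambda>z. \<alpha> s *s z + \<beta> s) has_derivative (\<lambda>h. \<alpha> s *s h)) (at z)"
      by (auto intro!: derivative_eq_intros bounded_linear_imp_has_derivative[OF vector_smult.bounded_linear_right])
    from has_derivative_compose[OF this entire_has_derivative[OF f]]
    show ?thesis
      unfolding D_def by (auto intro!: derivative_eq_intros simp: dir_deriv_smult[OF f])
  qed
  have bl: "bounded_linear (D z s)" for z s
    using der has_derivative_bounded_linear by blast
  have contD: "continuous_on (UNIV \<times> {0..1}) (\<lambda>x. D (fst x) (snd x) v)" for v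
    unfolding D_def
    by (intro continuous_intros continuous_on_compose2[OF continuous_on_dir_deriv[OF f, of UNIV]]
          continuous_on_compose2[of "{0..1}" \<phi>] continuous_on_compose2[of "{0..1}" \<alpha>]
          continuous_on_compose2[of "{0..1}" \<beta>]) (auto intro: assms)
  have "((\<lambda>z. integral (cbox 0 1) (\<lambda>s. \<phi> s * f (\<alpha> s *s z + \<beta> s))) has_derivative
      integral (cbox 0 1) (\<lambda>s. Blinfun (D z s))) (at z within UNIV)"
  proof (rule leibniz_rule)
    show "((\<lambda>x. \<phi> t * f (\<alpha> t *s x + \<beta> t)) has_derivative blinfun_apply (Blinfun (D x t))) (at x within UNIV)" for x t
      using der bl by (simp add: bounded_linear_Blinfun_apply)
    show "(\<lambda>s. \<phi> s * f (\<alpha> s *s x + \<beta> s)) integrable_on cbox 0 1" for x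
      by (rule integrable_continuous)
        (auto intro!: continuous_intros continuous_on_compose2[OF entire_continuous_on[OF f, of UNIV]] assms)
    show "continuous_on (UNIV \<times> cbox 0 1) (\<lambda>(x, t). Blinfun (D x t))"
      unfolding split_beta
      by (rule continuous_on_blinfun_componentwise) (use contD bl in \<open>simp add: bounded_linear_Blinfun_apply\<close>)
  qed auto
  \<comment> \<open>The Leibniz rule delivers an integral in the space of bounded linear maps;
    evaluation at \<open>v\<close> is itself bounded and linear, so it commutes with this
    integral.\<close>
  moreover have "blinfun_apply (integral (cbox 0 1) (\<lambda>s. Blinfun (D z s))) = (\<lambda>v. integral (cbox 0 1) (\<lambda>s. D z s v))"
  proof (rule ext)
    fix v
    have "continuous_on (cbox 0 1) (\<lambda>s. Blinfun (D z s))"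
    proof (rule continuous_on_blinfun_componentwise)
      fix v :: "complex ^ 'n"
      have "continuous_on {0..1} (\<lambda>s. D (fst (z, s)) (snd (z, s)) v)"
        by (rule continuous_on_compose2[OF contD]) (auto intro!: continuous_intros)
      then show "continuous_on (cbox 0 1) (\<lambda>s. blinfun_apply (Blinfun (D z s)) v)"
        using bl by (simp add: bounded_linear_Blinfun_apply)
    qed
    then have "(\<lambda>s. Blinfun (D z s)) integrable_on cbox 0 1"
      by (rule integrable_continuous)
    from blinfun_apply_integral[OF this]
    show "blinfun_apply (integral (cbox 0 1) (\<lambda>s. Blinfun (D z s))) v = integral (cbox 0 1) (\<lambda>s. D z s v)"
      using bl by (simp add: bounded_linear_Blinfun_apply)
  qed
  ultimately show ?thesis
    by (simp add: D_def)
qed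

lemma
  fixes \<alpha> :: "real \<Rightarrow> complex" and \<beta> :: "real \<Rightarrow> complex ^ 'n::finite"
  assumes "entire f" "continuous_on {0..1} \<phi>" "continuous_on {0..1} \<alpha>" "continuous_on {0..1} \<beta>"
  shows entire_parametric_integral:
      "entire (\<lambda>z. integral {0..1} (\<lambda>s. \<phi> s * f (\<alpha> s *s z + \<beta> s)))" (is ?A)
    and dir_deriv_parametric_integral:
      "dir_deriv (\<lambda>z. integral {0..1} (\<lambda>s. \<phi> s * f (\<alpha> s *s z + \<beta> s))) z v =
        integral {0..1} (\<lambda>s. \<phi> s * \<alpha> s * dir_deriv f (\<alpha> s *s z + \<beta> s) v)" (is ?B)
proof -
  note D = has_derivative_parametric_integral[OF assms]
  show ?B
    by (simp add: dir_deriv_eq[OF D])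
  show ?A
    by (rule entireI[OF D])
      (simp add: dir_deriv_smult[OF assms(1)] mult_ac flip: integral_mult_right)
qed

lemma entire_dir_deriv:
  assumes "entire f"
  shows "entire (\<lambda>z. dir_deriv f z v)"
proof -
  have "entire (\<lambda>z. integral {0..1} (\<lambda>s. cnj (cis (2 * pi * s)) * f (1 *s z + cis (2 * pi * s) *s v)))"
    by (rule entire_parametric_integral) (intro assms continuous_intros)+
  then show ?thesis
    by (simp add: dir_deriv_circle[OF assms])
qed

lemma entire_partial_z:
  assumes "entire f"
  shows "entire (partial_z j f)"
proof -
  have "partial_z j f = (\<lambda>z. dir_deriv f z (axis j 1))"
    using partial_z_eq_dir_deriv[OF assms] by blast
  then show ?thesis
    by (simp add: entire_dir_deriv assms)
qed

section \<open>Homogeneous components\<close>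

text \<open>The component homogeneous of degree \<open>k\<close>, obtained as a Fourier coefficient
  of the circle action. As an average of rotated copies of \<open>f\<close>, it is entire by
  differentiation under the integral sign.\<close>

definition hcomp :: "nat \<Rightarrow> (complex ^ 'n::finite \<Rightarrow> complex) \<Rightarrow> complex ^ 'n \<Rightarrow> complex" where
  "hcomp k f z = integral {0..1} (\<lambda>s. cnj (cis (2 * pi * s)) ^ k * f (cis (2 * pi * s) *s z))"

lemma cnj_cis_mult_cis [simp]: "cnj (cis t) * cis t = 1" "cis t * cnj (cis t) = 1"
  by (simp_all add: cis_cnj cis_mult)

lemma hcomp_integrable:
  assumes "entire f"
  shows "(\<lambda>s. cnj (cis (2 * pi * s)) ^ k * f (cis (2 * pi * s) *s z)) integrable_on {0..1}"
  by (intro integrable_continuous_interval continuous_intros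
      continuous_on_compose2[OF entire_continuous_on[OF assms, of UNIV]]) auto

lemma entire_hcomp [intro]:
  assumes "entire f"
  shows "entire (hcomp k f)"
proof -
  have "entire (\<lambda>z. integral {0..1} (\<lambda>s. cnj (cis (2 * pi * s)) ^ k * f (cis (2 * pi * s) *s z + 0)))"
    by (intro entire_parametric_integral assms continuous_intros)
  then show ?thesis
    by (simp add: hcomp_def[abs_def])
qed

lemma hcomp_taylor:
  assumes "entire f"
  shows "hcomp k f z = (deriv ^^ k) (\<lambda>\<zeta>. f (\<zeta> *s z)) 0 / fact k"
  using circle_coefficient[of "\<lambda>\<zeta>. f (\<zeta> *s z)" k] entire_line_holomorphic[OF assms, of 0 z]
  by (simp add: hcomp_def)

lemma hcomp_sums:
  assumes "entire f"
  shows "(\<lambda>k. hcomp k f z) sums f z"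
proof -
  \<comment> \<open>The series is evaluated at 1, so the ball has to reach beyond radius 1.\<close>
  have "(\<lambda>\<zeta>. f (\<zeta> *s z)) holomorphic_on ball 0 2"
    using entire_line_holomorphic[OF assms, of 0 z] by simp
  from holomorphic_power_series[OF this, of 1] show ?thesis
    by (simp add: hcomp_taylor[OF assms])
qed

text \<open>Lets identities be checked in one degree at a time, where the Euler operator is a
  scalar.\<close>

lemma entire_eqI_hcomp:
  assumes "entire f" "entire g" "\<And>k z. hcomp k f z = hcomp k g z"
  shows "f = g"
proof
  fix z
  show "f z = g z"
    using hcomp_sums[OF assms(1), of z] hcomp_sums[OF assms(2), of z] assms(3)
    by (simp add: sums_iff)
qed

lemma hcomp_0:
  assumes "entire f"
  shows "hcomp 0 f z = f 0"
  by (simp add: hcomp_taylor[OF assms])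

lemma hcomp_add:
  assumes "entire f" "entire g"
  shows "hcomp k (\<lambda>z. f z + g z) z = hcomp k f z + hcomp k g z"
  using integral_add[OF hcomp_integrable[OF assms(1), of k z] hcomp_integrable[OF assms(2), of k z]]
  by (simp add: hcomp_def distrib_left)

lemma hcomp_cmult: "hcomp k (\<lambda>z. c * f z) z = c * hcomp k f z"
  unfolding hcomp_def by (simp add: mult.left_commute[of _ c])

lemma hcomp_multr: "hcomp k (\<lambda>z. f z * c) z = hcomp k f z * c"
  unfolding hcomp_def by (simp flip: mult.assoc)

lemma hcomp_diff:
  assumes "entire f" "entire g"
  shows "hcomp k (\<lambda>z. f z - g z) z = hcomp k f z - hcomp k g z"
  using hcomp_add[OF assms(1) entire_cmult[OF assms(2), of "-1"], of k z] hcomp_cmult[of k "-1" g z]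
  by simp

lemma hcomp_zero [simp]: "hcomp k (\<lambda>z. 0) z = 0"
  by (simp add: hcomp_def)

lemma hcomp_sum:
  "(\<And>i. i \<in> I \<Longrightarrow> entire (f i)) \<Longrightarrow> hcomp k (\<lambda>z. \<Sum>i\<in>I. f i z) z = (\<Sum>i\<in>I. hcomp k (f i) z)"
  by (induction I rule: infinite_finite_induct) (auto simp: hcomp_add entire_sum)

lemma hcomp_smult:
  assumes "entire f"
  shows "hcomp k f (c *s z) = c ^ k * hcomp k f z"
proof -
  have "(deriv ^^ k) (\<lambda>\<zeta>. f ((c * \<zeta>) *s z)) 0 = c ^ k * (deriv ^^ k) (\<lambda>\<zeta>. f (\<zeta> *s z)) (c * 0)"
    by (rule higher_deriv_compose_linear[where S=UNIV and T=UNIV and f="\<lambda>\<zeta>. f (\<zeta> *s z)"])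
      (use entire_line_holomorphic[OF assms, of 0 z] in auto)
  then show ?thesis
    by (simp add: hcomp_taylor[OF assms] vector_smult_assoc mult.commute[of c])
qed

lemma hcomp_homogeneous:
  assumes "entire f" "\<And>c z. f (c *s z) = c ^ k * f z"
  shows "hcomp l f z = (if l = k then f z else 0)"
proof -
  have "hcomp l f z = (deriv ^^ l) (\<lambda>\<zeta>. \<zeta> ^ k * f z) 0 / fact l"
    unfolding hcomp_taylor[OF assms(1)] assms(2) ..
  also have "(deriv ^^ l) (\<lambda>\<zeta>. \<zeta> ^ k * f z) 0 = (deriv ^^ l) (\<lambda>\<zeta>. \<zeta> ^ k) 0 * f z"
    using higher_deriv_cmult[of "\<lambda>\<zeta>. \<zeta> ^ k" UNIV 0 l "f z"]
    by (simp add: mult.commute holomorphic_intros)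
  also have "(deriv ^^ l) (\<lambda>\<zeta>::complex. \<zeta> ^ k) 0 = (if l = k then fact k else 0)"
    using higher_deriv_power[of l 0 k 0]
    by (auto simp: pochhammer_fact pochhammer_0_left power_0_left of_nat_diff)
  finally show ?thesis by simp
qed

lemma hcomp_hcomp:
  assumes "entire f"
  shows "hcomp l (hcomp k f) z = (if l = k then hcomp k f z else 0)"
  by (rule hcomp_homogeneous) (auto simp: hcomp_smult assms)

lemma hcomp_nth_mult: "hcomp (Suc k) (\<lambda>z. z $ j * f z) z = z $ j * hcomp k f z"
proof -
  have "cnj (cis t) ^ Suc k * ((cis t *s z) $ j * f (cis t *s z)) = z $ j * (cnj (cis t) ^ k * f (cis t *s z))" for t
  proof -
    have "cnj (cis t) ^ Suc k * ((cis t *s z) $ j * f (cis t *s z))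
        = (cnj (cis t) * cis t) * (z $ j * (cnj (cis t) ^ k * f (cis t *s z)))"
      by (simp only: vector_smult_component power_Suc mult_ac)
    then show ?thesis by simp
  qed
  then show ?thesis
    by (simp only: hcomp_def integral_mult_right)
qed

text \<open>Differentiating under the integral brings out one factor \<open>cis\<close>, which
  cancels one of the \<open>Suc k\<close> conjugates; hence the degree drops by one.\<close>

lemma dir_deriv_hcomp_Suc:
  assumes "entire f"
  shows "dir_deriv (hcomp (Suc k) f) z v = hcomp k (\<lambda>z. dir_deriv f z v) z"
proof -
  have "dir_deriv (hcomp (Suc k) f) z v =
      dir_deriv (\<lambda>z. integral {0..1} (\<lambda>s. cnj (cis (2 * pi * s)) ^ Suc k * f (cis (2 * pi * s) *s z + 0))) z v"
    by (simp add: hcomp_def[abs_def])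
  also have "\<dots> = integral {0..1} (\<lambda>s. cnj (cis (2 * pi * s)) ^ Suc k * cis (2 * pi * s) * dir_deriv f (cis (2 * pi * s) *s z + 0) v)"
    by (intro dir_deriv_parametric_integral assms continuous_intros)
  also have "\<dots> = hcomp k (\<lambda>z. dir_deriv f z v) z"
  proof -
    have "cnj (cis t) ^ Suc k * cis t = cnj (cis t) ^ k" for t
      by (simp only: power_Suc2 mult.assoc cnj_cis_mult_cis mult_1_right)
    then show ?thesis by (simp only: hcomp_def add_0_right)
  qed
  finally show ?thesis .
qed

lemma partial_z_hcomp_Suc:
  assumes "entire f"
  shows "partial_z j (hcomp (Suc k) f) z = hcomp k (partial_z j f) z"
proof -
  have "partial_z j f = (\<lambda>z. dir_deriv f z (axis j 1))"
    using partial_z_eq_dir_deriv[OF assms] by blast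
  then show ?thesis
    by (simp add: partial_z_eq_dir_deriv entire_hcomp assms dir_deriv_hcomp_Suc)
qed

lemma partial_z_hcomp_0:
  assumes "entire f"
  shows "partial_z j (hcomp 0 f) z = 0"
proof -
  have "hcomp 0 f = (\<lambda>z. f 0)"
    using hcomp_0[OF assms] by blast
  then show ?thesis
    by (simp add: partial_z_eq_dir_deriv)
qed

section \<open>The Euler operator\<close>

definition euler :: "(complex ^ 'n::finite \<Rightarrow> complex) \<Rightarrow> complex ^ 'n \<Rightarrow> complex" where
  "euler f z = (\<Sum>j\<in>UNIV. z $ j * partial_z j f z)"

lemma entire_euler: "entire f \<Longrightarrow> entire (euler f)"
  unfolding euler_def[abs_def] by (intro entire_sum entire_mult entire_nth entire_partial_z)

lemma hcomp_euler:
  assumes "entire f"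
  shows "hcomp k (euler f) z = of_nat k * hcomp k f z"
proof (cases k)
  case 0
  then show ?thesis
    by (simp add: hcomp_0 entire_euler assms) (simp add: euler_def)
next
  case (Suc m)
  let ?g = "\<lambda>\<zeta>. f (\<zeta> *s z)"
  have g: "(?g has_field_derivative dir_deriv f (\<zeta> *s z) z) (at \<zeta>)" for \<zeta>
    using entire_line_deriv[OF assms, of 0 z \<zeta>] by simp
  have dg: "deriv ?g = (\<lambda>\<zeta>. dir_deriv f (\<zeta> *s z) z)"
    using DERIV_imp_deriv[OF g] by blast
  have "hcomp k (euler f) z = (\<Sum>j\<in>UNIV. z $ j * hcomp m (partial_z j f) z)"
    unfolding euler_def[abs_def] Suc
    by (simp add: hcomp_sum hcomp_nth_mult entire_mult entire_partial_z assms)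
  \<comment> \<open>The direction \<open>z\<close> is now frozen while \<open>w\<close> varies, so
    this is a Taylor coefficient of the derivative of \<open>?g\<close>; the factor \<open>k\<close>
    then comes from \<open>fact k = k * fact m\<close>.\<close>
  also have "\<dots> = hcomp m (\<lambda>w. dir_deriv f w z) z"
    by (simp add: dir_deriv_eq_sum[OF assms] hcomp_sum hcomp_cmult entire_cmult entire_partial_z assms)
  also have "\<dots> = (deriv ^^ m) (deriv ?g) 0 / fact m"
    by (simp add: hcomp_taylor entire_dir_deriv assms dg)
  also have "\<dots> = of_nat k * ((deriv ^^ k) ?g 0 / fact k)"
    unfolding Suc funpow_Suc_right o_apply fact_Suc of_nat_mult by (simp add: field_simps del: of_nat_Suc)
  finally show ?thesis
    by (simp add: hcomp_taylor[OF assms])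
qed

lemma euler_hcomp:
  assumes "entire f"
  shows "euler (hcomp k f) z = of_nat k * hcomp k f z"
proof -
  have "hcomp l (euler (hcomp k f)) z = hcomp l (\<lambda>z. of_nat k * hcomp k f z) z" for l z
    by (simp add: hcomp_euler entire_hcomp assms hcomp_hcomp hcomp_cmult)
  then have "euler (hcomp k f) = (\<lambda>z. of_nat k * hcomp k f z)"
    by (intro entire_eqI_hcomp entire_euler entire_hcomp entire_cmult assms)
  then show ?thesis by simp
qed

text \<open>The circle average bounds the component on the unit ball, and homogeneity carries the
  bound outward. Thus uniform smallness on the unit ball alone controls each degree on all of
  space.\<close>

lemma norm_hcomp_le:
  assumes "entire f" "\<And>w. norm w \<le> 1 \<Longrightarrow> cmod (f w) \<le> B"
  shows "cmod (hcomp k f z) \<le> B * norm z ^ k"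
proof -
  have *: "cmod (hcomp k f w) \<le> B" if "norm w \<le> 1" for w
    unfolding hcomp_def
    by (rule norm_integral_unit_interval_le)
      (auto simp: norm_mult norm_power norm_vector_smult assms that
        intro!: continuous_intros continuous_on_compose2[OF entire_continuous_on[OF assms(1), of UNIV]])
  show ?thesis
  proof (cases "z = 0")
    \<comment> \<open>For \<open>k = 0\<close> the bound rests on \<open>0 ^ 0 = 1\<close>; for
      larger \<open>k\<close> homogeneity with factor 0 gives the value 0 at the origin.\<close>
    case True
    then show ?thesis
      using *[of 0] hcomp_smult[OF assms(1), of k 0 0] by (cases k) auto
  next
    case False
    define w where "w = complex_of_real (1 / norm z) *s z"
    have "z = complex_of_real (norm z) *s w" "norm w \<le> 1"
      using False by (auto simp: w_def vector_smult_assoc norm_vector_smult norm_divide)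
    then have "hcomp k f z = complex_of_real (norm z) ^ k * hcomp k f w"
      using hcomp_smult[OF assms(1)] by metis
    then show ?thesis
      using mult_right_mono[OF *[OF \<open>norm w \<le> 1\<close>], of "norm z ^ k"]
      by (simp add: norm_mult norm_power mult.commute)
  qed
qed

lemma hcomp_power_bound:
  assumes "entire f"
  obtains B where "0 \<le> B" "\<And>z k. cmod (hcomp k f z) \<le> B * norm z ^ k"
proof -
  have "compact (f ` cball 0 1)"
    by (intro compact_continuous_image entire_continuous_on assms) auto
  then obtain B where "\<forall>y \<in> f ` cball 0 1. cmod y \<le> B"
    using compact_imp_bounded[of "f ` cball 0 1"] unfolding bounded_iff by blast
  then have B: "\<And>w. norm w \<le> 1 \<Longrightarrow> cmod (f w) \<le> B"
    by simp
  from B[of 0] have "0 \<le> B"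
    using order_trans[OF norm_ge_zero] by auto
  then show ?thesis
    using that norm_hcomp_le[OF assms B] by blast
qed

section \<open>Parseval's identity on a circle\<close>

lemma integral_unit_interval_of_real:
  fixes g :: "real \<Rightarrow> real"
  assumes "continuous_on {0..1} g"
  shows "integral {0..1} (\<lambda>s. complex_of_real (g s)) = complex_of_real (integral {0..1} g)"
  using integral_linear[OF integrable_continuous_interval[OF assms] bounded_linear_of_real[where 'a=complex]]
  by (simp add: o_def)

text \<open>Only the conjugate factor of |f|^2 is expanded into its series. Integrating the term
  \<open>F k\<close> over the circle then reproduces a Fourier coefficient of \<open>f\<close>, so
  it contributes \<open>cnj (a k) * a k\<close> and no double series appears.\<close>

lemma hcomp_parseval:
  assumes f: "entire f"
  shows "(\<lambda>k. (cmod (hcomp k f z))\<^sup>2) sums integral {0..1} (\<lambda>s. (cmod (f (cis (2 * pi * s) *s z)))\<^sup>2)"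
proof -
  define u where "u s = cis (2 * pi * s)" for s
  define a where "a k = hcomp k f z" for k
  have cont: "continuous_on A (\<lambda>s. f (u s *s z))" for A
    unfolding u_def
    by (intro continuous_intros continuous_on_compose2[OF entire_continuous_on[OF f, of UNIV]]) auto
  have contu: "continuous_on A u" for A
    unfolding u_def by (intro continuous_intros)
  have "bounded ((\<lambda>s. f (u s *s z)) ` {0..1})"
    by (intro compact_imp_bounded compact_continuous_image cont) auto
  then obtain B where "\<forall>y \<in> (\<lambda>s. f (u s *s z)) ` {0..1}. cmod y \<le> B"
    unfolding bounded_iff by blast
  then have B: "\<And>s. s \<in> {0..1} \<Longrightarrow> cmod (f (u s *s z)) \<le> B"
    by blast
  \<comment> \<open>Convergence at \<open>2 *s z\<close> makes the coefficients decay geometrically,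
    which gives the absolute convergence for the M-test.\<close>
  have "summable (\<lambda>k. a k * 2 ^ k)"
    using sums_summable[OF hcomp_sums[OF f, of "2 *s z"]] by (simp add: a_def hcomp_smult[OF f] mult.commute)
  then have sa: "summable (\<lambda>k. cmod (a k))"
    using powser_insidea[of a 2 1] by simp
  define F where "F k s = cnj (a k) * (cnj (u s) ^ k * f (u s *s z))" for k s
  have "uniform_limit {0..1} (\<lambda>n s. \<Sum>k<n. F k s) (\<lambda>s. \<Sum>k. F k s) sequentially"
  proof (rule Weierstrass_m_test)
    show "norm (F k s) \<le> cmod (a k) * B" if "s \<in> {0..1}" for k s
      using B[OF that] by (simp add: F_def norm_mult norm_power u_def mult_left_mono)
    show "summable (\<lambda>k. cmod (a k) * B)"
      using sa by (rule summable_mult2)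
  qed
  moreover have "(\<Sum>k. F k s) = complex_of_real ((cmod (f (u s *s z)))\<^sup>2)" for s
  proof -
    have "(\<lambda>k. cnj (hcomp k f (u s *s z))) sums cnj (f (u s *s z))"
      by (simp add: sums_cnj hcomp_sums f)
    from sums_mult2[OF this, of "f (u s *s z)"]
    have "(\<lambda>k. F k s) sums (cnj (f (u s *s z)) * f (u s *s z))"
      by (simp only: F_def a_def hcomp_smult[OF f] complex_cnj_mult complex_cnj_power mult_ac)
    then show ?thesis
      unfolding complex_norm_square by (simp add: sums_iff mult.commute)
  qed
  ultimately have ul: "uniform_limit {0..1} (\<lambda>n s. \<Sum>k<n. F k s) (\<lambda>s. complex_of_real ((cmod (f (u s *s z)))\<^sup>2)) sequentially"
    by simp
  have Fint: "integral {0..1} (F k) = complex_of_real ((cmod (a k))\<^sup>2)" for k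
    unfolding F_def u_def integral_mult_right hcomp_def[symmetric] a_def complex_norm_square by (rule mult.commute)
  have Fcont: "continuous_on {0..1} (F k)" for k
    unfolding F_def by (intro continuous_intros cont contu)
  have "continuous_on {0..1} (\<lambda>s. \<Sum>k<n. F k s)" for n
    by (intro continuous_intros Fcont)
  then obtain I J where I: "\<And>n. ((\<lambda>s. \<Sum>k<n. F k s) has_integral I n) {0..1}"
    and J: "((\<lambda>s. complex_of_real ((cmod (f (u s *s z)))\<^sup>2)) has_integral J) {0..1}" and IJ: "I \<longlonglongrightarrow> J"
    using uniform_limit_integral[OF ul _ sequentially_bot] by metis
  have "I n = complex_of_real (\<Sum>k<n. (cmod (a k))\<^sup>2)" for n
    using integral_unique[OF I] by (simp add: integral_sum integrable_continuous_interval Fcont Fint)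
  moreover have "J = complex_of_real (integral {0..1} (\<lambda>s. (cmod (f (u s *s z)))\<^sup>2))"
    using integral_unique[OF J] integral_unit_interval_of_real[of "\<lambda>s. (cmod (f (u s *s z)))\<^sup>2"]
    by (simp add: continuous_intros cont)
  ultimately have "(\<lambda>n. complex_of_real (\<Sum>k<n. (cmod (a k))\<^sup>2)) \<longlonglongrightarrow>
      complex_of_real (integral {0..1} (\<lambda>s. (cmod (f (u s *s z)))\<^sup>2))"
    using IJ by presburger
  then show ?thesis
    unfolding sums_def a_def u_def tendsto_of_real_iff .
qed

section \<open>The radial mean as the inverse of the Euler operator plus p\<close>

definition radial_mean :: "nat \<Rightarrow> (complex ^ 'n::finite \<Rightarrow> complex) \<Rightarrow> complex ^ 'n \<Rightarrow> complex" where
  "radial_mean p f z = integral {0..1} (\<lambda>t. complex_of_real t ^ (p - 1) * f (complex_of_real t *s z))"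

lemma entire_radial_mean:
  assumes "entire f"
  shows "entire (radial_mean p f)"
proof -
  have "entire (\<lambda>z. integral {0..1} (\<lambda>t. complex_of_real t ^ (p - 1) * f (complex_of_real t *s z + 0)))"
    by (intro entire_parametric_integral assms continuous_intros)
  then show ?thesis
    by (simp add: radial_mean_def[abs_def])
qed

text \<open>After the two averages are exchanged, dilation by \<open>t\<close> multiplies the
  degree-\<open>k\<close> part by \<open>t ^ k\<close>; together with the weight this leaves the
  integral of \<open>t ^ (k + p - 1)\<close>.\<close>

lemma hcomp_radial_mean:
  assumes f: "entire f" and p: "1 \<le> p"
  shows "hcomp k (radial_mean p f) z = hcomp k f z / of_nat (k + p)"
proof -
  define H where "H s t = cnj (cis (2 * pi * s)) ^ k * (complex_of_real t ^ (p - 1) * f (complex_of_real t *s (cis (2 * pi * s) *s z)))" for s t :: real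
  have "hcomp k (radial_mean p f) z = integral (cbox 0 1) (\<lambda>s. integral (cbox 0 1) (H s))"
    by (simp add: hcomp_def radial_mean_def H_def[abs_def] vector_smult_assoc)
  also have "\<dots> = integral (cbox 0 1) (\<lambda>t. integral (cbox 0 1) (\<lambda>s. H s t))"
    unfolding H_def
    by (intro integral_swap_continuous)
      (unfold split_beta, intro continuous_intros continuous_on_compose2[OF entire_continuous_on[OF f, of UNIV]], auto)
  also have "\<dots> = integral {0..1} (\<lambda>t. hcomp k f z * complex_of_real (t ^ (k + p - 1)))"
  proof -
    have "H s t = complex_of_real t ^ (p - 1) * (cnj (cis (2 * pi * s)) ^ k * f (cis (2 * pi * s) *s (complex_of_real t *s z)))" for s t
      by (simp add: H_def vector_smult_assoc mult_ac)
    moreover have "complex_of_real t ^ (p - 1) * (complex_of_real t ^ k * w) = w * complex_of_real (t ^ (k + p - 1))" for t w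
      using p by (simp add: power_add[symmetric] add.commute)
    ultimately have "integral {0..1} (\<lambda>s. H s t) = hcomp k f z * complex_of_real (t ^ (k + p - 1))" for t
      by (simp only: integral_mult_right hcomp_def[symmetric] hcomp_smult[OF f])
    then show ?thesis by simp
  qed
  also have "\<dots> = hcomp k f z * complex_of_real (integral {0..1} (\<lambda>t. t ^ (k + p - 1)))"
    by (simp only: integral_mult_right integral_unit_interval_of_real continuous_on_power continuous_on_id)
  also have "integral {0..1} (\<lambda>t::real. t ^ (k + p - 1)) = 1 / real (k + p)"
  proof -
    have "((\<lambda>t::real. t ^ (k + p - 1)) has_integral 1 ^ (k + p) / real (k + p) - 0 ^ (k + p) / real (k + p)) {0..1}"
      using p by (intro fundamental_theorem_of_calculus)
        (auto intro!: derivative_eq_intros simp: has_real_derivative_iff_has_vector_derivative[symmetric])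
    then show ?thesis
      using p by (simp add: integral_unique)
  qed
  finally show ?thesis by simp
qed

lemma radial_mean_solves:
  assumes "entire f" "1 \<le> p"
  shows "euler (radial_mean p f) z + of_nat p * radial_mean p f z = f z"
proof -
  let ?u = "radial_mean p f"
  have "(\<lambda>z. euler ?u z + of_nat p * ?u z) = f"
  proof (rule entire_eqI_hcomp)
    fix k z
    \<comment> \<open>Degree 0 is the case where \<open>1 \<le> p\<close> is decisive.\<close>
    have "of_nat k + of_nat p \<noteq> (0::complex)"
      using assms(2) by (metis add_is_0 not_one_le_zero of_nat_add of_nat_eq_0_iff)
    then have "of_nat k * (w / of_nat (k + p)) + of_nat p * (w / of_nat (k + p)) = w" for w :: complex
      by (simp flip: distrib_right add_divide_distrib)
    then show "hcomp k (\<lambda>z. euler ?u z + of_nat p * ?u z) z = hcomp k f z"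
      by (simp add: hcomp_add hcomp_cmult hcomp_euler entire_euler entire_cmult entire_radial_mean assms(1)
          hcomp_radial_mean[OF assms])
  qed (intro entire_add entire_cmult entire_euler entire_radial_mean assms)+
  then show ?thesis by metis
qed

lemma euler_plus_injective:
  assumes "entire f" "entire g" "1 \<le> p"
    and eq: "\<And>z. euler f z + of_nat p * f z = euler g z + of_nat p * g z"
  shows "f = g"
proof (rule entire_eqI_hcomp)
  fix k z
  have *: "hcomp k (\<lambda>z. euler h z + of_nat p * h z) z = of_nat (k + p) * hcomp k h z" if "entire h" for h :: "complex ^ 'a \<Rightarrow> complex"
    by (simp add: hcomp_add hcomp_cmult hcomp_euler entire_euler entire_cmult that algebra_simps)
  have "of_nat (k + p) * hcomp k f z = of_nat (k + p) * hcomp k g z"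
    unfolding *[OF assms(1), symmetric] *[OF assms(2), symmetric] eq ..
  then show "hcomp k f z = hcomp k g z"
    using assms(3) by (simp del: of_nat_add)
qed fact+

section \<open>Rotation invariance and Gaussian integrals\<close>

lemma nn_integral_lborel_translate:
  fixes f :: "'a::euclidean_space \<Rightarrow> ennreal"
  assumes "f \<in> borel_measurable borel"
  shows "(\<integral>\<^sup>+x. f (x + t) \<partial>lborel) = (\<integral>\<^sup>+x. f x \<partial>lborel)"
proof -
  have "(\<integral>\<^sup>+x. f x \<partial>lborel) = (\<integral>\<^sup>+x. f x \<partial>distr lborel borel ((+) t))"
    by (simp add: lborel_distr_plus)
  also have "\<dots> = (\<integral>\<^sup>+x. f (x + t) \<partial>lborel)"
    by (subst nn_integral_distr) (use assms in \<open>auto simp: add.commute\<close>)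
  finally show ?thesis by simp
qed

lemma integral_lborel_translate:
  fixes f :: "'a::euclidean_space \<Rightarrow> 'b::euclidean_space"
  assumes "f \<in> borel_measurable borel"
  shows "(LINT x|lborel. f (x + t)) = (LINT x|lborel. f x)"
proof -
  have "(LINT x|lborel. f x) = (LINT x|distr lborel borel ((+) t). f x)"
    by (simp add: lborel_distr_plus)
  also have "\<dots> = (LINT x|lborel. f (x + t))"
    by (subst integral_distr) (use assms in \<open>auto simp: add.commute\<close>)
  finally show ?thesis by simp
qed

text \<open>
  As in the uniqueness proof of Haar measure: integrating \<^term>\<open>f (R x + y)\<close> over all \<^term>\<open>x\<close>
  and all \<^term>\<open>y\<close> in the unit ball in both orders gives the two sides times the volume of the ball.
\<close>

lemma nn_integral_linear_isometry:
  fixes f :: "'a::euclidean_space \<Rightarrow> ennreal" and R :: "'a \<Rightarrow> 'a"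
  assumes f [measurable]: "f \<in> borel_measurable borel"
    and R: "linear R" "\<And>x. norm (R x) = norm x"
  shows "(\<integral>\<^sup>+x. f (R x) \<partial>lborel) = (\<integral>\<^sup>+x. f x \<partial>lborel)"
proof -
  have [measurable]: "R \<in> borel_measurable borel"
    using R(1) by (intro borel_measurable_continuous_onI linear_continuous_on) (simp add: linear_conv_bounded_linear)
  have "inj R"
    using R by (simp add: linear_injective_0) (metis norm_eq_zero)
  then have surj: "surj R"
    using R(1) linear_injective_imp_surjective by blast
  define b :: "'a \<Rightarrow> ennreal" where "b = indicator (ball 0 1)"
  have [measurable]: "b \<in> borel_measurable borel"
    unfolding b_def by (intro borel_measurable_indicator) simp
  define V where "V = emeasure lborel (ball (0::'a) 1)"
  have V: "V \<noteq> 0" "V \<noteq> top"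
    using unit_ball_vol_pos[of "real DIM('a)"] by (auto simp: V_def emeasure_ball simp del: unit_ball_vol_pos)
  have "V * (\<integral>\<^sup>+x. f (R x) \<partial>lborel) = (\<integral>\<^sup>+y. b y * (\<integral>\<^sup>+x. f (R x) \<partial>lborel) \<partial>lborel)"
    by (subst nn_integral_multc) (measurable, simp add: V_def b_def)
  also have "\<dots> = (\<integral>\<^sup>+y. \<integral>\<^sup>+x. b y * f (R x + y) \<partial>lborel \<partial>lborel)"
  proof (rule nn_integral_cong)
    fix y
    obtain s where s: "y = R s" using surj by blast
    have "(\<integral>\<^sup>+x. f (R (x + s)) \<partial>lborel) = (\<integral>\<^sup>+x. f (R x) \<partial>lborel)"
      by (rule nn_integral_lborel_translate) measurable
    then show "b y * (\<integral>\<^sup>+x. f (R x) \<partial>lborel) = (\<integral>\<^sup>+x. b y * f (R x + y) \<partial>lborel)"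
      by (simp add: nn_integral_cmult s linear_add[OF R(1)])
  qed
  also have "\<dots> = (\<integral>\<^sup>+x. \<integral>\<^sup>+y. b y * f (R x + y) \<partial>lborel \<partial>lborel)"
    by (rule lborel_pair.Fubini') measurable
  also have "\<dots> = (\<integral>\<^sup>+x. \<integral>\<^sup>+y. b (y - R x) * f y \<partial>lborel \<partial>lborel)"
  proof (rule nn_integral_cong)
    fix x
    have "(\<integral>\<^sup>+y. b (y + R x - R x) * f (y + R x) \<partial>lborel) = (\<integral>\<^sup>+y. b (y - R x) * f y \<partial>lborel)"
      by (rule nn_integral_lborel_translate) measurable
    then show "(\<integral>\<^sup>+y. b y * f (R x + y) \<partial>lborel) = (\<integral>\<^sup>+y. b (y - R x) * f y \<partial>lborel)"
      by (simp add: add.commute)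
  qed
  also have "\<dots> = (\<integral>\<^sup>+y. \<integral>\<^sup>+x. b (y - R x) * f y \<partial>lborel \<partial>lborel)"
    by (rule lborel_pair.Fubini') measurable
  also have "\<dots> = (\<integral>\<^sup>+y. V * f y \<partial>lborel)"
  proof (rule nn_integral_cong)
    fix y
    obtain s where s: "y = R s" using surj by blast
    have "b (y - R x) = (indicator (ball s 1) x :: ennreal)" for x
      by (simp add: s flip: linear_diff[OF R(1)]) (simp add: b_def indicator_def R dist_norm)
    then have "(\<integral>\<^sup>+x. b (y - R x) * f y \<partial>lborel) = emeasure lborel (ball s 1) * f y"
      by (simp add: nn_integral_multc borel_measurable_indicator)
    then show "(\<integral>\<^sup>+x. b (y - R x) * f y \<partial>lborel) = V * f y"
      by (simp add: V_def emeasure_ball)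
  qed
  also have "\<dots> = V * (\<integral>\<^sup>+y. f y \<partial>lborel)"
    by (simp add: nn_integral_cmult)
  finally show ?thesis
    using V by (simp add: ennreal_mult_cancel_left)
qed

lemma nn_integral_rotate:
  fixes f :: "complex ^ 'n::finite \<Rightarrow> ennreal"
  assumes "f \<in> borel_measurable borel" "cmod c = 1"
  shows "(\<integral>\<^sup>+z. f (c *s z) \<partial>lborel) = (\<integral>\<^sup>+z. f z \<partial>lborel)"
  by (rule nn_integral_linear_isometry)
    (use assms in \<open>auto simp: norm_vector_smult bounded_linear.linear[OF vector_smult.bounded_linear_right]\<close>)

lemma measurable_vector_smult [measurable]:
  "(\<lambda>x. fst x *s snd x) \<in> borel_measurable (borel \<Otimes>\<^sub>M (borel :: (complex ^ 'n::finite) measure))"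
  unfolding borel_prod
  by (intro borel_measurable_continuous_onI continuous_intros)

text \<open>Averaging over rotations leaves the integral unchanged, and Fubini moves the average
  inside, where it is Parseval on each circle. The general weight serves both the Gaussian and the
  indicator of the unit ball; integrals in \<open>ennreal\<close> allow the value infinity, so that
  membership in the Fock space can be read off.\<close>

lemma nn_integral_hcomp_parseval:
  fixes F :: "complex ^ 'n::finite \<Rightarrow> complex" and W :: "complex ^ 'n \<Rightarrow> ennreal"
  assumes F: "entire F" and W [measurable]: "W \<in> borel_measurable borel"
    and rot: "\<And>c z. cmod c = 1 \<Longrightarrow> W (c *s z) = W z"
  shows "(\<integral>\<^sup>+z. ennreal ((cmod (F z))\<^sup>2) * W z \<partial>lborel) =
    (\<Sum>k. \<integral>\<^sup>+z. ennreal ((cmod (hcomp k F z))\<^sup>2) * W z \<partial>lborel)"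
proof -
  define u where "u s = cis (2 * pi * s)" for s :: real
  have [measurable]: "F \<in> borel_measurable borel" "\<And>k. hcomp k F \<in> borel_measurable borel"
    using F entire_hcomp[OF F] entire_measurable by auto
  have [measurable]: "u \<in> borel_measurable borel"
    unfolding u_def by (intro borel_measurable_continuous_onI continuous_intros)
  have m [measurable]: "(\<lambda>x. u (snd x) *s fst x) \<in> borel_measurable ((borel :: (complex ^ 'n) measure) \<Otimes>\<^sub>M borel)"
    using measurable_compose[OF _ measurable_vector_smult, of "\<lambda>x. (u (snd x), fst x)" "(borel :: (complex ^ 'n) measure) \<Otimes>\<^sub>M borel"]
    by simp
  define g where "g z = ennreal ((cmod (F z))\<^sup>2) * W z" for z
  have [measurable]: "g \<in> borel_measurable borel"
    unfolding g_def by measurable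
  have "(\<integral>\<^sup>+z. g z \<partial>lborel) = (\<integral>\<^sup>+s. indicator {0..1::real} s * (\<integral>\<^sup>+z. g z \<partial>lborel) \<partial>lborel)"
    by (simp add: nn_integral_multc)
  also have "\<dots> = (\<integral>\<^sup>+s. \<integral>\<^sup>+z. indicator {0..1::real} s * g (u s *s z) \<partial>lborel \<partial>lborel)"
  proof (rule nn_integral_cong)
    fix s
    have "(\<integral>\<^sup>+z. indicator {0..1::real} s * g (u s *s z) \<partial>lborel) = (\<integral>\<^sup>+z. indicator {0..1::real} s * g z \<partial>lborel)"
      by (rule nn_integral_rotate) (auto simp: u_def)
    then show "indicator {0..1} s * (\<integral>\<^sup>+z. g z \<partial>lborel) = (\<integral>\<^sup>+z. indicator {0..1::real} s * g (u s *s z) \<partial>lborel)"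
      by (simp add: nn_integral_cmult)
  qed
  also have "\<dots> = (\<integral>\<^sup>+z. \<integral>\<^sup>+s. indicator {0..1::real} s * g (u s *s z) \<partial>lborel \<partial>lborel)"
    by (rule lborel_pair.Fubini') measurable
  also have "\<dots> = (\<integral>\<^sup>+z. (\<Sum>k. ennreal ((cmod (hcomp k F z))\<^sup>2)) * W z \<partial>lborel)"
  proof (rule nn_integral_cong)
    fix z
    let ?h = "\<lambda>s. (cmod (F (u s *s z)))\<^sup>2"
    have cont: "continuous_on A ?h" for A
      unfolding u_def
      by (intro continuous_intros continuous_on_compose2[OF entire_continuous_on[OF F, of UNIV]]) auto
    have [measurable]: "?h \<in> borel_measurable borel"
      by (rule borel_measurable_continuous_onI[OF cont])
    have "(?h has_integral integral {0..1} ?h) {0..1}"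
      by (intro integrable_integral integrable_continuous_interval cont)
    then have "((\<lambda>s. indicator {0..1} s * ?h s) has_integral integral {0..1} ?h) UNIV"
      unfolding has_integral_restrict_UNIV[symmetric, of _ _ "{0..1}"]
      by (rule has_integral_eq[rotated]) (simp add: indicator_def)
    then have "(\<integral>\<^sup>+s. ennreal (indicator {0..1} s * ?h s) \<partial>lborel) = ennreal (integral {0..1} ?h)"
      by (intro nn_integral_has_integral_lborel) auto
    also have "\<dots> = (\<Sum>k. ennreal ((cmod (hcomp k F z))\<^sup>2))"
      unfolding u_def by (rule suminf_ennreal_eq[OF _ hcomp_parseval[OF F], symmetric]) simp
    finally have *: "(\<integral>\<^sup>+s. ennreal (indicator {0..1} s * ?h s) \<partial>lborel) = (\<Sum>k. ennreal ((cmod (hcomp k F z))\<^sup>2))" .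
    have "(\<integral>\<^sup>+s. indicator {0..1::real} s * g (u s *s z) \<partial>lborel) = (\<integral>\<^sup>+s. ennreal (indicator {0..1} s * ?h s) * W z \<partial>lborel)"
      by (intro nn_integral_cong) (simp add: g_def rot u_def split: split_indicator)
    also have "\<dots> = (\<Sum>k. ennreal ((cmod (hcomp k F z))\<^sup>2)) * W z"
      unfolding *[symmetric] by (rule nn_integral_multc) auto
    finally show "(\<integral>\<^sup>+s. indicator {0..1::real} s * g (u s *s z) \<partial>lborel) = (\<Sum>k. ennreal ((cmod (hcomp k F z))\<^sup>2)) * W z" .
  qed
  also have "\<dots> = (\<Sum>k. \<integral>\<^sup>+z. ennreal ((cmod (hcomp k F z))\<^sup>2) * W z \<partial>lborel)"
    unfolding ennreal_suminf_multc[symmetric] by (rule nn_integral_suminf) measurable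
  finally show ?thesis
    unfolding g_def .
qed

section \<open>Integrability against the Gaussian\<close>

lemma power_le_exp:
  fixes x :: real
  assumes "0 \<le> x"
  shows "x ^ m \<le> real m ^ m * exp x"
proof (cases "m = 0")
  case False
  \<comment> \<open>From \<open>t \<le> exp t\<close> at \<open>t = x / m\<close>; the m-th power of
    the right-hand side is \<open>exp x\<close>.\<close>
  have "(x / m) ^ m \<le> exp (x / m) ^ m"
    using exp_ge_add_one_self[of "x / m"] assms by (intro power_mono) (linarith, simp)
  also have "\<dots> = exp x"
    using False by (simp flip: exp_of_nat_mult)
  finally show ?thesis
    using False by (simp add: power_divide field_simps)
qed (use assms in simp)

text \<open>The Gaussian is a product over the coordinates, and each factor is a multiple of the
  standard normal density. The exponent is halved because the other half will absorb polynomial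
  factors.\<close>

lemma integrable_exp_neg_half_norm_square:
  "integrable lborel (\<lambda>x::'a::euclidean_space. exp (- ((norm x)\<^sup>2) / 2))"
proof (rule integrableI_nonneg)
  have "integrable lborel (\<lambda>x::real. sqrt (2 * pi) * std_normal_density x)"
    by (intro integrable_mult_right integrable_normal_density) simp
  then have "integrable lborel (\<lambda>x::real. exp (- (x\<^sup>2) / 2))"
    by (simp add: std_normal_density_def)
  then have *: "(\<integral>\<^sup>+x. ennreal (exp (- (x\<^sup>2) / 2)) \<partial>(lborel :: real measure)) < \<infinity>"
    by (simp add: integrable_iff_bounded)
  have "(norm x)\<^sup>2 = (\<Sum>b\<in>Basis. (x \<bullet> b)\<^sup>2)" for x :: 'a
    unfolding power2_norm_eq_inner by (subst euclidean_inner) (simp only: power2_eq_square)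
  then have "exp (- ((norm x)\<^sup>2) / 2) = (\<Prod>b\<in>Basis. exp (- ((x \<bullet> b)\<^sup>2) / 2))" for x :: 'a
    by (simp add: exp_sum[symmetric] sum_divide_distrib[symmetric] sum_negf)
  then have "(\<integral>\<^sup>+x. ennreal (exp (- ((norm x)\<^sup>2) / 2)) \<partial>(lborel :: 'a measure)) =
      (\<integral>\<^sup>+x. (\<Prod>b\<in>Basis. ennreal (exp (- ((x \<bullet> b)\<^sup>2) / 2))) \<partial>(lborel :: 'a measure))"
    by (simp add: prod_ennreal)
  also have "\<dots> = (\<Prod>b\<in>(Basis :: 'a set). (\<integral>\<^sup>+x. ennreal (exp (- (x\<^sup>2) / 2)) \<partial>(lborel :: real measure)))"
    by (rule nn_integral_lborel_prod) auto
  also have "\<dots> < \<infinity>"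
    using * by (simp add: power_less_top_ennreal)
  finally show "(\<integral>\<^sup>+x. ennreal (exp (- ((norm x)\<^sup>2) / 2)) \<partial>(lborel :: 'a measure)) < \<infinity>" .
qed auto

lemma integrable_polynomial_gaussian:
  fixes F :: "'a::euclidean_space \<Rightarrow> complex"
  assumes [measurable]: "F \<in> borel_measurable borel"
    and bound: "\<And>x. cmod (F x) \<le> B * (1 + norm x) ^ m"
  shows "integrable lborel (\<lambda>x. F x * of_real (exp (- (norm x)\<^sup>2)))"
proof (rule Bochner_Integration.integrable_bound)
  show "integrable lborel (\<lambda>x::'a. \<bar>B\<bar> * real m ^ m * exp 2 * exp (- ((norm x)\<^sup>2) / 2))"
    by (intro integrable_mult_right integrable_exp_neg_half_norm_square)
  show "AE x in lborel. norm (F x * of_real (exp (- (norm x)\<^sup>2))) \<le> norm (\<bar>B\<bar> * real m ^ m * exp 2 * exp (- ((norm x)\<^sup>2) / 2))"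
  proof (rule AE_I2)
    fix x :: 'a
    \<comment> \<open>Expanding gives \<open>norm x \<le> 1 / 2 + (norm x)\<^sup>2 / 2\<close>,
      hence a bound for \<open>1 + norm x\<close> with constant 3/2, rounded up to 2.\<close>
    have "0 \<le> (norm x - 1)\<^sup>2" by simp
    then have "1 + norm x \<le> 2 + (norm x)\<^sup>2 / 2"
      by (simp add: power2_diff)
    then have e: "exp (1 + norm x) \<le> exp 2 * exp ((norm x)\<^sup>2 / 2)"
      by (simp flip: exp_add)
    have "cmod (F x) \<le> \<bar>B\<bar> * (1 + norm x) ^ m"
      by (rule order_trans[OF bound]) (simp add: mult_right_mono)
    also have "\<dots> \<le> \<bar>B\<bar> * (real m ^ m * exp (1 + norm x))"
      by (intro mult_left_mono power_le_exp) auto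
    also have "\<dots> \<le> \<bar>B\<bar> * (real m ^ m * (exp 2 * exp ((norm x)\<^sup>2 / 2)))"
      by (intro mult_left_mono e) auto
    finally have "cmod (F x) * exp (- (norm x)\<^sup>2) \<le> \<bar>B\<bar> * (real m ^ m * (exp 2 * exp ((norm x)\<^sup>2 / 2))) * exp (- (norm x)\<^sup>2)"
      by (rule mult_right_mono) simp
    also have "\<dots> = \<bar>B\<bar> * real m ^ m * exp 2 * (exp ((norm x)\<^sup>2 / 2) * exp (- (norm x)\<^sup>2))"
      by (simp only: mult_ac)
    also have "exp ((norm x)\<^sup>2 / 2) * exp (- (norm x)\<^sup>2) = exp (- ((norm x)\<^sup>2) / 2)"
      by (simp flip: exp_add)
    finally show "norm (F x * of_real (exp (- (norm x)\<^sup>2))) \<le> norm (\<bar>B\<bar> * real m ^ m * exp 2 * exp (- ((norm x)\<^sup>2) / 2))"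
      by (simp add: norm_mult abs_mult)
  qed
qed measurable

text \<open>
  By the fundamental theorem of calculus \<^term>\<open>F (x + v) - F x\<close> is the integral of
  \<^term>\<open>D (x + s *\<^sub>R v) v\<close> over the unit interval; now integrate over \<^term>\<open>x\<close> and use
  translation invariance.
\<close>

lemma integral_directional_derivative_eq_0:
  fixes F :: "'a::euclidean_space \<Rightarrow> complex"
  assumes D: "\<And>x. (F has_derivative D x) (at x)"
    and cont: "continuous_on UNIV (\<lambda>x. D x v)"
    and F: "integrable lborel F" and Dv: "integrable lborel (\<lambda>x. D x v)"
  shows "(LINT x|lborel. D x v) = 0"
proof -
  define h where "h x = D x v" for x
  have [measurable]: "h \<in> borel_measurable borel"
    unfolding h_def by (rule borel_measurable_continuous_onI[OF cont])
  have conth: "continuous_on A (\<lambda>s. h (x + s *\<^sub>R v))" for A x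
    unfolding h_def by (intro continuous_on_compose2[OF cont] continuous_intros) auto
  have Fmeas [measurable]: "F \<in> borel_measurable borel"
    using F by auto
  have inner: "(LINT s|lborel. indicator {0..1} s *\<^sub>R h (x + s *\<^sub>R v)) = F (x + v) - F x" for x
  proof -
    have "((\<lambda>s. h (x + s *\<^sub>R v)) has_integral F (x + 1 *\<^sub>R v) - F (x + 0 *\<^sub>R v)) {0..1}"
    proof (rule fundamental_theorem_of_calculus)
      fix s :: real
      have "((\<lambda>s. x + s *\<^sub>R v) has_derivative (\<lambda>t. t *\<^sub>R v)) (at s)"
        by (auto intro!: derivative_eq_intros)
      from has_derivative_compose[OF this D]
      have "((\<lambda>s. F (x + s *\<^sub>R v)) has_derivative (\<lambda>t. D (x + s *\<^sub>R v) (t *\<^sub>R v))) (at s)" .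
      then have "((\<lambda>s. F (x + s *\<^sub>R v)) has_derivative (\<lambda>t. t *\<^sub>R h (x + s *\<^sub>R v))) (at s)"
        by (simp add: h_def linear_scale[OF has_derivative_linear[OF D]])
      then show "((\<lambda>s. F (x + s *\<^sub>R v)) has_vector_derivative h (x + s *\<^sub>R v)) (at s within {0..1})"
        by (simp add: has_vector_derivative_def has_derivative_at_withinI)
    qed simp
    then show ?thesis
      using set_borel_integral_eq_integral(2)[OF borel_integrable_atLeastAtMost'[OF conth]]
      by (simp add: set_lebesgue_integral_def integral_unique)
  qed
  define G where "G = (\<lambda>(s::real, x). indicator {0..1} s *\<^sub>R h (x + s *\<^sub>R v))"
  have Gm [measurable]: "G \<in> borel_measurable (lborel \<Otimes>\<^sub>M lborel)"
    unfolding G_def by measurable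
  have "integrable (lborel \<Otimes>\<^sub>M lborel) G"
  proof (rule integrableI_bounded)
    have "(\<integral>\<^sup>+p. ennreal (norm (G p)) \<partial>(lborel \<Otimes>\<^sub>M lborel)) = (\<integral>\<^sup>+s. \<integral>\<^sup>+x. ennreal (norm (G (s, x))) \<partial>lborel \<partial>lborel)"
      by (rule lborel.nn_integral_fst[symmetric]) measurable
    also have "\<dots> = (\<integral>\<^sup>+s. indicator {0..1::real} s * (\<integral>\<^sup>+x. ennreal (norm (h x)) \<partial>lborel) \<partial>lborel)"
    proof (rule nn_integral_cong)
      fix s :: real
      have "(\<integral>\<^sup>+x. ennreal (norm (G (s, x))) \<partial>lborel) = (\<integral>\<^sup>+x. indicator {0..1} s * ennreal (norm (h (x + s *\<^sub>R v))) \<partial>lborel)"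
        by (intro nn_integral_cong) (simp add: G_def split: split_indicator)
      also have "\<dots> = (\<integral>\<^sup>+x. indicator {0..1} s * ennreal (norm (h x)) \<partial>lborel)"
        by (rule nn_integral_lborel_translate) measurable
      finally show "(\<integral>\<^sup>+x. ennreal (norm (G (s, x))) \<partial>lborel) = indicator {0..1::real} s * (\<integral>\<^sup>+x. ennreal (norm (h x)) \<partial>lborel)"
        by (simp add: nn_integral_cmult)
    qed
    also have "\<dots> < \<infinity>"
      using Dv by (simp add: nn_integral_multc integrable_iff_bounded h_def)
    finally show "(\<integral>\<^sup>+p. ennreal (norm (G p)) \<partial>(lborel \<Otimes>\<^sub>M lborel)) < \<infinity>" .
  qed fact
  then have "(LINT x|lborel. LINT s|lborel. G (s, x)) = (LINT s|lborel. LINT x|lborel. G (s, x))"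
    using lborel_pair.Fubini_integral[of "\<lambda>s x. G (s, x)"] by simp
  also have "(LINT x|lborel. LINT s|lborel. G (s, x)) = (LINT x|lborel. F (x + v) - F x)"
    by (simp add: G_def inner)
  also have "\<dots> = 0"
  proof -
    have "integrable lborel (\<lambda>x. F (x + v))"
      using F nn_integral_lborel_translate[of "\<lambda>x. ennreal (norm (F x))" v] by (simp add: integrable_iff_bounded)
    then show ?thesis
      using F by (simp add: integral_lborel_translate)
  qed
  also have "(LINT s|lborel. LINT x|lborel. G (s, x)) = (LINT s|lborel. indicator {0..1::real} s *\<^sub>R (LINT x|lborel. h x))"
    by (simp add: G_def integral_lborel_translate)
  finally show ?thesis
    by (simp add: h_def)
qed

section \<open>The Fock space\<close>

lemma borel_measurable_cnj [measurable]: "cnj \<in> borel_measurable borel"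
  by (intro borel_measurable_continuous_onI continuous_intros)

text \<open>The squared norm with infinity as a possible value. \<open>fock_norm\<close> cannot
  express divergence, since a non-integrable function has Lebesgue integral 0 by convention, so
  membership tests are made with \<open>fock_nn\<close>.\<close>

definition fock_nn :: "(complex ^ 'n::finite \<Rightarrow> complex) \<Rightarrow> ennreal" where
  "fock_nn f = (\<integral>\<^sup>+z. ennreal ((cmod (f z))\<^sup>2) * ennreal (exp (- (norm z)\<^sup>2)) \<partial>lborel)"

lemma fock_space_iff: "f \<in> fock_space \<longleftrightarrow> entire f \<and> fock_nn f < \<infinity>"
proof (cases "entire f")
  case True
  then have [measurable]: "f \<in> borel_measurable borel" by (rule entire_measurable)
  show ?thesis
    using True unfolding fock_space_def fock_nn_def integrable_iff_bounded
    by (simp add: abs_mult ennreal_mult)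
qed (simp add: fock_space_def)

lemma fock_entire: "f \<in> fock_space \<Longrightarrow> entire f"
  by (simp add: fock_space_def)

lemma fock_measurable [measurable_dest]: "f \<in> fock_space \<Longrightarrow> f \<in> borel_measurable borel"
  by (simp add: fock_entire entire_measurable)

lemma fock_norm_nonneg [simp]: "0 \<le> fock_norm f"
  by (simp add: fock_norm_def)

lemma fock_norm_square: "(fock_norm f)\<^sup>2 = (LINT z|lborel. (cmod (f z))\<^sup>2 * exp (- (norm z)\<^sup>2))"
  by (simp add: fock_norm_def)

lemma fock_nn_eq:
  assumes "f \<in> fock_space"
  shows "fock_nn f = ennreal ((fock_norm f)\<^sup>2)"
proof -
  have "integrable lborel (\<lambda>z. (cmod (f z))\<^sup>2 * exp (- (norm z)\<^sup>2))"
    using assms by (simp add: fock_space_def)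
  then show ?thesis
    unfolding fock_norm_square fock_nn_def
    by (subst nn_integral_eq_integral[symmetric]) (auto simp: ennreal_mult)
qed

lemma fock_nn_parseval:
  assumes "entire F"
  shows "fock_nn F = (\<Sum>k. fock_nn (hcomp k F))"
  unfolding fock_nn_def
  by (rule nn_integral_hcomp_parseval[OF assms]) (auto simp: norm_vector_smult)

lemma fock_nn_hcomp_le: "entire f \<Longrightarrow> fock_nn (hcomp k f) \<le> fock_nn f"
  unfolding fock_nn_parseval[of f]
  using sum_le_suminf[of "\<lambda>k. fock_nn (hcomp k f)" "{k}"] by simp

lemma hcomp_fock: "f \<in> fock_space \<Longrightarrow> hcomp k f \<in> fock_space"
  using fock_nn_hcomp_le[of f k] by (auto simp: fock_space_iff intro: le_less_trans)

lemma fock_norm_parseval: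
  assumes "f \<in> fock_space"
  shows "(\<lambda>k. (fock_norm (hcomp k f))\<^sup>2) sums (fock_norm f)\<^sup>2"
proof -
  have "(\<Sum>k. ennreal ((fock_norm (hcomp k f))\<^sup>2)) = ennreal ((fock_norm f)\<^sup>2)"
    using fock_nn_parseval[OF fock_entire[OF assms]] by (simp add: fock_nn_eq assms hcomp_fock)
  moreover from this have "summable (\<lambda>k. (fock_norm (hcomp k f))\<^sup>2)"
    by (intro summable_suminf_not_top) auto
  ultimately show ?thesis
    by (simp add: suminf_ennreal2 suminf_nonneg sums_iff)
qed

section \<open>The Fock space as an inner product space\<close>

lemma fock_integrable_mult:
  assumes f: "f \<in> fock_space" and g: "g \<in> fock_space"
  shows "integrable lborel (\<lambda>z. f z * cnj (g z) * of_real (exp (- (norm z)\<^sup>2)))"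
proof (rule Bochner_Integration.integrable_bound)
  have [measurable]: "f \<in> borel_measurable borel" "g \<in> borel_measurable borel"
    using f g by (auto intro: fock_measurable)
  show "integrable lborel (\<lambda>z. (cmod (f z))\<^sup>2 * exp (- (norm z)\<^sup>2) + (cmod (g z))\<^sup>2 * exp (- (norm z)\<^sup>2))"
    using f g by (auto simp: fock_space_def)
  show "(\<lambda>z. f z * cnj (g z) * of_real (exp (- (norm z)\<^sup>2))) \<in> borel_measurable lborel"
    by measurable
  show "AE z in lborel. norm (f z * cnj (g z) * of_real (exp (- (norm z)\<^sup>2))) \<le>
      norm ((cmod (f z))\<^sup>2 * exp (- (norm z)\<^sup>2) + (cmod (g z))\<^sup>2 * exp (- (norm z)\<^sup>2))"
  proof (rule AE_I2)
    fix z
    have "2 * (cmod (f z) * cmod (g z)) \<le> (cmod (f z))\<^sup>2 + (cmod (g z))\<^sup>2"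
      using sum_squares_bound[of "cmod (f z)" "cmod (g z)"] by simp
    moreover have "0 \<le> cmod (f z) * cmod (g z)" by simp
    ultimately have "cmod (f z) * cmod (g z) \<le> (cmod (f z))\<^sup>2 + (cmod (g z))\<^sup>2" by linarith
    then have "cmod (f z) * cmod (g z) * exp (- (norm z)\<^sup>2) \<le> ((cmod (f z))\<^sup>2 + (cmod (g z))\<^sup>2) * exp (- (norm z)\<^sup>2)"
      by (rule mult_right_mono) simp
    then show "norm (f z * cnj (g z) * of_real (exp (- (norm z)\<^sup>2))) \<le>
      norm ((cmod (f z))\<^sup>2 * exp (- (norm z)\<^sup>2) + (cmod (g z))\<^sup>2 * exp (- (norm z)\<^sup>2))"
      by (simp add: norm_mult distrib_right)
  qed
qed

lemma fock_zero [simp]: "(\<lambda>z. 0) \<in> fock_space"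
  by (simp add: fock_space_def)

lemma fock_cmult:
  assumes "f \<in> fock_space"
  shows "(\<lambda>z. c * f z) \<in> fock_space"
  using assms by (auto simp: fock_space_def entire_cmult norm_mult power_mult_distrib mult.assoc)

lemma fock_multr: "f \<in> fock_space \<Longrightarrow> (\<lambda>z. f z * c) \<in> fock_space"
  using fock_cmult[of f c] by (simp add: mult.commute)

lemma fock_add:
  assumes "f \<in> fock_space" "g \<in> fock_space"
  shows "(\<lambda>z. f z + g z) \<in> fock_space"
proof -
  note f = assms(1) and g = assms(2)
  have [measurable]: "f \<in> borel_measurable borel" "g \<in> borel_measurable borel"
    using f g by (auto intro: fock_measurable)
  have "integrable lborel (\<lambda>z. (cmod (f z + g z))\<^sup>2 * exp (- (norm z)\<^sup>2))"
  proof (rule Bochner_Integration.integrable_bound)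
    show "integrable lborel (\<lambda>z. 2 * ((cmod (f z))\<^sup>2 * exp (- (norm z)\<^sup>2)) + 2 * ((cmod (g z))\<^sup>2 * exp (- (norm z)\<^sup>2)))"
      using f g by (auto simp: fock_space_def)
    show "AE z in lborel. norm ((cmod (f z + g z))\<^sup>2 * exp (- (norm z)\<^sup>2)) \<le>
        norm (2 * ((cmod (f z))\<^sup>2 * exp (- (norm z)\<^sup>2)) + 2 * ((cmod (g z))\<^sup>2 * exp (- (norm z)\<^sup>2)))"
    proof (rule AE_I2)
      fix z
      have "(cmod (f z + g z))\<^sup>2 \<le> (cmod (f z) + cmod (g z))\<^sup>2"
        by (intro power_mono norm_triangle_ineq) auto
      also have "\<dots> \<le> 2 * (cmod (f z))\<^sup>2 + 2 * (cmod (g z))\<^sup>2"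
        using sum_squares_bound[of "cmod (f z)" "cmod (g z)"] by (simp add: power2_sum)
      finally have "(cmod (f z + g z))\<^sup>2 * exp (- (norm z)\<^sup>2) \<le> (2 * (cmod (f z))\<^sup>2 + 2 * (cmod (g z))\<^sup>2) * exp (- (norm z)\<^sup>2)"
        by (rule mult_right_mono) simp
      then show "norm ((cmod (f z + g z))\<^sup>2 * exp (- (norm z)\<^sup>2)) \<le>
        norm (2 * ((cmod (f z))\<^sup>2 * exp (- (norm z)\<^sup>2)) + 2 * ((cmod (g z))\<^sup>2 * exp (- (norm z)\<^sup>2)))"
        by (simp add: distrib_right)
    qed
  qed measurable
  then show ?thesis
    using f g by (simp add: fock_space_def entire_add)
qed

lemma fock_sum: "(\<And>i. i \<in> I \<Longrightarrow> f i \<in> fock_space) \<Longrightarrow> (\<lambda>z. \<Sum>i\<in>I. f i z) \<in> fock_space"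
  by (induction I rule: infinite_finite_induct) (auto intro: fock_add)

lemma fock_diff: "f \<in> fock_space \<Longrightarrow> g \<in> fock_space \<Longrightarrow> (\<lambda>z. f z - g z) \<in> fock_space"
  using fock_add[OF _ fock_cmult[of g "-1"], of f] by simp

lemma fock_inner_commute: "fock_inner g f = cnj (fock_inner f g)"
  unfolding fock_inner_def Bochner_Integration.integral_cnj[symmetric] by (simp add: mult.commute)

lemma fock_inner_cmult_left: "fock_inner (\<lambda>z. c * f z) g = c * fock_inner f g"
  unfolding fock_inner_def by (simp add: mult.assoc)

lemma fock_inner_cmult_right: "fock_inner f (\<lambda>z. c * g z) = cnj c * fock_inner f g"
  by (metis complex_cnj_mult fock_inner_cmult_left fock_inner_commute)

lemma fock_inner_zero_left [simp]: "fock_inner (\<lambda>z. 0) g = 0"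
  by (simp add: fock_inner_def)

lemma fock_inner_zero_right [simp]: "fock_inner f (\<lambda>z. 0) = 0"
  by (simp add: fock_inner_def)

lemma fock_inner_add_left:
  assumes "f \<in> fock_space" "g \<in> fock_space" "h \<in> fock_space"
  shows "fock_inner (\<lambda>z. f z + g z) h = fock_inner f h + fock_inner g h"
  unfolding fock_inner_def
  by (subst Bochner_Integration.integral_add[symmetric])
    (auto simp: distrib_right intro: fock_integrable_mult assms)

lemma fock_inner_add_right:
  assumes "f \<in> fock_space" "g \<in> fock_space" "h \<in> fock_space"
  shows "fock_inner h (\<lambda>z. f z + g z) = fock_inner h f + fock_inner h g"
  using fock_inner_add_left[OF assms] by (metis complex_cnj_add fock_inner_commute)

lemma fock_inner_sum_left:
  assumes "\<And>i. i \<in> I \<Longrightarrow> f i \<in> fock_space" "h \<in> fock_space"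
  shows "fock_inner (\<lambda>z. \<Sum>i\<in>I. f i z) h = (\<Sum>i\<in>I. fock_inner (f i) h)"
  using assms by (induction I rule: infinite_finite_induct) (auto simp: fock_inner_add_left fock_sum)

lemma fock_inner_sum_right:
  assumes "\<And>i. i \<in> I \<Longrightarrow> f i \<in> fock_space" "h \<in> fock_space"
  shows "fock_inner h (\<lambda>z. \<Sum>i\<in>I. f i z) = (\<Sum>i\<in>I. fock_inner h (f i))"
  using assms by (induction I rule: infinite_finite_induct) (auto simp: fock_inner_add_right fock_sum)

lemma fock_inner_diff_right:
  assumes "f \<in> fock_space" "g \<in> fock_space" "h \<in> fock_space"
  shows "fock_inner h (\<lambda>z. f z - g z) = fock_inner h f - fock_inner h g"
  using fock_inner_add_right[OF assms(1) fock_cmult[OF assms(2), of "-1"] assms(3)]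
    fock_inner_cmult_right[of h "-1" g] by simp

lemma fock_inner_self: "fock_inner f f = of_real ((fock_norm f)\<^sup>2)"
proof -
  have "fock_inner f f = (LINT z|lborel. complex_of_real ((cmod (f z))\<^sup>2 * exp (- (norm z)\<^sup>2)))"
    unfolding fock_inner_def of_real_mult complex_norm_square ..
  then show ?thesis
    unfolding fock_norm_square by (simp only: integral_complex_of_real)
qed

text \<open>A zero norm only yields vanishing almost everywhere; by continuity the exceptional set
  is open, and a nonempty open set is not negligible.\<close>

lemma fock_norm_eq_0:
  assumes "f \<in> fock_space" "fock_norm f = 0"
  shows "f = (\<lambda>z. 0)"
proof -
  have [measurable]: "f \<in> borel_measurable borel"
    using assms(1) by (rule fock_measurable)
  have "fock_nn f = 0"
    using fock_nn_eq[OF assms(1)] assms(2) by simp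
  then have "AE z in lborel. ennreal ((cmod (f z))\<^sup>2) * ennreal (exp (- (norm z)\<^sup>2)) = 0"
    unfolding fock_nn_def by (subst (asm) nn_integral_0_iff_AE) auto
  then have "AE z in lborel. f z = 0"
    by eventually_elim (auto simp: ennreal_zero_less_mult_iff)
  then have "{z. f z \<noteq> 0} \<in> null_sets lborel"
    by (subst AE_iff_null_sets) auto
  then have "negligible {z. f z \<noteq> 0}"
    by (simp add: negligible_iff_null_sets null_sets_completionI)
  moreover have "open {z. f z \<noteq> 0}"
    using entire_continuous_on[OF fock_entire[OF assms(1)], of UNIV]
    by (intro open_Collect_neq continuous_on_const)
  ultimately have "{z. f z \<noteq> 0} = {}"
    using open_not_negligible by blast
  then show ?thesis by auto
qed

lemma fock_norm_cmult: "fock_norm (\<lambda>z. c * f z) = cmod c * fock_norm f"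
proof -
  have "(fock_norm (\<lambda>z. c * f z))\<^sup>2 = (cmod c * fock_norm f)\<^sup>2"
    unfolding power_mult_distrib fock_norm_square by (simp add: norm_mult power_mult_distrib mult.assoc)
  then show ?thesis by (simp add: power2_eq_iff_nonneg)
qed

lemma fock_nn_cmult:
  assumes "entire f"
  shows "fock_nn (\<lambda>z. c * f z) = ennreal ((cmod c)\<^sup>2) * fock_nn f"
proof -
  have [measurable]: "f \<in> borel_measurable borel"
    using assms by (rule entire_measurable)
  show ?thesis
    unfolding fock_nn_def
    by (subst nn_integral_cmult[symmetric]) (auto simp: norm_mult power_mult_distrib ennreal_mult mult.assoc)
qed

text \<open>Pointwise, the mixed term \<open>2 * x * y\<close> is at most
  \<open>b / a * x\<^sup>2 + a / b * y\<^sup>2\<close>; with \<open>a\<close> and \<open>b\<close>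
  the two norms, the integrated bound is exactly \<open>(a + b)\<^sup>2\<close>.\<close>

lemma fock_norm_triangle:
  assumes f: "f \<in> fock_space" and g: "g \<in> fock_space"
  shows "fock_norm (\<lambda>z. f z + g z) \<le> fock_norm f + fock_norm g"
proof (cases "fock_norm f = 0 \<or> fock_norm g = 0")
  case True
  then show ?thesis
    using fock_norm_eq_0[OF f] fock_norm_eq_0[OF g] by auto
next
  case False
  define a b where "a = fock_norm f" and "b = fock_norm g"
  have ab: "0 < a" "0 < b"
    using False fock_norm_nonneg[of f] fock_norm_nonneg[of g] by (auto simp: a_def b_def less_le)
  let ?e = "\<lambda>z. exp (- (norm z)\<^sup>2)"
  have int: "integrable lborel (\<lambda>z. (cmod (f z))\<^sup>2 * ?e z)" "integrable lborel (\<lambda>z. (cmod (g z))\<^sup>2 * ?e z)"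
    "integrable lborel (\<lambda>z. (cmod (f z + g z))\<^sup>2 * ?e z)"
    using f g fock_add[OF f g] by (auto simp: fock_space_def)
  have pointwise: "(cmod (f z + g z))\<^sup>2 \<le> (1 + b / a) * (cmod (f z))\<^sup>2 + (1 + a / b) * (cmod (g z))\<^sup>2" for z
  proof -
    let ?x = "cmod (f z)" and ?y = "cmod (g z)"
    have "0 \<le> (b * ?x - a * ?y)\<^sup>2 / (a * b)"
      using ab by simp
    also have "\<dots> = b / a * ?x\<^sup>2 + a / b * ?y\<^sup>2 - 2 * ?x * ?y"
      using ab by (simp add: field_simps power2_eq_square)
    finally have "(?x + ?y)\<^sup>2 \<le> (1 + b / a) * ?x\<^sup>2 + (1 + a / b) * ?y\<^sup>2"
      by (simp add: power2_sum distrib_right)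
    moreover have "(cmod (f z + g z))\<^sup>2 \<le> (?x + ?y)\<^sup>2"
      by (intro power_mono norm_triangle_ineq) auto
    ultimately show ?thesis by linarith
  qed
  have "(fock_norm (\<lambda>z. f z + g z))\<^sup>2 \<le> (LINT z|lborel. (1 + b / a) * ((cmod (f z))\<^sup>2 * ?e z) + (1 + a / b) * ((cmod (g z))\<^sup>2 * ?e z))"
    unfolding fock_norm_square
  proof (rule integral_mono)
    show "(cmod (f z + g z))\<^sup>2 * ?e z \<le> (1 + b / a) * ((cmod (f z))\<^sup>2 * ?e z) + (1 + a / b) * ((cmod (g z))\<^sup>2 * ?e z)" for z
      using mult_right_mono[OF pointwise[of z], of "?e z"] by (simp add: distrib_right mult.assoc)
  qed (use int in auto)
  also have "\<dots> = (1 + b / a) * a\<^sup>2 + (1 + a / b) * b\<^sup>2"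
    using int(1,2) by (simp add: a_def b_def fock_norm_square)
  also have "\<dots> = (a + b)\<^sup>2"
    using ab by (simp add: field_simps power2_eq_square)
  finally have "fock_norm (\<lambda>z. f z + g z) \<le> a + b"
    by (rule power2_le_imp_le) (use ab in simp)
  then show ?thesis
    by (simp only: a_def b_def)
qed

text \<open>Expresses the inner product by four norms, so that Parseval's identity for norms passes
  to inner products.\<close>

lemma fock_inner_polarization:
  assumes f: "f \<in> fock_space" and g: "g \<in> fock_space"
  defines "N \<equiv> \<lambda>c. complex_of_real ((fock_norm (\<lambda>z. f z + c * g z))\<^sup>2)"
  shows "fock_inner f g = (N 1 - N (-1) + \<i> * N \<i> - \<i> * N (-\<i>)) / 4"
proof -
  have "N c = fock_inner f f + cnj c * fock_inner f g + c * fock_inner g f + c * cnj c * fock_inner g g" for c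
    unfolding N_def fock_inner_self[symmetric]
    using fock_cmult[OF g, of c] fock_add[OF f fock_cmult[OF g], of c]
    by (simp add: fock_inner_add_left fock_inner_add_right f g fock_inner_cmult_left fock_inner_cmult_right algebra_simps)
  then show ?thesis
    by (simp add: algebra_simps)
qed

lemma fock_inner_parseval:
  assumes f: "f \<in> fock_space" and g: "g \<in> fock_space"
  shows "(\<lambda>k. fock_inner (hcomp k f) (hcomp k g)) sums fock_inner f g"
proof -
  have "(\<lambda>k. complex_of_real ((fock_norm (\<lambda>z. hcomp k f z + c * hcomp k g z))\<^sup>2)) sums complex_of_real ((fock_norm (\<lambda>z. f z + c * g z))\<^sup>2)" for c
  proof -
    have "hcomp k (\<lambda>z. f z + c * g z) = (\<lambda>z. hcomp k f z + c * hcomp k g z)" for k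
      by (simp add: hcomp_add hcomp_cmult fock_entire f g entire_cmult fun_eq_iff)
    then show ?thesis
      using sums_of_real[OF fock_norm_parseval[OF fock_add[OF f fock_cmult[OF g]], of c]] by simp
  qed
  then show ?thesis
    unfolding fock_inner_polarization[OF f g] fock_inner_polarization[OF hcomp_fock[OF f] hcomp_fock[OF g]]
    by (intro sums_divide sums_diff sums_add sums_mult)
qed

section \<open>Creation and annihilation operators\<close>

text \<open>The growth class in which integration by parts is carried out: closed under products,
  conjugates and, for entire functions, derivatives; its measurable members are integrable against
  the Gaussian.\<close>

definition poly_bounded :: "(complex ^ 'n::finite \<Rightarrow> complex) \<Rightarrow> bool" where
  "poly_bounded F \<longleftrightarrow> (\<exists>B m. \<forall>z. cmod (F z) \<le> B * (1 + norm z) ^ m)"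

lemma poly_boundedE:
  assumes "poly_bounded F"
  obtains B m where "0 \<le> B" "\<And>z. cmod (F z) \<le> B * (1 + norm z) ^ m"
proof -
  obtain B m where B: "\<And>z. cmod (F z) \<le> B * (1 + norm z) ^ m"
    using assms unfolding poly_bounded_def by blast
  from B[of 0] have "0 \<le> B"
    using order_trans[OF norm_ge_zero] by auto
  then show ?thesis using that B by blast
qed

lemma poly_bounded_nth [simp]: "poly_bounded (\<lambda>z. z $ j)"
  unfolding poly_bounded_def
proof (intro exI allI)
  show "cmod (z $ j) \<le> 1 * (1 + norm z) ^ 1" for z :: "complex ^ 'a"
    using Finite_Cartesian_Product.norm_nth_le[of z j] by simp
qed

lemma poly_bounded_dominated:
  assumes "poly_bounded F" "\<And>z. cmod (G z) \<le> cmod (F z)"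
  shows "poly_bounded G"
  using assms unfolding poly_bounded_def by (meson order_trans)

lemma poly_bounded_mult:
  assumes "poly_bounded F" "poly_bounded G"
  shows "poly_bounded (\<lambda>z. F z * G z)"
proof -
  obtain B m where B: "0 \<le> B" "\<And>z. cmod (F z) \<le> B * (1 + norm z) ^ m"
    using poly_boundedE[OF assms(1)] by blast
  obtain C k where C: "0 \<le> C" "\<And>z. cmod (G z) \<le> C * (1 + norm z) ^ k"
    using poly_boundedE[OF assms(2)] by blast
  have "cmod (F z * G z) \<le> (B * C) * (1 + norm z) ^ (m + k)" for z
    using mult_mono[OF B(2) C(2), of z z] B(1) by (simp add: norm_mult power_add mult_ac)
  then show ?thesis
    unfolding poly_bounded_def by blast
qed

text \<open>The Cauchy estimate on the ball of radius \<open>norm v\<close> costs only a constant,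
  as \<open>1 + norm w \<le> (1 + norm v) * (1 + norm z)\<close> there.\<close>

lemma poly_bounded_dir_deriv:
  assumes "entire f" "poly_bounded f"
  shows "poly_bounded (\<lambda>z. dir_deriv f z v)"
proof -
  obtain B m where B: "0 \<le> B" "\<And>z. cmod (f z) \<le> B * (1 + norm z) ^ m"
    using poly_boundedE[OF assms(2)] by blast
  have "cmod (dir_deriv f z v) \<le> B * (1 + norm v) ^ m * (1 + norm z) ^ m" for z
  proof (rule norm_dir_deriv_le[OF assms(1)])
    fix w
    assume "norm (w - z) \<le> norm v"
    then have "1 + norm w \<le> 1 + norm z + norm v"
      using norm_triangle_ineq[of z "w - z"] by simp
    also have "\<dots> \<le> (1 + norm v) * (1 + norm z)"
      by (simp add: algebra_simps)
    finally have "(1 + norm w) ^ m \<le> ((1 + norm v) * (1 + norm z)) ^ m"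
      by (intro power_mono) auto
    then show "cmod (f w) \<le> B * (1 + norm v) ^ m * (1 + norm z) ^ m"
      using B mult_left_mono[OF _ B(1)] by (metis (no_types, opaque_lifting) mult.assoc order_trans power_mult_distrib)
  qed
  then show ?thesis
    unfolding poly_bounded_def by blast
qed

lemma poly_bounded_partial_z:
  assumes "entire f" "poly_bounded f"
  shows "poly_bounded (partial_z j f)"
  using poly_bounded_dir_deriv[OF assms, of "axis j 1"] partial_z_eq_dir_deriv[OF assms(1)]
  by (simp add: poly_bounded_def)

text \<open>Homogeneity caps the growth of each component however fast \<open>f\<close> itself
  grows; this opens integration by parts to arbitrary entire functions, degree by degree.\<close>

lemma poly_bounded_hcomp:
  assumes "entire f"
  shows "poly_bounded (hcomp k f)"
proof -
  obtain B where "0 \<le> B" "\<And>z k. cmod (hcomp k f z) \<le> B * norm z ^ k"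
    using hcomp_power_bound[OF assms] by blast
  then have "cmod (hcomp k f z) \<le> B * (1 + norm z) ^ k" for z
    by (meson add_increasing mult_left_mono norm_ge_zero order_refl order_trans power_mono zero_le_one)
  then show ?thesis
    unfolding poly_bounded_def by blast
qed

lemma poly_bounded_integrable:
  assumes "poly_bounded F" "F \<in> borel_measurable borel"
  shows "integrable lborel (\<lambda>z. F z * of_real (exp (- (norm z)\<^sup>2)))"
  using assms integrable_polynomial_gaussian unfolding poly_bounded_def by blast

lemma poly_bounded_cnj: "poly_bounded F \<Longrightarrow> poly_bounded (\<lambda>z. cnj (F z))"
  by (simp add: poly_bounded_def)

lemma poly_bounded_fock:
  assumes "entire f" "poly_bounded f"
  shows "f \<in> fock_space"
proof -
  have [measurable]: "f \<in> borel_measurable borel"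
    using assms(1) by (rule entire_measurable)
  have "integrable lborel (\<lambda>z. f z * cnj (f z) * of_real (exp (- (norm z)\<^sup>2)))"
    by (intro poly_bounded_integrable poly_bounded_mult poly_bounded_cnj assms) measurable
  from integrable_norm[OF this] show ?thesis
    using assms(1) by (simp add: fock_space_def norm_mult power2_eq_square)
qed

lemma fock_space_hcomp: "entire f \<Longrightarrow> hcomp k f \<in> fock_space"
  by (intro poly_bounded_fock poly_bounded_hcomp entire_hcomp)

text \<open>
  On polynomially bounded entire functions, \<^term>\<open>partial_z j\<close> and multiplication by $z_j$ are
  formally adjoint: integrate the derivatives of $f \bar h e^{-|z|^2}$ in the directions of
  the real and of the imaginary part of $z_j$, and combine.
\<close>

lemma fock_inner_partial_z:
  assumes f: "entire f" "poly_bounded f" and h: "entire h" "poly_bounded h"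
  shows "fock_inner (partial_z j f) h = fock_inner f (\<lambda>z. z $ j * h z)"
proof -
  let ?e = "\<lambda>z :: complex ^ 'a. complex_of_real (exp (- (norm z)\<^sup>2))"
  have [measurable]: "f \<in> borel_measurable borel" "h \<in> borel_measurable borel"
      "partial_z j f \<in> borel_measurable borel" "partial_z j h \<in> borel_measurable borel"
      "(\<lambda>z :: complex ^ 'a. z $ j) \<in> borel_measurable borel"
    using f h by (auto intro!: entire_measurable entire_partial_z)
  have int: "integrable lborel (\<lambda>z. partial_z j f z * cnj (h z) * ?e z)"
      "integrable lborel (\<lambda>z. f z * cnj (partial_z j h z) * ?e z)"
      "integrable lborel (\<lambda>z. f z * cnj (h z) * of_real (Re (z $ j)) * ?e z)"
      "integrable lborel (\<lambda>z. f z * cnj (h z) * of_real (Im (z $ j)) * ?e z)"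
      "integrable lborel (\<lambda>z. f z * cnj (h z) * ?e z)"
    by (intro poly_bounded_integrable poly_bounded_mult poly_bounded_cnj poly_bounded_partial_z f h
        poly_bounded_dominated[OF poly_bounded_nth[of j]]; simp add: abs_Re_le_cmod abs_Im_le_cmod; fail)+
  define A where "A = (LINT z|lborel. partial_z j f z * cnj (h z) * ?e z)"
  define B where "B = (LINT z|lborel. f z * cnj (partial_z j h z) * ?e z)"
  define X where "X = (LINT z|lborel. f z * cnj (h z) * of_real (Re (z $ j)) * ?e z)"
  define Y where "Y = (LINT z|lborel. f z * cnj (h z) * of_real (Im (z $ j)) * ?e z)"
  \<comment> \<open>\<open>axis j c\<close> runs through the real directions of the j-th coordinate
    plane. The factor \<open>f\<close> contributes \<open>c\<close>, the conjugated factor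
    \<open>cnj c\<close>; taking \<open>c = 1\<close> and \<open>c = \<i>\<close> later eliminates
    the unwanted \<open>B\<close>.\<close>
  have key: "c * A + cnj c * B - 2 * of_real (Re c) * X - 2 * of_real (Im c) * Y = 0" for c
  proof -
    define D where "D z v = (f z * cnj (dir_deriv h z v) + dir_deriv f z v * cnj (h z)) * ?e z
        + (f z * cnj (h z)) * of_real (- (2 * (z \<bullet> v)) * exp (- (norm z)\<^sup>2))" for z v
    have der: "((\<lambda>z. f z * cnj (h z) * ?e z) has_derivative D z) (at z)" for z
    proof -
      have "((\<lambda>z::complex ^ 'a. exp (- (z \<bullet> z))) has_derivative (\<lambda>v. - (2 * (z \<bullet> v)) * exp (- (z \<bullet> z)))) (at z)"
        by (auto intro!: derivative_eq_intros simp: inner_commute)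
      then have e: "((\<lambda>z::complex ^ 'a. ?e z) has_derivative (\<lambda>v. of_real (- (2 * (z \<bullet> v)) * exp (- (norm z)\<^sup>2)))) (at z)"
        unfolding power2_norm_eq_inner by (rule has_derivative_of_real)
      have c: "((\<lambda>z. cnj (h z)) has_derivative (\<lambda>v. cnj (dir_deriv h z v))) (at z)"
        by (rule has_derivative_cnj) (rule entire_has_derivative[OF h(1)])
      show ?thesis
        unfolding D_def
        by (rule has_derivative_eq_rhs[OF has_derivative_mult[OF has_derivative_mult[OF entire_has_derivative[OF f(1)] c] e]])
          (simp add: fun_eq_iff algebra_simps)
    qed
    have ax: "axis j c = c *s axis j 1"
      by (simp add: axis_def vec_eq_iff)
    have D_axis: "D z (axis j c) = c * (partial_z j f z * cnj (h z) * ?e z) + cnj c * (f z * cnj (partial_z j h z) * ?e z)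
        - 2 * of_real (Re c) * (f z * cnj (h z) * of_real (Re (z $ j)) * ?e z)
        - 2 * of_real (Im c) * (f z * cnj (h z) * of_real (Im (z $ j)) * ?e z)" for z
    proof -
      have "dir_deriv f z (axis j c) = c * partial_z j f z" "dir_deriv h z (axis j c) = c * partial_z j h z"
        unfolding ax by (simp_all only: dir_deriv_smult f h partial_z_eq_dir_deriv)
      moreover have "z \<bullet> axis j c = Re (z $ j) * Re c + Im (z $ j) * Im c"
        by (simp add: inner_axis inner_complex_def)
      ultimately show ?thesis
        unfolding D_def by (simp add: algebra_simps)
    qed
    have contD: "continuous_on UNIV (\<lambda>z. D z (axis j c))"
      unfolding D_def
      by (intro continuous_intros entire_continuous_on[OF f(1)] entire_continuous_on[OF h(1)]
          continuous_on_dir_deriv f h)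
    have hb: "has_bochner_integral lborel (\<lambda>z. D z (axis j c)) (c * A + cnj c * B - 2 * of_real (Re c) * X - 2 * of_real (Im c) * Y)"
      unfolding D_axis A_def B_def X_def Y_def
      by (intro has_bochner_integral_diff has_bochner_integral_add has_bochner_integral_mult_right
          has_bochner_integral_integrable int)
    have "(LINT z|lborel. D z (axis j c)) = 0"
      by (rule integral_directional_derivative_eq_0[OF der contD int(5)])
        (use hb in \<open>auto simp: has_bochner_integral_iff\<close>)
    then show ?thesis
      using has_bochner_integral_integral_eq[OF hb] by (simp only:)
  qed
  have "fock_inner f (\<lambda>z. z $ j * h z) = X - \<i> * Y"
  proof -
    have "f z * cnj (z $ j * h z) * ?e z = f z * cnj (h z) * of_real (Re (z $ j)) * ?e z - \<i> * (f z * cnj (h z) * of_real (Im (z $ j)) * ?e z)" for z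
    proof -
      have *: "cnj (z $ j) = of_real (Re (z $ j)) - \<i> * of_real (Im (z $ j))"
        by (simp add: complex_eq_iff)
      show ?thesis
        unfolding complex_cnj_mult * by (simp add: algebra_simps)
    qed
    then show ?thesis
      unfolding fock_inner_def X_def Y_def using int(3,4) by simp
  qed
  moreover have "A = X - \<i> * Y"
  proof -
    have "A + B = 2 * X" "\<i> * (A - B) = 2 * Y"
      using key[of 1] key[of \<i>] by (simp_all add: algebra_simps)
    moreover have "A = ((A + B) - \<i> * (\<i> * (A - B))) / 2"
      by (simp add: algebra_simps flip: mult.assoc)
    ultimately have "A = (2 * X - \<i> * (2 * Y)) / 2"
      by metis
    then show ?thesis
      by (simp add: diff_divide_distrib)
  qed
  ultimately show ?thesis
    by (simp add: A_def fock_inner_def)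
qed

text \<open>Summed over all variables, the squared norms of the derivatives equal the inner product
  of \<open>g\<close> with \<open>euler g\<close>, which is \<open>k\<close> times the squared norm
  of \<open>g\<close>; a single summand is at most that.\<close>

lemma fock_norm_partial_z_hcomp:
  assumes "entire f"
  shows "(fock_norm (partial_z j (hcomp k f)))\<^sup>2 \<le> real k * (fock_norm (hcomp k f))\<^sup>2"
proof -
  define g where "g = hcomp k f"
  have g: "entire g" "poly_bounded g"
    using assms by (auto simp: g_def entire_hcomp poly_bounded_hcomp)
  have G: "(\<lambda>z. z $ i * partial_z i g z) \<in> fock_space" for i
    by (intro poly_bounded_fock poly_bounded_mult poly_bounded_nth poly_bounded_partial_z entire_mult
        entire_nth entire_partial_z g)
  have "complex_of_real (\<Sum>i\<in>UNIV. (fock_norm (partial_z i g))\<^sup>2) = (\<Sum>i\<in>UNIV. fock_inner (partial_z i g) (partial_z i g))"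
    by (simp add: fock_inner_self)
  also have "\<dots> = (\<Sum>i\<in>UNIV. fock_inner g (\<lambda>z. z $ i * partial_z i g z))"
    by (simp add: fock_inner_partial_z g entire_partial_z poly_bounded_partial_z)
  also have "\<dots> = fock_inner g (euler g)"
    unfolding euler_def[abs_def]
    by (rule fock_inner_sum_right[symmetric]) (auto intro: G poly_bounded_fock g)
  also have "\<dots> = fock_inner g (\<lambda>z. of_nat k * g z)"
  proof -
    have "euler g = (\<lambda>z. of_nat k * g z)"
      unfolding g_def by (rule ext) (rule euler_hcomp[OF assms])
    then show ?thesis by (simp only:)
  qed
  also have "\<dots> = complex_of_real (real k * (fock_norm g)\<^sup>2)"
    by (simp add: fock_inner_cmult_right fock_inner_self)
  finally have "(\<Sum>i\<in>UNIV. (fock_norm (partial_z i g))\<^sup>2) = real k * (fock_norm g)\<^sup>2"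
    by (simp only: of_real_eq_iff)
  moreover have "(fock_norm (partial_z j g))\<^sup>2 \<le> (\<Sum>i\<in>UNIV. (fock_norm (partial_z i g))\<^sup>2)"
    by (rule member_le_sum) auto
  ultimately show ?thesis
    by (simp add: g_def)
qed

text \<open>This is the commutation relation: moving \<open>z $ j\<close> across the inner product
  gives the derivative of \<open>z $ j * g z\<close>, whose product rule leaves the extra term
  \<open>g\<close>.\<close>

lemma fock_norm_nth_mult:
  assumes g: "entire g" "poly_bounded g"
  shows "(fock_norm (\<lambda>z. z $ j * g z))\<^sup>2 = (fock_norm g)\<^sup>2 + (fock_norm (partial_z j g))\<^sup>2"
proof -
  have zg: "entire (\<lambda>z. z $ j * g z)" "poly_bounded (\<lambda>z. z $ j * g z)"
    by (intro entire_mult poly_bounded_mult poly_bounded_nth entire_nth g)+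
  have zdg: "(\<lambda>z. z $ j * partial_z j g z) \<in> fock_space"
    by (intro poly_bounded_fock poly_bounded_mult poly_bounded_nth poly_bounded_partial_z entire_mult
        entire_nth entire_partial_z g)
  have "partial_z j (\<lambda>z. z $ j * g z) = (\<lambda>z. z $ j * partial_z j g z + g z)"
    by (simp add: fun_eq_iff partial_z_eq_dir_deriv zg g dir_deriv_mult dir_deriv_nth)
  then have "fock_inner (\<lambda>z. z $ j * g z) (\<lambda>z. z $ j * g z) = fock_inner (\<lambda>z. z $ j * partial_z j g z + g z) g"
    using fock_inner_partial_z[OF zg g, of j] by simp
  also have "\<dots> = fock_inner (\<lambda>z. z $ j * partial_z j g z) g + fock_inner g g"
    by (intro fock_inner_add_left zdg poly_bounded_fock g)
  also have "fock_inner (\<lambda>z. z $ j * partial_z j g z) g = cnj (fock_inner (partial_z j g) (partial_z j g))"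
    by (subst fock_inner_partial_z) (auto simp: g entire_partial_z poly_bounded_partial_z fock_inner_commute[of g])
  finally have "complex_of_real ((fock_norm (\<lambda>z. z $ j * g z))\<^sup>2) = complex_of_real ((fock_norm (partial_z j g))\<^sup>2 + (fock_norm g)\<^sup>2)"
    by (simp add: fock_inner_self)
  then show ?thesis
    by (simp only: of_real_eq_iff)
qed

lemma fock_norm_nth_mult_hcomp:
  assumes "entire f"
  shows "(fock_norm (\<lambda>z. z $ j * hcomp k f z))\<^sup>2 \<le> real (Suc k) * (fock_norm (hcomp k f))\<^sup>2"
  using fock_norm_nth_mult[OF entire_hcomp[OF assms] poly_bounded_hcomp[OF assms], of j k]
    fock_norm_partial_z_hcomp[OF assms, of j k] by (simp add: algebra_simps)

section \<open>The adjoint of the \<open>\<partial>\<close> operator on forms\<close>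

text \<open>Forms without growth condition: the contraction of a form in the Fock space may leave
  that space, yet its homogeneous components must still make sense.\<close>

definition entire_forms :: "nat \<Rightarrow> ('n::finite) form set" where
  "entire_forms p = {f. (\<forall>J. entire (f J)) \<and> (\<forall>J. J \<notin> multi_indices p \<longrightarrow> f J = (\<lambda>z. 0))}"

definition form_hcomp :: "nat \<Rightarrow> ('n::finite) form \<Rightarrow> 'n form" where
  "form_hcomp k f = (\<lambda>J. hcomp k (f J))"

text \<open>Interior product with the Euler vector field, written as the formal transpose of
  \<open>del p\<close>; as there, \<open>p\<close> is the lower of the two degrees.\<close>

definition contraction :: "nat \<Rightarrow> ('n::{finite,linorder}) form \<Rightarrow> 'n form" where
  "contraction p g = (\<lambda>J z. \<Sum>K\<in>multi_indices (p + 1). \<Sum>j\<in>UNIV. z $ j * g K z * wedge_coeff j J K)"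

lemma entire_formsD: "f \<in> entire_forms p \<Longrightarrow> entire (f J)"
  by (simp add: entire_forms_def)

lemma fock_forms_iff:
  "f \<in> fock_forms p \<longleftrightarrow> (\<forall>J. f J \<in> fock_space) \<and> (\<forall>J. J \<notin> multi_indices p \<longrightarrow> f J = (\<lambda>z. 0))"
  unfolding fock_forms_def mem_Collect_eq using fock_zero by metis

lemma fock_formsD: "f \<in> fock_forms p \<Longrightarrow> f J \<in> fock_space"
  by (simp add: fock_forms_iff)

lemma fock_forms_entire: "f \<in> fock_forms p \<Longrightarrow> f \<in> entire_forms p"
  by (simp add: fock_forms_iff entire_forms_def fock_entire)

lemma wedge_coeff_eq_0:
  fixes J K :: "'n::{finite,linorder} set"
  assumes "card K \<noteq> card J + 1"
  shows "wedge_coeff j J K = 0"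
  using assms by (auto simp: wedge_coeff_def)

lemma cnj_wedge_coeff [simp]: "cnj (wedge_coeff j J K) = wedge_coeff j J K"
  by (simp add: wedge_coeff_def)

lemma del_outside: "K \<notin> multi_indices (p + 1) \<Longrightarrow> del p f K = (\<lambda>z. 0)"
  unfolding del_def multi_indices_def by (simp add: wedge_coeff_eq_0)

lemma contraction_outside: "J \<notin> multi_indices p \<Longrightarrow> contraction p g J = (\<lambda>z. 0)"
  unfolding contraction_def multi_indices_def by (simp add: wedge_coeff_eq_0)

lemma contraction_entire:
  assumes "g \<in> entire_forms (p + 1)"
  shows "contraction p g \<in> entire_forms p"
proof -
  have "entire (contraction p g J)" for J
    unfolding contraction_def by (intro entire_sum entire_multr entire_mult entire_nth entire_formsD[OF assms])
  then show ?thesis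
    by (simp add: entire_forms_def contraction_outside)
qed

lemma form_hcomp_fock:
  assumes "f \<in> entire_forms p"
  shows "form_hcomp k f \<in> fock_forms p"
proof -
  have "hcomp k (f J) = (\<lambda>z. 0)" if "J \<notin> multi_indices p" for J
  proof -
    have "f J = (\<lambda>z. 0)"
      using assms that by (simp add: entire_forms_def)
    then show ?thesis by (simp only: hcomp_zero ext)
  qed
  then show ?thesis
    using assms by (simp add: fock_forms_iff form_hcomp_def fock_space_hcomp entire_formsD)
qed

lemma form_hcomp_del:
  assumes "f \<in> entire_forms p"
  shows "form_hcomp k (del p f) = del p (form_hcomp (Suc k) f)"
  unfolding form_hcomp_def del_def fun_eq_iff
  by (simp add: hcomp_sum hcomp_multr entire_sum entire_multr entire_partial_z entire_formsD[OF assms]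
      partial_z_hcomp_Suc)

lemma form_hcomp_Suc_contraction:
  assumes "g \<in> entire_forms (p + 1)"
  shows "form_hcomp (Suc k) (contraction p g) = contraction p (form_hcomp k g)"
  unfolding form_hcomp_def contraction_def fun_eq_iff
  by (simp add: hcomp_sum hcomp_multr entire_sum entire_multr entire_mult entire_formsD[OF assms] hcomp_nth_mult)

lemma form_hcomp_0_contraction:
  assumes "g \<in> entire_forms (p + 1)"
  shows "form_hcomp 0 (contraction p g) = (\<lambda>J z. 0)"
  using entire_formsD[OF contraction_entire[OF assms]]
  by (simp add: form_hcomp_def hcomp_0 fun_eq_iff) (simp add: contraction_def)

text \<open>Coefficientwise this is \<open>fock_inner_partial_z\<close>; the signs in
  \<open>wedge_coeff\<close> are real and pass through the conjugation.\<close>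

lemma form_inner_del:
  fixes a b :: "('n::{finite,linorder}) form"
  assumes a: "\<And>J. entire (a J)" "\<And>J. poly_bounded (a J)"
    and b: "\<And>K. entire (b K)" "\<And>K. poly_bounded (b K)"
  shows "form_inner (p + 1) (del p a) b = form_inner p a (contraction p b)"
proof -
  have fb: "b K \<in> fock_space" and fa: "a J \<in> fock_space" for J K
    by (intro poly_bounded_fock a b)+
  have dz: "partial_z j (a J) \<in> fock_space" for j J
    by (intro poly_bounded_fock entire_partial_z poly_bounded_partial_z a)
  have zb: "(\<lambda>z. z $ j * b K z) \<in> fock_space" for j K
    by (intro poly_bounded_fock entire_mult poly_bounded_mult entire_nth poly_bounded_nth b)
  have "form_inner (p + 1) (del p a) b =
      (\<Sum>K\<in>multi_indices (p + 1). \<Sum>J\<in>multi_indices p. \<Sum>j\<in>UNIV. wedge_coeff j J K * fock_inner (partial_z j (a J)) (b K))"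
    unfolding form_inner_def del_def
    by (simp add: fock_inner_sum_left fock_sum fock_cmult dz fb mult.commute[of _ "wedge_coeff _ _ _"] fock_inner_cmult_left)
  also have "\<dots> = (\<Sum>K\<in>multi_indices (p + 1). \<Sum>J\<in>multi_indices p. \<Sum>j\<in>UNIV. wedge_coeff j J K * fock_inner (a J) (\<lambda>z. z $ j * b K z))"
    by (simp add: fock_inner_partial_z a b)
  also have "\<dots> = (\<Sum>J\<in>multi_indices p. \<Sum>K\<in>multi_indices (p + 1). \<Sum>j\<in>UNIV. wedge_coeff j J K * fock_inner (a J) (\<lambda>z. z $ j * b K z))"
    by (rule sum.swap)
  also have "\<dots> = form_inner p a (contraction p b)"
    unfolding form_inner_def contraction_def
    by (simp add: fock_inner_sum_right fock_sum fock_cmult zb fa mult.commute[of _ "wedge_coeff _ _ _"] fock_inner_cmult_right)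
  finally show ?thesis .
qed

lemma form_inner_parseval:
  assumes "f \<in> fock_forms p" "g \<in> fock_forms p"
  shows "(\<lambda>k. form_inner p (form_hcomp k f) (form_hcomp k g)) sums form_inner p f g"
  unfolding form_inner_def form_hcomp_def
  by (intro sums_sum fock_inner_parseval fock_formsD[OF assms(1)] fock_formsD[OF assms(2)])

text \<open>The contraction of \<open>g\<close> may fail to be square integrable, so an inner
  product with it may be meaningless. Its components always pair with those of \<open>f\<close>, and
  the series of these pairings converges because it is Parseval's series for \<open>del p f\<close>
  and \<open>g\<close>.\<close>

lemma del_pairing_sums:
  assumes f: "f \<in> dom_del p" and g: "g \<in> fock_forms (p + 1)"
  shows "(\<lambda>k. form_inner p (form_hcomp k f) (form_hcomp k (contraction p g))) sums form_inner (p + 1) (del p f) g"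
proof -
  have ef: "f \<in> entire_forms p" and eg: "g \<in> entire_forms (p + 1)"
    using f g by (auto simp: dom_del_def intro: fock_forms_entire)
  have "form_inner (p + 1) (form_hcomp k (del p f)) (form_hcomp k g)
      = form_inner p (form_hcomp (Suc k) f) (form_hcomp (Suc k) (contraction p g))" for k
    unfolding form_hcomp_del[OF ef] form_hcomp_Suc_contraction[OF eg]
    by (rule form_inner_del) (auto simp: form_hcomp_def entire_hcomp poly_bounded_hcomp entire_formsD[OF ef] entire_formsD[OF eg])
  moreover have "(\<lambda>k. form_inner (p + 1) (form_hcomp k (del p f)) (form_hcomp k g)) sums form_inner (p + 1) (del p f) g"
    using f g by (intro form_inner_parseval) (auto simp: dom_del_def)
  ultimately have "(\<lambda>k. form_inner p (form_hcomp (Suc k) f) (form_hcomp (Suc k) (contraction p g))) sums form_inner (p + 1) (del p f) g"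
    by simp
  \<comment> \<open>\<open>del p\<close> lowers the polynomial degree and
    \<open>contraction p\<close> raises it, so the series starts at degree 1; the missing term
    vanishes because a contraction is zero at the origin.\<close>
  moreover have "form_inner p (form_hcomp 0 f) (form_hcomp 0 (contraction p g)) = 0"
    by (simp add: form_hcomp_0_contraction[OF eg] form_inner_def)
  ultimately show ?thesis
    using sums_Suc by fastforce
qed

lemma form_inner_self_eq_0:
  assumes "f \<in> fock_forms p" "form_inner p f f = 0"
  shows "f = (\<lambda>J z. 0)"
proof -
  have "complex_of_real (\<Sum>J\<in>multi_indices p. (fock_norm (f J))\<^sup>2) = 0"
    using assms(2) by (simp add: form_inner_def fock_inner_self)
  then have "(\<Sum>J\<in>multi_indices p. (fock_norm (f J))\<^sup>2) = 0"
    by (simp only: of_real_eq_0_iff)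
  then have "fock_norm (f J) = 0" if "J \<in> multi_indices p" for J
    using that by (subst (asm) sum_nonneg_eq_0_iff) auto
  then show ?thesis
    using assms(1) fock_norm_eq_0 fock_forms_iff by metis
qed

text \<open>
  Testing with the homogeneous form $u$ of degree $k$ that is the difference of the two
  components of degree $k$ shows that these agree.
\<close>

lemma adjoint_unique:
  assumes g: "g \<in> fock_forms (p + 1)" and h: "h \<in> fock_forms p"
    and adj: "\<And>f. f \<in> dom_del p \<Longrightarrow> form_inner (p + 1) (del p f) g = form_inner p f h"
  shows "h = contraction p g"
proof -
  have eg: "g \<in> entire_forms (p + 1)" and eh: "h \<in> entire_forms p"
    using g h by (auto intro: fock_forms_entire)
  note ec = contraction_entire[OF eg]
  have "hcomp k (h J) z = hcomp k (contraction p g J) z" for k J z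
  proof -
    define u where "u = (\<lambda>J z. hcomp k (h J) z - hcomp k (contraction p g J) z)"
    have u_fock: "u \<in> fock_forms p"
      using form_hcomp_fock[OF eh, of k] form_hcomp_fock[OF ec, of k]
      by (auto simp: fock_forms_iff form_hcomp_def u_def intro: fock_diff)
    then have eu: "u \<in> entire_forms p"
      by (rule fock_forms_entire)
    have hu: "form_hcomp l u = (if l = k then u else (\<lambda>J z. 0))" for l
      unfolding u_def form_hcomp_def fun_eq_iff
      by (simp add: hcomp_diff hcomp_hcomp entire_hcomp entire_formsD[OF eh] entire_formsD[OF ec])
    have "del p u \<in> fock_forms (p + 1)"
    proof -
      \<comment> \<open>As a component of one entire function, \<open>u J\<close> is polynomially
        bounded, which places \<open>u\<close> in the domain.\<close>
      have "u J = (\<lambda>z. hcomp k (\<lambda>z. h J z - contraction p g J z) z)" for J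
        by (simp add: u_def hcomp_diff entire_formsD[OF eh] entire_formsD[OF ec])
      then have "poly_bounded (u J)" for J
        using poly_bounded_hcomp entire_diff entire_formsD[OF eh] entire_formsD[OF ec] by metis
      then have "del p u K \<in> fock_space" for K
        unfolding del_def
        by (intro fock_sum fock_multr poly_bounded_fock poly_bounded_partial_z entire_partial_z entire_formsD[OF eu])
      then show ?thesis
        by (simp add: fock_forms_iff del_outside[simplified])
    qed
    then have ud: "u \<in> dom_del p"
      using u_fock by (simp add: dom_del_def)
    have only: "(\<lambda>l. form_inner p (form_hcomp l u) (w l)) sums form_inner p u (w k)" for w
    proof -
      have "(\<lambda>l. form_inner p (form_hcomp l u) (w l)) = (\<lambda>l. if l = k then form_inner p u (w k) else 0)"
        unfolding hu fun_eq_iff by (auto simp: form_inner_def)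
      then show ?thesis
        using sums_single[of k "\<lambda>_. form_inner p u (w k)"] by simp
    qed
    have "form_inner p u (form_hcomp k (contraction p g)) = form_inner (p + 1) (del p u) g"
      by (rule sums_unique2[OF only del_pairing_sums[OF ud g]])
    also have "\<dots> = form_inner p u h"
      by (rule adj[OF ud])
    also have "\<dots> = form_inner p u (form_hcomp k h)"
      by (rule sums_unique2[OF form_inner_parseval[OF u_fock h] only])
    finally have "form_inner p u u = 0"
      using form_hcomp_fock[OF eh, of k] form_hcomp_fock[OF ec, of k] u_fock
      unfolding form_inner_def form_hcomp_def
      by (subst (2) u_def) (simp add: fock_forms_iff fock_inner_diff_right sum_subtractf)
    then have "u = (\<lambda>J z. 0)"
      by (rule form_inner_self_eq_0[OF u_fock])
    then show ?thesis
      unfolding u_def fun_eq_iff by simp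
  qed
  then show ?thesis
    by (intro ext[of h] entire_eqI_hcomp entire_formsD[OF eh] entire_formsD[OF ec])
qed

text \<open>Both inner products are sums of the same series over the degrees.\<close>

lemma adjoint_contraction:
  assumes "g \<in> fock_forms (p + 1)" "contraction p g \<in> fock_forms p" "f \<in> dom_del p"
  shows "form_inner (p + 1) (del p f) g = form_inner p f (contraction p g)"
  by (rule sums_unique2[OF del_pairing_sums[OF assms(3,1)] form_inner_parseval])
    (use assms in \<open>auto simp: dom_del_def\<close>)

text \<open>Replaces the existential condition that defines the adjoint domain by a growth condition
  on one explicit form, which makes the domain of the Laplacian checkable.\<close>

lemma dom_del_adj_iff:
  "g \<in> dom_del_adj p \<longleftrightarrow> g \<in> fock_forms (p + 1) \<and> contraction p g \<in> fock_forms p"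
proof
  assume "g \<in> dom_del_adj p"
  then obtain h where "g \<in> fock_forms (p + 1)" "h \<in> fock_forms p"
      "\<And>f. f \<in> dom_del p \<Longrightarrow> form_inner (p + 1) (del p f) g = form_inner p f h"
    unfolding dom_del_adj_def by blast
  with adjoint_unique show "g \<in> fock_forms (p + 1) \<and> contraction p g \<in> fock_forms p"
    by metis
next
  assume "g \<in> fock_forms (p + 1) \<and> contraction p g \<in> fock_forms p"
  then show "g \<in> dom_del_adj p"
    unfolding dom_del_adj_def using adjoint_contraction by blast
qed

lemma del_adj_eq:
  assumes "g \<in> dom_del_adj p"
  shows "del_adj p g = contraction p g"
  unfolding del_adj_def
proof (rule the_equality)
  have g: "g \<in> fock_forms (p + 1)" "contraction p g \<in> fock_forms p"
    using assms by (auto simp: dom_del_adj_iff)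
  show "contraction p g \<in> fock_forms p \<and> (\<forall>f\<in>dom_del p. form_inner (p + 1) (del p f) g = form_inner p f (contraction p g))"
    using g adjoint_contraction by blast
  show "h = contraction p g" if "h \<in> fock_forms p \<and> (\<forall>f\<in>dom_del p. form_inner (p + 1) (del p f) g = form_inner p f h)" for h
    using that by (intro adjoint_unique g) auto
qed

section \<open>The Laplacian\<close>

lemma sum_wedge_coeff_below:
  fixes J L :: "'n::{finite,linorder} set"
  shows "(\<Sum>M\<in>UNIV. wedge_coeff k M J * wedge_coeff j M L) = wedge_coeff k (J - {k}) J * wedge_coeff j (J - {k}) L"
proof -
  have "(\<Sum>M\<in>UNIV. wedge_coeff k M J * wedge_coeff j M L) =
      (\<Sum>M\<in>UNIV. if M = J - {k} then wedge_coeff k (J - {k}) J * wedge_coeff j (J - {k}) L else 0)"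
    by (intro sum.cong) (auto simp: wedge_coeff_def)
  then show ?thesis by simp
qed

text \<open>Matrix entry from \<open>J\<close> to \<open>L\<close> of the relation between wedging
  with dz_j and contracting dz_k. For \<open>j = k\<close> and \<open>J = L\<close>, membership of
  \<open>k\<close> in \<open>J\<close> decides which term is 1; for \<open>j \<noteq> k\<close> both
  survive only if \<open>L\<close> arises from \<open>J\<close> by exchanging \<open>k\<close> for
  \<open>j\<close>, and then their signs are opposite.\<close>

lemma wedge_coeff_anticommute:
  fixes J L :: "'n::{finite,linorder} set"
  shows "(\<Sum>K\<in>UNIV. wedge_coeff k L K * wedge_coeff j J K) + (\<Sum>M\<in>UNIV. wedge_coeff k M J * wedge_coeff j M L)
    = (if j = k \<and> J = L then 1 else 0)"
proof -
  define s :: "'n \<Rightarrow> 'n set \<Rightarrow> complex" where "s j J = (-1) ^ card {i\<in>J. i < j}" for j J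
  have s2: "s j J * s j J = 1" for j J
    by (simp add: s_def flip: power_add power_mult_distrib)
  have s_insert: "s k (insert j M) = (if j < k then - s k M else s k M)" if "j \<notin> M" for j k M
  proof -
    have "{i \<in> insert j M. i < k} = (if j < k then insert j {i \<in> M. i < k} else {i \<in> M. i < k})"
      by auto
    then show ?thesis
      using that by (simp add: s_def)
  qed
  have wc: "wedge_coeff j J K = (if j \<notin> J \<and> K = insert j J then s j J else 0)" for j J K
    by (simp add: wedge_coeff_def s_def)
  have "(\<Sum>K\<in>UNIV. wedge_coeff k L K * wedge_coeff j J K) =
      (\<Sum>K\<in>UNIV. if K = insert k L then wedge_coeff k L (insert k L) * wedge_coeff j J (insert k L) else 0)"
    by (intro sum.cong) (auto simp: wc)
  then have 1: "(\<Sum>K\<in>UNIV. wedge_coeff k L K * wedge_coeff j J K) = wedge_coeff k L (insert k L) * wedge_coeff j J (insert k L)"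
    by simp
  note 2 = sum_wedge_coeff_below
  show ?thesis
  proof (cases "j = k")
    case True
    have "insert k (J - {k}) = J \<longleftrightarrow> k \<in> J" by blast
    moreover have "k \<notin> L \<Longrightarrow> k \<notin> J \<Longrightarrow> insert k L = insert k J \<longleftrightarrow> J = L"
      by (metis insert_ident)
    ultimately show ?thesis
      unfolding 1 2 using True s2 by (auto simp: wc)
  next
    case False
    show ?thesis
    proof (cases "k \<in> J \<and> j \<notin> J \<and> L = insert j (J - {k})")
      case True
      define M where "M = J - {k}"
      have M: "k \<notin> M" "j \<notin> M" "J = insert k M" "L = insert j M"
        using True by (auto simp: M_def)
      have "wedge_coeff k L (insert k L) * wedge_coeff j J (insert k L) = s k (insert j M) * s j (insert k M)"
        using M False by (auto simp: wc insert_commute)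
      \<comment> \<open>Exactly one of \<open>j < k\<close> and \<open>k < j\<close> holds, so
        exactly one of the two factors changes sign.\<close>
      also have "\<dots> = - (s k M * s j M)"
        using M False by (auto simp: s_insert)
      finally show ?thesis
        unfolding 1 2 M_def[symmetric] using M False by (simp add: wc)
    next
      case neg: False
      have "wedge_coeff k L (insert k L) * wedge_coeff j J (insert k L) = 0"
      proof (rule ccontr)
        assume "wedge_coeff k L (insert k L) * wedge_coeff j J (insert k L) \<noteq> 0"
        then have *: "k \<notin> L" "j \<notin> J" "insert k L = insert j J"
          by (auto simp: wc split: if_splits)
        then have "k \<in> J"
          using False by (metis insertE insertI1)
        moreover have "L = insert j J - {k}"
          using *(1) unfolding *(3)[symmetric] by simp
        ultimately have "k \<in> J \<and> j \<notin> J \<and> L = insert j (J - {k})"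
          using False *(2) by (simp add: insert_Diff_if)
        with neg show False by blast
      qed
      moreover have "wedge_coeff k (J - {k}) J * wedge_coeff j (J - {k}) L = 0"
        using neg False by (auto simp: wc)
      ultimately show ?thesis
        unfolding 1 2 using False by (simp only: simp_thms if_False add_0_left)
    qed
  qed
qed

text \<open>Removing and reinserting dz_j is the identity when \<open>j\<close> is in
  \<open>J\<close> and zero otherwise, so summing over \<open>j\<close> counts the entries. This
  count is the \<open>p\<close> in the formula for the Laplacian.\<close>

lemma wedge_coeff_square_sum:
  fixes J L :: "'n::{finite,linorder} set"
  shows "(\<Sum>j\<in>UNIV. \<Sum>M\<in>UNIV. wedge_coeff j M J * wedge_coeff j M L) = (if J = L then of_nat (card J) else 0)"
proof -
  have "(\<Sum>M\<in>UNIV. wedge_coeff j M J * wedge_coeff j M L) = (if J = L \<and> j \<in> J then 1 else 0)" for j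
  proof -
    have "wedge_coeff j (J - {j}) J * wedge_coeff j (J - {j}) L = (if J = L \<and> j \<in> J then 1 else 0)"
    proof (cases "j \<in> J")
      case True
      then have "insert j (J - {j}) = J" by blast
      moreover have "(-1) ^ m * (-1) ^ m = (1::complex)" for m :: nat
        by (simp flip: power_mult_distrib)
      ultimately show ?thesis
        using True by (auto simp: wedge_coeff_def)
    next
      case False
      then have "J \<noteq> insert j (J - {j})" by blast
      then show ?thesis
        using False by (simp add: wedge_coeff_def)
    qed
    then show ?thesis
      by (simp only: sum_wedge_coeff_below)
  qed
  then show ?thesis
    by (simp add: sum.If_cases)
qed

section \<open>The Laplacian on coefficients\<close>

lemma sum_multi_indices_wedge:
  fixes J L :: "'n::{finite,linorder} set"
  assumes "J \<in> multi_indices p"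
  shows "(\<Sum>K\<in>multi_indices (p + 1). wedge_coeff k L K * wedge_coeff j J K) =
      (\<Sum>K\<in>UNIV. wedge_coeff k L K * wedge_coeff j J K)"
    and "1 \<le> p \<Longrightarrow> (\<Sum>M\<in>multi_indices (p - 1). wedge_coeff k M J * wedge_coeff j M L) =
      (\<Sum>M\<in>UNIV. wedge_coeff k M J * wedge_coeff j M L)"
  by (intro sum.mono_neutral_left; use assms in \<open>auto simp: multi_indices_def wedge_coeff_eq_0\<close>)+

text \<open>Collecting the signs behind \<open>z $ k * partial_z j (f J) z\<close> serves twice: for
  the formula of the Laplacian and for showing that this form lies in the Fock space.\<close>

lemma contraction_del_eq:
  fixes f :: "('n::{finite,linorder}) form"
  shows "contraction p (del p f) L z = (\<Sum>J\<in>multi_indices p. \<Sum>k\<in>UNIV. \<Sum>j\<in>UNIV.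
      z $ k * partial_z j (f J) z * (\<Sum>K\<in>UNIV. wedge_coeff k L K * wedge_coeff j J K))"
proof -
  have "contraction p (del p f) L z = (\<Sum>K\<in>multi_indices (p + 1). \<Sum>k\<in>UNIV. \<Sum>J\<in>multi_indices p. \<Sum>j\<in>UNIV.
      z $ k * partial_z j (f J) z * (wedge_coeff k L K * wedge_coeff j J K))"
    unfolding contraction_def del_def by (simp add: sum_distrib_left sum_distrib_right mult_ac)
  also have "\<dots> = (\<Sum>k\<in>UNIV. \<Sum>J\<in>multi_indices p. \<Sum>j\<in>UNIV. \<Sum>K\<in>multi_indices (p + 1).
      z $ k * partial_z j (f J) z * (wedge_coeff k L K * wedge_coeff j J K))"
    by (simp only: sum.swap[of _ _ "multi_indices (p + 1)"])
  also have "\<dots> = (\<Sum>J\<in>multi_indices p. \<Sum>k\<in>UNIV. \<Sum>j\<in>UNIV. \<Sum>K\<in>multi_indices (p + 1).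
      z $ k * partial_z j (f J) z * (wedge_coeff k L K * wedge_coeff j J K))"
    by (rule sum.swap)
  also have "\<dots> = (\<Sum>J\<in>multi_indices p. \<Sum>k\<in>UNIV. \<Sum>j\<in>UNIV.
      z $ k * partial_z j (f J) z * (\<Sum>K\<in>UNIV. wedge_coeff k L K * wedge_coeff j J K))"
    by (intro sum.cong refl) (simp add: sum_multi_indices_wedge[symmetric] sum_distrib_left)
  finally show ?thesis .
qed

text \<open>The product rule for \<open>z $ k * f J z\<close> creates the undifferentiated term at
  \<open>j = k\<close>, the source of the zeroth-order part of the Laplacian.\<close>

lemma del_contraction_eq:
  fixes f :: "('n::{finite,linorder}) form"
  assumes f: "f \<in> entire_forms p" and p: "1 \<le> p"
  shows "del (p - 1) (contraction (p - 1) f) L z = (\<Sum>J\<in>multi_indices p. \<Sum>k\<in>UNIV. \<Sum>j\<in>UNIV.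
      (z $ k * partial_z j (f J) z + (if j = k then f J z else 0)) * (\<Sum>M\<in>UNIV. wedge_coeff k M J * wedge_coeff j M L))"
proof -
  have pz: "partial_z j (contraction (p - 1) f M) z = (\<Sum>J\<in>multi_indices p. \<Sum>k\<in>UNIV.
      (z $ k * partial_z j (f J) z + (if j = k then f J z else 0)) * wedge_coeff k M J)" for j M
  proof -
    have e: "entire (\<lambda>z. z $ k * f J z * c)" "entire (\<lambda>z. z $ k * f J z)" for k J c
      by (intro entire_multr entire_mult entire_nth entire_formsD[OF f])+
    have "partial_z j (contraction (p - 1) f M) z = dir_deriv (contraction (p - 1) f M) z (axis j 1)"
      using f p by (intro partial_z_eq_dir_deriv entire_formsD[OF contraction_entire]) simp
    also have "\<dots> = (\<Sum>J\<in>multi_indices p. \<Sum>k\<in>UNIV. dir_deriv (\<lambda>z. z $ k * f J z * wedge_coeff k M J) z (axis j 1))"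
      unfolding contraction_def using p by (simp add: dir_deriv_sum e entire_sum)
    also have "\<dots> = (\<Sum>J\<in>multi_indices p. \<Sum>k\<in>UNIV.
      (z $ k * partial_z j (f J) z + (if j = k then f J z else 0)) * wedge_coeff k M J)"
    proof (intro sum.cong refl)
      fix J k
      have "dir_deriv (\<lambda>z. z $ k * f J z * wedge_coeff k M J) z (axis j 1) =
          (z $ k * dir_deriv (f J) z (axis j 1) + axis j 1 $ k * f J z) * wedge_coeff k M J"
        by (simp add: dir_deriv_multr e dir_deriv_mult entire_formsD[OF f] dir_deriv_nth)
      also have "axis j 1 $ k * f J z = (if j = k then f J z else 0)"
        by (auto simp: axis_def)
      finally show "dir_deriv (\<lambda>z. z $ k * f J z * wedge_coeff k M J) z (axis j 1) =
          (z $ k * partial_z j (f J) z + (if j = k then f J z else 0)) * wedge_coeff k M J"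
        by (simp only: partial_z_eq_dir_deriv entire_formsD[OF f])
    qed
    finally show ?thesis .
  qed
  define X where "X J k j = z $ k * partial_z j (f J) z + (if j = k then f J z else 0)" for J k j
  have "del (p - 1) (contraction (p - 1) f) L z = (\<Sum>M\<in>multi_indices (p - 1). \<Sum>j\<in>UNIV. \<Sum>J\<in>multi_indices p. \<Sum>k\<in>UNIV.
      X J k j * (wedge_coeff k M J * wedge_coeff j M L))"
    unfolding del_def pz X_def[symmetric] by (simp add: sum_distrib_left sum_distrib_right mult.assoc)
  also have "\<dots> = (\<Sum>j\<in>UNIV. \<Sum>J\<in>multi_indices p. \<Sum>k\<in>UNIV. \<Sum>M\<in>multi_indices (p - 1).
      X J k j * (wedge_coeff k M J * wedge_coeff j M L))"
    by (simp only: sum.swap[of _ _ "multi_indices (p - 1)"])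
  also have "\<dots> = (\<Sum>J\<in>multi_indices p. \<Sum>j\<in>UNIV. \<Sum>k\<in>UNIV. \<Sum>M\<in>multi_indices (p - 1).
      X J k j * (wedge_coeff k M J * wedge_coeff j M L))"
    by (rule sum.swap)
  also have "\<dots> = (\<Sum>J\<in>multi_indices p. \<Sum>k\<in>UNIV. \<Sum>j\<in>UNIV. \<Sum>M\<in>multi_indices (p - 1).
      X J k j * (wedge_coeff k M J * wedge_coeff j M L))"
    by (intro sum.cong refl sum.swap)
  also have "\<dots> = (\<Sum>J\<in>multi_indices p. \<Sum>k\<in>UNIV. \<Sum>j\<in>UNIV.
      X J k j * (\<Sum>M\<in>UNIV. wedge_coeff k M J * wedge_coeff j M L))"
    by (intro sum.cong refl) (simp add: sum_multi_indices_wedge(2)[OF _ p, symmetric] sum_distrib_left)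
  finally show ?thesis
    unfolding X_def .
qed

text \<open>In the terms with a derivative the two sign sums add up to the anticommutator, which
  leaves only \<open>j = k\<close> and \<open>J = L\<close>, that is, the Euler operator. The
  product-rule terms carry one sign sum only, and that one counts the entries of
  \<open>L\<close>.\<close>

lemma laplacian_pointwise:
  fixes f :: "('n::{finite,linorder}) form"
  assumes f: "f \<in> entire_forms p" and p: "1 \<le> p"
  shows "contraction p (del p f) L z + del (p - 1) (contraction (p - 1) f) L z
    = euler (f L) z + of_nat p * f L z"
proof (cases "L \<in> multi_indices p")
  case False
  then have "f L = (\<lambda>z. 0)"
    using f by (simp add: entire_forms_def)
  moreover have "del (p - 1) (contraction (p - 1) f) L = (\<lambda>z. 0)"
    using False p by (intro del_outside) simp
  ultimately show ?thesis
    using False by (simp add: contraction_outside euler_def partial_z_eq_dir_deriv)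
next
  case True
  define S where "S k j J = (\<Sum>K\<in>UNIV. wedge_coeff k L K * wedge_coeff j J K)" for k j J
  define T where "T k j J = (\<Sum>M\<in>UNIV. wedge_coeff k M J * wedge_coeff j M L)" for k j J
  have ST: "S k j J + T k j J = (if j = k \<and> J = L then 1 else 0)" for k j J
    unfolding S_def T_def by (rule wedge_coeff_anticommute)
  have "contraction p (del p f) L z + del (p - 1) (contraction (p - 1) f) L z =
      (\<Sum>J\<in>multi_indices p. \<Sum>k\<in>UNIV. \<Sum>j\<in>UNIV.
        z $ k * partial_z j (f J) z * (S k j J + T k j J) + (if j = k then f J z * T k k J else 0))"
    unfolding contraction_del_eq del_contraction_eq[OF f p] S_def[symmetric] T_def[symmetric] sum.distrib[symmetric]
    by (intro sum.cong refl) (simp add: algebra_simps)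
  also have "\<dots> = (\<Sum>J\<in>multi_indices p. \<Sum>k\<in>UNIV.
      (if J = L then z $ k * partial_z k (f J) z else 0) + f J z * T k k J)"
  proof (intro sum.cong refl)
    fix J k
    have "(\<Sum>j\<in>UNIV. z $ k * partial_z j (f J) z * (S k j J + T k j J) + (if j = k then f J z * T k k J else 0)) =
        (\<Sum>j\<in>UNIV. (if j = k then (if J = L then z $ k * partial_z k (f J) z else 0) + f J z * T k k J else 0))"
      by (intro sum.cong refl) (simp add: ST)
    then show "(\<Sum>j\<in>UNIV. z $ k * partial_z j (f J) z * (S k j J + T k j J) + (if j = k then f J z * T k k J else 0)) =
        (if J = L then z $ k * partial_z k (f J) z else 0) + f J z * T k k J"
      by simp
  qed
  also have "\<dots> = (\<Sum>J\<in>multi_indices p. (if J = L then euler (f L) z else 0) + f J z * (\<Sum>k\<in>UNIV. T k k J))"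
    by (intro sum.cong refl) (simp add: sum.distrib sum_distrib_left euler_def)
  also have "\<dots> = (\<Sum>J\<in>multi_indices p. if J = L then euler (f L) z + of_nat p * f L z else 0)"
    using True by (intro sum.cong refl) (auto simp: T_def wedge_coeff_square_sum multi_indices_def)
  also have "\<dots> = euler (f L) z + of_nat p * f L z"
    using True by simp
  finally show ?thesis .
qed

lemma laplacian_eq:
  assumes "1 \<le> p" "f \<in> dom_laplacian p"
  shows "laplacian p f = (\<lambda>J z. euler (f J) z + of_nat p * f J z)"
proof -
  have "f \<in> entire_forms p"
    using assms(2) by (auto simp: dom_laplacian_def dom_del_def intro: fock_forms_entire)
  then show ?thesis
    using assms unfolding laplacian_def
    by (simp add: dom_laplacian_def del_adj_eq laplacian_pointwise[simplified])
qed

section \<open>The inverse of the Laplacian\<close>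

lemma ennreal_suminf_Suc:
  fixes a :: "nat \<Rightarrow> ennreal"
  shows "(\<Sum>k. a k) = (\<Sum>k. a (Suc k)) + a 0"
proof -
  have "(\<lambda>k. a (Suc k)) sums (\<Sum>k. a (Suc k))"
    by (rule summable_sums) (rule summableI)
  from sums_Suc[OF this] show ?thesis
    by (simp add: sums_iff)
qed

text \<open>With infinite values included, finiteness for the product reduces to comparing the terms
  of one series.\<close>

lemma fock_nn_nth_mult:
  assumes "entire f"
  shows "fock_nn (\<lambda>z. z $ j * f z) = (\<Sum>k. fock_nn (\<lambda>z. z $ j * hcomp k f z))"
proof -
  have e: "entire (\<lambda>z. z $ j * f z)"
    by (intro entire_mult entire_nth assms)
  have "hcomp 0 (\<lambda>z. z $ j * f z) = (\<lambda>z. 0)" "hcomp (Suc k) (\<lambda>z. z $ j * f z) = (\<lambda>z. z $ j * hcomp k f z)" for k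
    using hcomp_0[OF e] by (auto simp: hcomp_nth_mult fun_eq_iff)
  then show ?thesis
    unfolding fock_nn_parseval[OF e] ennreal_suminf_Suc[of "\<lambda>k. fock_nn (hcomp k (\<lambda>z. z $ j * f z))"]
    by (simp add: fock_nn_def)
qed

lemma fock_nn_partial_z:
  assumes "entire f"
  shows "fock_nn (partial_z j f) = (\<Sum>k. fock_nn (partial_z j (hcomp k f)))"
proof -
  have "partial_z j (hcomp 0 f) = (\<lambda>z. 0)" "hcomp k (partial_z j f) = partial_z j (hcomp (Suc k) f)" for k
    using partial_z_hcomp_0[OF assms] partial_z_hcomp_Suc[OF assms] by auto
  then show ?thesis
    unfolding fock_nn_parseval[OF entire_partial_z[OF assms]] ennreal_suminf_Suc[of "\<lambda>k. fock_nn (partial_z j (hcomp k f))"]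
    by (simp add: fock_nn_def)
qed

lemma fock_nn_nth_mult_hcomp_le:
  assumes "entire f"
  shows "fock_nn (\<lambda>z. z $ j * hcomp k f z) \<le> ennreal (real (Suc k)) * fock_nn (hcomp k f)"
proof -
  have "(\<lambda>z. z $ j * hcomp k f z) \<in> fock_space"
    by (intro poly_bounded_fock poly_bounded_mult poly_bounded_nth poly_bounded_hcomp entire_mult entire_nth entire_hcomp assms)
  then show ?thesis
    using fock_norm_nth_mult_hcomp[OF assms, of j k]
    by (simp only: fock_nn_eq fock_space_hcomp assms ennreal_mult[symmetric] of_nat_0_le_iff zero_le_power2 ennreal_leI)
qed

lemma fock_nn_partial_z_hcomp_le:
  assumes "entire f"
  shows "fock_nn (partial_z j (hcomp k f)) \<le> ennreal (real k) * fock_nn (hcomp k f)"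
proof -
  have "partial_z j (hcomp k f) \<in> fock_space"
    by (intro poly_bounded_fock poly_bounded_partial_z poly_bounded_hcomp entire_partial_z entire_hcomp assms)
  then show ?thesis
    using fock_norm_partial_z_hcomp[OF assms, of j k]
    by (simp only: fock_nn_eq fock_space_hcomp assms ennreal_mult[symmetric] of_nat_0_le_iff zero_le_power2 ennreal_leI)
qed

lemma fock_nn_hcomp_radial_mean:
  assumes "entire f" "1 \<le> p"
  shows "fock_nn (hcomp k (radial_mean p f)) = ennreal (1 / (real (k + p))\<^sup>2) * fock_nn (hcomp k f)"
proof -
  have *: "hcomp k (radial_mean p f) = (\<lambda>z. (1 / of_nat (k + p)) * hcomp k f z)"
    by (simp add: hcomp_radial_mean[OF assms] fun_eq_iff)
  show ?thesis
    unfolding * fock_nn_cmult[OF entire_hcomp[OF assms(1)]]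
    by (simp add: norm_divide power_divide del: of_nat_add)
qed

text \<open>The square of the factor \<open>1 / (k + p)\<close> pays for any weight up to
  \<open>(real (k + p))\<^sup>2\<close>.\<close>

lemma fock_nn_hcomp_radial_mean_le:
  assumes "entire f" "1 \<le> p" "a \<le> (real (k + p))\<^sup>2" "0 \<le> a"
  shows "ennreal a * fock_nn (hcomp k (radial_mean p f)) \<le> fock_nn (hcomp k f)"
proof -
  have "ennreal a * fock_nn (hcomp k (radial_mean p f)) = ennreal (a / (real (k + p))\<^sup>2) * fock_nn (hcomp k f)"
    unfolding fock_nn_hcomp_radial_mean[OF assms(1,2)] mult.assoc[symmetric]
    using assms(4) by (simp add: ennreal_mult[symmetric])
  also have "\<dots> \<le> 1 * fock_nn (hcomp k f)"
    using assms(2,3) by (intro mult_right_mono) (auto simp: divide_le_eq)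
  finally show ?thesis by simp
qed

text \<open>In squared norm, multiplication by a variable costs \<open>k + 1\<close> and
  differentiation costs \<open>k\<close> in degree \<open>k\<close>. The gain
  \<open>(k + p)\<^sup>2\<close> is at least \<open>(k + 1)\<^sup>2\<close>, enough for both
  operations together.\<close>

lemma
  assumes f: "f \<in> fock_space" and p: "1 \<le> p"
  shows radial_mean_fock: "radial_mean p f \<in> fock_space"
    and nth_mult_radial_mean_fock: "(\<lambda>z. z $ j * radial_mean p f z) \<in> fock_space"
    and partial_z_radial_mean_fock: "partial_z j (radial_mean p f) \<in> fock_space"
    and nth_mult_partial_z_radial_mean_fock: "(\<lambda>z. z $ i * partial_z j (radial_mean p f) z) \<in> fock_space"
proof -
  have ef: "entire f" using f by (rule fock_entire)
  define u where "u = radial_mean p f"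
  have eu: "entire u" unfolding u_def by (rule entire_radial_mean[OF ef])
  have fin: "(\<Sum>k. fock_nn (hcomp k f)) < \<infinity>"
    using f fock_nn_parseval[OF ef] by (simp add: fock_space_iff)
  have le: "ennreal a * fock_nn (hcomp k u) \<le> fock_nn (hcomp k f)" if "a \<le> (real k + 1)\<^sup>2" "0 \<le> a" for a k
  proof -
    have "(real k + 1)\<^sup>2 \<le> (real (k + p))\<^sup>2"
      using p by (intro power_mono) auto
    from order_trans[OF that(1) this] show ?thesis
      unfolding u_def by (rule fock_nn_hcomp_radial_mean_le[OF ef p _ that(2)])
  qed
  have sq: "real k \<le> (real k + 1)\<^sup>2" "real (Suc k) \<le> (real k + 1)\<^sup>2" "1 \<le> (real k + 1)\<^sup>2" "real (Suc k) * real (Suc k) \<le> (real (Suc k) + 1)\<^sup>2" for k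
    by (simp_all add: power2_eq_square algebra_simps)
  have "fock_nn u \<le> (\<Sum>k. fock_nn (hcomp k f))"
    unfolding fock_nn_parseval[OF eu] using le[of 1] sq(3) by (intro suminf_le) auto
  then show "radial_mean p f \<in> fock_space"
    using fin eu by (auto simp: fock_space_iff u_def intro: le_less_trans)
  have "fock_nn (\<lambda>z. z $ j * u z) \<le> (\<Sum>k. fock_nn (hcomp k f))"
    unfolding fock_nn_nth_mult[OF eu]
    by (intro suminf_le order_trans[OF fock_nn_nth_mult_hcomp_le[OF eu] le] sq) auto
  then show "(\<lambda>z. z $ j * radial_mean p f z) \<in> fock_space"
    using fin eu by (auto simp: fock_space_iff u_def intro: le_less_trans entire_mult)
  have "fock_nn (partial_z j u) \<le> (\<Sum>k. fock_nn (hcomp k f))"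
    unfolding fock_nn_partial_z[OF eu]
    by (intro suminf_le order_trans[OF fock_nn_partial_z_hcomp_le[OF eu] le] sq) auto
  then show "partial_z j (radial_mean p f) \<in> fock_space"
    using fin eu by (auto simp: fock_space_iff u_def intro: le_less_trans entire_partial_z)
  have "fock_nn (\<lambda>z. z $ i * partial_z j u z) \<le> (\<Sum>k. fock_nn (hcomp (Suc k) f))"
    unfolding fock_nn_nth_mult[OF entire_partial_z[OF eu]]
  proof (intro suminf_le)
    fix k
    \<comment> \<open>The derivative comes from degree \<open>Suc k\<close>, so both operations cost
      \<open>Suc k\<close> here, against a gain of at least
      \<open>(Suc k + 1)\<^sup>2\<close>.\<close>
    have "hcomp k (partial_z j u) = partial_z j (hcomp (Suc k) u)"
      using partial_z_hcomp_Suc[OF eu] by auto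
    then have "fock_nn (\<lambda>z. z $ i * hcomp k (partial_z j u) z) \<le> ennreal (real (Suc k)) * fock_nn (partial_z j (hcomp (Suc k) u))"
      using fock_nn_nth_mult_hcomp_le[OF entire_partial_z[OF eu], of i k j] by simp
    also have "\<dots> \<le> ennreal (real (Suc k)) * (ennreal (real (Suc k)) * fock_nn (hcomp (Suc k) u))"
      by (intro mult_left_mono fock_nn_partial_z_hcomp_le eu) simp
    also have "\<dots> = ennreal (real (Suc k) * real (Suc k)) * fock_nn (hcomp (Suc k) u)"
      by (subst ennreal_mult) (simp_all only: of_nat_0_le_iff mult.assoc)
    also have "\<dots> \<le> fock_nn (hcomp (Suc k) f)"
      by (intro le sq) simp
    finally show "fock_nn (\<lambda>z. z $ i * hcomp k (partial_z j u) z) \<le> fock_nn (hcomp (Suc k) f)" .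
  qed auto
  also have "\<dots> \<le> (\<Sum>k. fock_nn (hcomp k f))"
    unfolding ennreal_suminf_Suc[of "\<lambda>k. fock_nn (hcomp k f)"] by simp
  finally show "(\<lambda>z. z $ i * partial_z j (radial_mean p f) z) \<in> fock_space"
    using fin eu by (auto simp: fock_space_iff u_def intro: le_less_trans entire_mult entire_partial_z)
qed

section \<open>Inverting the Laplacian on forms\<close>

definition form_radial_mean :: "nat \<Rightarrow> ('n::finite) form \<Rightarrow> 'n form" where
  "form_radial_mean p f = (\<lambda>J. radial_mean p (f J))"

lemma radial_mean_zero [simp]: "radial_mean p (\<lambda>z. 0) = (\<lambda>z. 0)"
  by (simp add: radial_mean_def fun_eq_iff)

lemma form_radial_mean_fock:
  assumes "1 \<le> p" "f \<in> fock_forms p"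
  shows "form_radial_mean p f \<in> fock_forms p"
  using assms by (simp add: fock_forms_iff form_radial_mean_def radial_mean_fock)

lemma form_radial_mean_inverse:
  fixes f :: "('n::{finite,linorder}) form"
  assumes p: "1 \<le> p" and f: "f \<in> fock_forms p"
  shows "form_radial_mean p f \<in> dom_laplacian p" "laplacian p (form_radial_mean p f) = f"
proof -
  define u where "u = form_radial_mean p f"
  have u: "u \<in> fock_forms p"
    unfolding u_def by (rule form_radial_mean_fock[OF p f])
  then have eu: "u \<in> entire_forms p"
    by (rule fock_forms_entire)
  have fJ: "f J \<in> fock_space" for J
    using f by (rule fock_formsD)
  have "del p u K \<in> fock_space" for K
    unfolding del_def u_def form_radial_mean_def
    by (intro fock_sum fock_multr partial_z_radial_mean_fock fJ p)
  then have du: "del p u \<in> fock_forms (p + 1)"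
    by (simp add: fock_forms_iff del_outside[simplified])
  have "contraction (p - 1) u J \<in> fock_space" for J
    unfolding contraction_def u_def form_radial_mean_def
    by (intro fock_sum fock_multr nth_mult_radial_mean_fock fJ p)
  then have cu: "contraction (p - 1) u \<in> fock_forms (p - 1)"
    by (simp add: fock_forms_iff contraction_outside)
  have "contraction p (del p u) L = (\<lambda>z. \<Sum>J\<in>multi_indices p. \<Sum>k\<in>UNIV. \<Sum>j\<in>UNIV.
      z $ k * partial_z j (u J) z * (\<Sum>K\<in>UNIV. wedge_coeff k L K * wedge_coeff j J K))" for L
    by (rule ext) (rule contraction_del_eq)
  then have "contraction p (del p u) L \<in> fock_space" for L
    unfolding u_def form_radial_mean_def
    by (simp add: fock_sum fock_multr nth_mult_partial_z_radial_mean_fock[OF fJ p])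
  then have cdu: "contraction p (del p u) \<in> fock_forms p"
    by (simp add: fock_forms_iff contraction_outside)
  have lap: "contraction p (del p u) L z + del (p - 1) (contraction (p - 1) u) L z = f L z" for L z
    unfolding laplacian_pointwise[OF eu p]
    unfolding u_def form_radial_mean_def
    by (rule radial_mean_solves[OF fock_entire[OF fJ] p])
  \<comment> \<open>Membership of this last term is read off from the equation: it is the difference
    of \<open>f\<close> and a term already known to lie in the Fock space.\<close>
  have "del (p - 1) (contraction (p - 1) u) L = (\<lambda>z. f L z - contraction p (del p u) L z)" for L
    using lap[of L] by (simp add: fun_eq_iff algebra_simps)
  then have "del (p - 1) (contraction (p - 1) u) L \<in> fock_space" for L
    using fock_diff[OF fJ fock_formsD[OF cdu]] by simp
  moreover have "p - 1 + 1 = p" using p by simp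
  ultimately have dcu: "del (p - 1) (contraction (p - 1) u) \<in> fock_forms (p - 1 + 1)"
    using del_outside[of _ "p - 1"] by (simp only: fock_forms_iff) blast
  have adj: "u \<in> dom_del_adj (p - 1)" "del p u \<in> dom_del_adj p"
    using u cu du cdu p by (auto simp: dom_del_adj_iff)
  then show dom: "form_radial_mean p f \<in> dom_laplacian p"
    using u du cu dcu unfolding u_def[symmetric] dom_laplacian_def dom_del_def
    by (simp add: del_adj_eq)
  show "laplacian p (form_radial_mean p f) = f"
    unfolding laplacian_eq[OF p dom]
    by (simp add: form_radial_mean_def fun_eq_iff radial_mean_solves[OF fock_entire[OF fJ] p])
qed

lemma inj_on_laplacian:
  assumes "1 \<le> p"
  shows "inj_on (laplacian p) (dom_laplacian p)"
proof (rule inj_onI)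
  fix f g :: "'n::{finite,linorder} form"
  assume f: "f \<in> dom_laplacian p" and g: "g \<in> dom_laplacian p" and eq: "laplacian p f = laplacian p g"
  have "entire (f J)" "entire (g J)" for J
    using f g by (auto simp: dom_laplacian_def dom_del_def intro!: fock_entire fock_formsD)
  moreover have "euler (f J) z + of_nat p * f J z = euler (g J) z + of_nat p * g J z" for J z
    using eq unfolding laplacian_eq[OF assms f] laplacian_eq[OF assms g] by (simp add: fun_eq_iff)
  ultimately show "f = g"
    using euler_plus_injective[OF _ _ assms] by blast
qed

lemma inverse_laplacian_eq:
  assumes "1 \<le> p" "f \<in> fock_forms p"
  shows "inverse_laplacian p f = form_radial_mean p f"
  unfolding inverse_laplacian_def
  by (rule the_inv_into_f_eq[OF inj_on_laplacian[OF assms(1)] form_radial_mean_inverse(2,1)[OF assms]])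

section \<open>Point evaluations and completeness\<close>

lemma entire_translate:
  assumes "entire f"
  shows "entire (\<lambda>z. f (w + z))"
proof (rule entireI)
  fix z
  have "((\<lambda>z. w + z) has_derivative (\<lambda>h. h)) (at z)"
    by (auto intro!: derivative_eq_intros)
  from has_derivative_compose[OF this entire_has_derivative[OF assms]]
  show "((\<lambda>z. f (w + z)) has_derivative dir_deriv f (w + z)) (at z)" .
qed (rule dir_deriv_smult[OF assms])

text \<open>
  The summand of degree 0 in the Parseval identity for \<^term>\<open>\<lambda>z. f (w + z)\<close> over the unit ball
  gives the sub-mean value property of $|f|^2$.
\<close>

lemma fock_eval_bound:
  obtains C where "0 \<le> C"
    "\<And>f w. f \<in> fock_space \<Longrightarrow> norm (w :: complex ^ 'n::finite) \<le> R \<Longrightarrow> cmod (f w) \<le> C * fock_norm f"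
proof -
  define b :: "complex ^ 'n \<Rightarrow> ennreal" where "b = indicator (ball 0 1)"
  have [measurable]: "b \<in> borel_measurable borel"
    unfolding b_def by (intro borel_measurable_indicator) simp
  define v where "v = unit_ball_vol (real DIM(complex ^ 'n))"
  have v: "0 < v"
    unfolding v_def by (rule unit_ball_vol_pos) simp
  have bv: "(\<integral>\<^sup>+z. b z \<partial>lborel) = ennreal v"
    by (simp add: b_def v_def emeasure_ball)
  \<comment> \<open>On the unit ball around a point of norm at most \<open>R\<close>, the Gaussian
    weight is at least \<open>1 / E\<close>.\<close>
  define E where "E = exp ((\<bar>R\<bar> + 1)\<^sup>2)"
  have bound: "(cmod (f w))\<^sup>2 \<le> E / v * (fock_norm f)\<^sup>2" if f: "f \<in> fock_space" and w: "norm w \<le> R" for f and w :: "complex ^ 'n"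
  proof -
    define F where "F z = f (w + z)" for z
    have F: "entire F"
      unfolding F_def by (rule entire_translate[OF fock_entire[OF f]])
    have [measurable]: "f \<in> borel_measurable borel"
      using f by (rule fock_measurable)
    have "ennreal ((cmod (f w))\<^sup>2 * v) = (\<integral>\<^sup>+z. ennreal ((cmod (hcomp 0 F z))\<^sup>2) * b z \<partial>lborel)"
      using v by (simp add: hcomp_0[OF F] nn_integral_cmult bv ennreal_mult F_def)
    also have "\<dots> \<le> (\<Sum>k. \<integral>\<^sup>+z. ennreal ((cmod (hcomp k F z))\<^sup>2) * b z \<partial>lborel)"
      using sum_le_suminf[of "\<lambda>k. \<integral>\<^sup>+z. ennreal ((cmod (hcomp k F z))\<^sup>2) * b z \<partial>lborel" "{0}"] by simp
    also have "\<dots> = (\<integral>\<^sup>+z. ennreal ((cmod (F z))\<^sup>2) * b z \<partial>lborel)"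
      by (rule nn_integral_hcomp_parseval[symmetric, OF F])
        (auto simp: b_def indicator_def norm_vector_smult dist_norm)
    also have "\<dots> \<le> (\<integral>\<^sup>+z. ennreal E * (ennreal ((cmod (f (z + w)))\<^sup>2) * ennreal (exp (- (norm (z + w))\<^sup>2))) \<partial>lborel)"
    proof (rule nn_integral_mono)
      fix z
      show "ennreal ((cmod (F z))\<^sup>2) * b z \<le> ennreal E * (ennreal ((cmod (f (z + w)))\<^sup>2) * ennreal (exp (- (norm (z + w))\<^sup>2)))"
      proof (cases "norm z < 1")
        case True
        have "norm (z + w) \<le> \<bar>R\<bar> + 1"
          using norm_triangle_ineq[of z w] True w by linarith
        then have "(norm (z + w))\<^sup>2 \<le> (\<bar>R\<bar> + 1)\<^sup>2"
          by (intro power_mono) auto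
        then have "1 \<le> E * exp (- (norm (z + w))\<^sup>2)"
          unfolding E_def by (simp flip: exp_add)
        then have "(cmod (f (z + w)))\<^sup>2 * 1 \<le> (cmod (f (z + w)))\<^sup>2 * (E * exp (- (norm (z + w))\<^sup>2))"
          by (rule mult_left_mono) simp
        then have "(cmod (f (z + w)))\<^sup>2 \<le> E * ((cmod (f (z + w)))\<^sup>2 * exp (- (norm (z + w))\<^sup>2))"
          by (simp add: mult_ac)
        moreover have "0 \<le> E" by (simp add: E_def)
        ultimately have "ennreal ((cmod (f (z + w)))\<^sup>2) \<le> ennreal E * (ennreal ((cmod (f (z + w)))\<^sup>2) * ennreal (exp (- (norm (z + w))\<^sup>2)))"
          by (simp add: ennreal_mult[symmetric] ennreal_leI)
        then show ?thesis
          using True by (simp add: b_def F_def add.commute)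
      qed (simp add: b_def)
    qed
    also have "\<dots> = ennreal E * fock_nn f"
    proof -
      have "(\<integral>\<^sup>+z. ennreal ((cmod (f (z + w)))\<^sup>2) * ennreal (exp (- (norm (z + w))\<^sup>2)) \<partial>lborel) = fock_nn f"
        unfolding fock_nn_def by (rule nn_integral_lborel_translate) measurable
      then show ?thesis
        by (subst nn_integral_cmult) auto
    qed
    also have "\<dots> = ennreal (E * (fock_norm f)\<^sup>2)"
      unfolding fock_nn_eq[OF f] by (simp add: E_def ennreal_mult)
    finally have "(cmod (f w))\<^sup>2 * v \<le> E * (fock_norm f)\<^sup>2"
      by (subst (asm) ennreal_le_iff) (auto simp: E_def)
    then show ?thesis
      using v by (simp add: pos_le_divide_eq)
  qed
  have Ev: "0 \<le> E / v"
    using v by (simp add: E_def)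
  show ?thesis
  proof (rule that[of "sqrt (E / v)"])
    show "0 \<le> sqrt (E / v)"
      using Ev by (rule real_sqrt_ge_zero)
    fix f :: "complex ^ 'n \<Rightarrow> complex" and w :: "complex ^ 'n"
    assume "f \<in> fock_space" "norm w \<le> R"
    from bound[OF this] have "(cmod (f w))\<^sup>2 \<le> (sqrt (E / v) * fock_norm f)\<^sup>2"
      by (simp only: power_mult_distrib real_sqrt_pow2[OF Ev])
    then show "cmod (f w) \<le> sqrt (E / v) * fock_norm f"
      by (rule power2_le_imp_le) (intro mult_nonneg_nonneg real_sqrt_ge_zero Ev fock_norm_nonneg)
  qed
qed

lemma norm_dir_deriv_le_norm:
  assumes f: "entire f" and B: "\<And>w. norm (w - z) \<le> 1 \<Longrightarrow> cmod (f w) \<le> B"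
  shows "cmod (dir_deriv f z v) \<le> B * norm v"
proof (cases "v = 0")
  case True
  then show ?thesis
    by (simp add: linear_0[OF linear_dir_deriv[OF f]])
next
  case False
  define e where "e = complex_of_real (1 / norm v) *s v"
  have e: "norm e = 1" "v = complex_of_real (norm v) *s e"
    using False by (simp_all add: e_def norm_vector_smult vector_smult_assoc norm_divide)
  have "cmod (dir_deriv f z e) \<le> B"
    using e(1) by (intro norm_dir_deriv_le[OF f]) (auto intro: B)
  then have "norm v * cmod (dir_deriv f z e) \<le> norm v * B"
    by (rule mult_left_mono) simp
  moreover have "cmod (dir_deriv f z v) = norm v * cmod (dir_deriv f z e)"
    by (subst e(2)) (simp add: dir_deriv_smult[OF f] norm_mult)
  ultimately show ?thesis
    by (simp add: mult.commute)
qed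

text \<open>Weierstrass' theorem: Cauchy estimates on the ball of radius \<open>R + 1\<close> make
  the derivatives uniformly Cauchy on radius \<open>R\<close>, which permits differentiating the
  limit, and complex linearity survives pointwise limits.\<close>

lemma entire_locally_uniform_limit:
  fixes f :: "nat \<Rightarrow> complex ^ 'n::finite \<Rightarrow> complex"
  assumes f: "\<And>n. entire (f n)"
    and cauchy: "\<And>R e. 0 < e \<Longrightarrow> \<exists>N. \<forall>m\<ge>N. \<forall>n\<ge>N. \<forall>z. norm z \<le> R \<longrightarrow> cmod (f m z - f n z) \<le> e"
  obtains g where "entire g" "\<And>z. (\<lambda>n. f n z) \<longlonglongrightarrow> g z"
proof -
  have dcauchy: "\<exists>N. \<forall>m\<ge>N. \<forall>n\<ge>N. \<forall>z v. norm z \<le> R \<longrightarrow> cmod (dir_deriv (f m) z v - dir_deriv (f n) z v) \<le> e * norm v"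
    if "0 < e" for R e
  proof -
    obtain N where N: "\<And>m n z. m \<ge> N \<Longrightarrow> n \<ge> N \<Longrightarrow> norm z \<le> R + 1 \<Longrightarrow> cmod (f m z - f n z) \<le> e"
      using cauchy[OF \<open>0 < e\<close>, of "R + 1"] by blast
    have "cmod (dir_deriv (f m) z v - dir_deriv (f n) z v) \<le> e * norm v" if "m \<ge> N" "n \<ge> N" "norm z \<le> R" for m n z v
    proof -
      have "dir_deriv (f m) z v - dir_deriv (f n) z v = dir_deriv (\<lambda>z. f m z + (-1) * f n z) z v"
        by (simp only: dir_deriv_add f entire_cmult dir_deriv_cmult) simp
      moreover have "cmod (dir_deriv (\<lambda>z. f m z + (-1) * f n z) z v) \<le> e * norm v"
      proof (rule norm_dir_deriv_le_norm)
        show "entire (\<lambda>z. f m z + (-1) * f n z)"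
          by (intro entire_add entire_cmult f)
        fix w
        assume "norm (w - z) \<le> 1"
        then have "norm w \<le> R + 1"
          using norm_triangle_ineq[of z "w - z"] that(3) by simp
        then show "cmod (f m w + (-1) * f n w) \<le> e"
          using N that(1,2) by simp
      qed
      ultimately show ?thesis by simp
    qed
    then show ?thesis by blast
  qed
  have "convergent (\<lambda>n. dir_deriv (f n) z v)" for z v
  proof (rule Cauchy_convergent, rule CauchyI)
    fix e :: real
    assume "0 < e"
    then have "0 < e / (norm v + 1)"
      by (simp add: add_nonneg_pos)
    then obtain N where N: "\<And>m n. m \<ge> N \<Longrightarrow> n \<ge> N \<Longrightarrow> cmod (dir_deriv (f m) z v - dir_deriv (f n) z v) \<le> e / (norm v + 1) * norm v"
      using dcauchy[of "e / (norm v + 1)" "norm z"] by blast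
    have "e / (norm v + 1) * norm v < e"
      using \<open>0 < e\<close> by (simp add: divide_less_eq add_nonneg_pos distrib_left)
    then show "\<exists>N. \<forall>m\<ge>N. \<forall>n\<ge>N. norm (dir_deriv (f m) z v - dir_deriv (f n) z v) < e"
      using N by (meson le_less_trans)
  qed
  then obtain D where D: "\<And>z v. (\<lambda>n. dir_deriv (f n) z v) \<longlonglongrightarrow> D z v"
    unfolding convergent_def by metis
  have lim0: "convergent (\<lambda>n. f n 0)"
  proof (rule Cauchy_convergent, rule CauchyI)
    fix e :: real
    assume "0 < e"
    then obtain N where "\<And>m n. m \<ge> N \<Longrightarrow> n \<ge> N \<Longrightarrow> cmod (f m 0 - f n 0) \<le> e / 2"
      using cauchy[of "e / 2" 0] by auto
    moreover have "e / 2 < e"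
      using \<open>0 < e\<close> by simp
    ultimately show "\<exists>N. \<forall>m\<ge>N. \<forall>n\<ge>N. norm (f m 0 - f n 0) < e"
      using le_less_trans by blast
  qed
  have unif: "\<forall>\<^sub>F n in sequentially. \<forall>x\<in>ball 0 R. \<forall>h. norm (dir_deriv (f n) x h - D x h) \<le> e * norm h" if "0 < e" for e R
  proof -
    obtain N where N: "\<And>m n z v. m \<ge> N \<Longrightarrow> n \<ge> N \<Longrightarrow> norm z \<le> R \<Longrightarrow> cmod (dir_deriv (f m) z v - dir_deriv (f n) z v) \<le> e * norm v"
      using dcauchy[OF \<open>0 < e\<close>, of R] by blast
    have "norm (dir_deriv (f n) x h - D x h) \<le> e * norm h" if "n \<ge> N" "x \<in> ball 0 R" for n x h
    proof (rule LIMSEQ_le_const2)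
      show "(\<lambda>m. norm (dir_deriv (f n) x h - dir_deriv (f m) x h)) \<longlonglongrightarrow> norm (dir_deriv (f n) x h - D x h)"
        by (intro tendsto_intros D)
      show "\<exists>M. \<forall>m\<ge>M. norm (dir_deriv (f n) x h - dir_deriv (f m) x h) \<le> e * norm h"
        using N that by (metis less_imp_le mem_ball_0)
    qed
    then show ?thesis
      unfolding eventually_sequentially by blast
  qed
  have ball: "\<exists>g. \<forall>x\<in>ball 0 R. (\<lambda>n. f n x) \<longlonglongrightarrow> g x \<and> (g has_derivative D x) (at x within ball 0 R)" if "0 < R" for R
  proof (rule has_derivative_sequence[OF convex_ball _ unif])
    show "(f n has_derivative dir_deriv (f n) x) (at x within ball 0 R)" for n x
      by (rule has_derivative_at_withinI[OF entire_has_derivative[OF f]])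
    show "(\<lambda>n. f n 0) \<longlonglongrightarrow> lim (\<lambda>n. f n 0)"
      using lim0 by (simp add: convergent_LIMSEQ_iff)
  qed (use \<open>0 < R\<close> in auto)
  \<comment> \<open>The limits found on different balls are glued by taking the pointwise limit,
    which agrees with each of them.\<close>
  define g where "g z = lim (\<lambda>n. f n z)" for z
  have g: "(\<lambda>n. f n z) \<longlonglongrightarrow> g z \<and> (g has_derivative D z) (at z)" for z
  proof -
    define R where "R = norm z + 1"
    have R: "0 < R" "z \<in> ball 0 R"
      by (auto simp: R_def add_nonneg_pos)
    obtain h where h: "\<And>x. x \<in> ball 0 R \<Longrightarrow> (\<lambda>n. f n x) \<longlonglongrightarrow> h x \<and> (h has_derivative D x) (at x within ball 0 R)"
      using ball[OF R(1)] by blast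
    have gh: "g x = h x" if "x \<in> ball 0 R" for x
      unfolding g_def using h[OF that] by (blast intro: limI)
    have "(h has_derivative D z) (at z)"
      using h[OF R(2)] R(2) by (simp add: at_within_open[OF R(2) open_ball])
    then have "(g has_derivative D z) (at z)"
      by (rule has_derivative_transform_within_open[OF _ open_ball R(2)]) (simp add: gh)
    then show ?thesis
      using h[OF R(2)] gh[OF R(2)] by simp
  qed
  have "D z (c *s v) = c * D z v" for z c v
  proof (rule LIMSEQ_unique[OF D])
    show "(\<lambda>n. dir_deriv (f n) z (c *s v)) \<longlonglongrightarrow> c * D z v"
      unfolding dir_deriv_smult[OF f] by (intro tendsto_intros D)
  qed
  then have "entire g"
    using g by (intro entireI) auto
  then show ?thesis
    using that g by blast
qed

text \<open>Point evaluations turn a Cauchy sequence in norm into a locally uniformly Cauchy one,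
  which gives an entire limit; Fatou's lemma then carries the Cauchy estimate over to the distance
  from the limit.\<close>

lemma fock_complete:
  fixes f :: "nat \<Rightarrow> complex ^ 'n::finite \<Rightarrow> complex"
  assumes f: "\<And>n. f n \<in> fock_space"
    and cauchy: "\<And>e. 0 < e \<Longrightarrow> \<exists>N. \<forall>m\<ge>N. \<forall>n\<ge>N. fock_norm (\<lambda>z. f m z - f n z) < e"
  obtains g where "g \<in> fock_space" "(\<lambda>n. fock_norm (\<lambda>z. f n z - g z)) \<longlonglongrightarrow> 0"
proof -
  have d: "(\<lambda>z. f m z - f n z) \<in> fock_space" for m n
    by (intro fock_diff f)
  have "\<exists>N. \<forall>m\<ge>N. \<forall>n\<ge>N. \<forall>z. norm z \<le> R \<longrightarrow> cmod (f m z - f n z) \<le> e" if "0 < e" for R e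
  proof -
    obtain C where C: "0 \<le> C" "\<And>f w. f \<in> fock_space \<Longrightarrow> norm (w :: complex ^ 'n) \<le> R \<Longrightarrow> cmod (f w) \<le> C * fock_norm f"
      using fock_eval_bound by blast
    \<comment> \<open>The 1 guards against \<open>C = 0\<close>.\<close>
    have "0 < e / (C + 1)"
      using C(1) that by simp
    then obtain N where N: "\<And>m n. m \<ge> N \<Longrightarrow> n \<ge> N \<Longrightarrow> fock_norm (\<lambda>z. f m z - f n z) < e / (C + 1)"
      using cauchy by blast
    have "cmod (f m z - f n z) \<le> e" if "m \<ge> N" "n \<ge> N" "norm z \<le> R" for m n z
    proof -
      have "cmod (f m z - f n z) \<le> C * fock_norm (\<lambda>z. f m z - f n z)"
        using C(2)[OF d] that(3) by blast
      also have "\<dots> \<le> (C + 1) * (e / (C + 1))"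
        using N[OF that(1,2)] C(1) by (intro mult_mono) auto
      finally show ?thesis
        using C(1) by simp
    qed
    then show ?thesis by blast
  qed
  from entire_locally_uniform_limit[of f, OF fock_entire[OF f] this]
  obtain g where g: "entire g" and lim: "\<And>z. (\<lambda>n. f n z) \<longlonglongrightarrow> g z"
    by blast
  have [measurable]: "f n \<in> borel_measurable borel" "g \<in> borel_measurable borel" for n
    using fock_measurable[OF f] entire_measurable[OF g] by auto
  have near: "\<exists>N. \<forall>n\<ge>N. fock_nn (\<lambda>z. f n z - g z) \<le> ennreal (e\<^sup>2)" if "0 < e" for e
  proof -
    obtain N where N: "\<And>m n. m \<ge> N \<Longrightarrow> n \<ge> N \<Longrightarrow> fock_norm (\<lambda>z. f m z - f n z) < e"
      using cauchy[OF \<open>0 < e\<close>] by blast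
    have "fock_nn (\<lambda>z. f n z - g z) \<le> ennreal (e\<^sup>2)" if "n \<ge> N" for n
    proof -
      let ?u = "\<lambda>m z. ennreal ((cmod (f n z - f m z))\<^sup>2) * ennreal (exp (- (norm z)\<^sup>2))"
      have "(\<lambda>m. ?u m z) \<longlonglongrightarrow> ennreal ((cmod (f n z - g z))\<^sup>2) * ennreal (exp (- (norm z)\<^sup>2))" for z
        unfolding ennreal_mult[symmetric, OF zero_le_power2 exp_ge_zero]
        by (intro tendsto_ennrealI tendsto_intros lim)
      then have "fock_nn (\<lambda>z. f n z - g z) = (\<integral>\<^sup>+z. liminf (\<lambda>m. ?u m z) \<partial>lborel)"
        unfolding fock_nn_def by (intro nn_integral_cong lim_imp_Liminf[symmetric]) auto
      also have "\<dots> \<le> liminf (\<lambda>m. \<integral>\<^sup>+z. ?u m z \<partial>lborel)"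
        by (rule nn_integral_liminf) measurable
      also have "\<dots> \<le> ennreal (e\<^sup>2)"
      proof (rule Liminf_le)
        have "fock_nn (\<lambda>z. f n z - f m z) \<le> ennreal (e\<^sup>2)" if "m \<ge> N" for m
          unfolding fock_nn_eq[OF d] using N[OF \<open>n \<ge> N\<close> that]
          by (intro ennreal_leI power_mono) auto
        then show "\<forall>\<^sub>F m in sequentially. (\<integral>\<^sup>+z. ?u m z \<partial>lborel) \<le> ennreal (e\<^sup>2)"
          unfolding fock_nn_def eventually_sequentially by blast
      qed simp
      finally show ?thesis .
    qed
    then show ?thesis by blast
  qed
  obtain N where "fock_nn (\<lambda>z. f N z - g z) \<le> ennreal (1\<^sup>2)"
    using near[of 1] by auto
  then have "(\<lambda>z. f N z - g z) \<in> fock_space"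
    using g f by (auto simp: fock_space_iff fock_entire entire_diff intro: le_less_trans)
  from fock_diff[OF f[of N] this] have gF: "g \<in> fock_space"
    by simp
  have "(\<lambda>n. fock_norm (\<lambda>z. f n z - g z)) \<longlonglongrightarrow> 0"
  proof (rule LIMSEQ_I)
    fix e :: real
    assume "0 < e"
    then obtain N where N: "\<And>n. n \<ge> N \<Longrightarrow> fock_nn (\<lambda>z. f n z - g z) \<le> ennreal ((e / 2)\<^sup>2)"
      using near[of "e / 2"] by auto
    have "fock_norm (\<lambda>z. f n z - g z) < e" if "n \<ge> N" for n
    proof -
      have "(fock_norm (\<lambda>z. f n z - g z))\<^sup>2 \<le> (e / 2)\<^sup>2"
        using N[OF that] unfolding fock_nn_eq[OF fock_diff[OF f gF]] by (subst (asm) ennreal_le_iff) auto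
      then have "fock_norm (\<lambda>z. f n z - g z) \<le> e / 2"
        by (rule power2_le_imp_le) (use \<open>0 < e\<close> in simp)
      then show ?thesis
        using \<open>0 < e\<close> by simp
    qed
    then show "\<exists>N. \<forall>n\<ge>N. norm (fock_norm (\<lambda>z. f n z - g z) - 0) < e"
      by auto
  qed
  with gF show ?thesis
    using that by blast
qed

section \<open>Compactness\<close>

lemma form_norm_L2_set: "form_norm p f = L2_set (\<lambda>J. fock_norm (f J)) (multi_indices p)"
  by (simp add: form_norm_def L2_set_def)

lemma form_norm_nonneg [simp]: "0 \<le> form_norm p f"
  by (simp add: form_norm_L2_set)

lemma fock_norm_le_form_norm: "J \<in> multi_indices p \<Longrightarrow> fock_norm (f J) \<le> form_norm p f"
  unfolding form_norm_L2_set by (rule member_le_L2_set) auto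

lemma form_norm_le_sum: "form_norm p f \<le> (\<Sum>J\<in>multi_indices p. fock_norm (f J))"
  unfolding form_norm_L2_set by (rule L2_set_le_sum) simp

lemma fock_forms_diff:
  assumes "f \<in> fock_forms p" "g \<in> fock_forms p"
  shows "(\<lambda>J z. f J z - g J z) \<in> fock_forms p"
  using assms by (auto simp: fock_forms_iff intro: fock_diff)

lemma form_norm_triangle:
  assumes "f \<in> fock_forms p" "g \<in> fock_forms p"
  shows "form_norm p (\<lambda>J z. f J z + g J z) \<le> form_norm p f + form_norm p g"
proof -
  have "form_norm p (\<lambda>J z. f J z + g J z) \<le> L2_set (\<lambda>J. fock_norm (f J) + fock_norm (g J)) (multi_indices p)"
    unfolding form_norm_L2_set
    by (intro L2_set_mono fock_norm_triangle fock_formsD[OF assms(1)] fock_formsD[OF assms(2)]) auto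
  also have "\<dots> \<le> form_norm p f + form_norm p g"
    unfolding form_norm_L2_set by (rule L2_set_triangle_ineq)
  finally show ?thesis .
qed

lemma form_norm_eq_0:
  assumes "f \<in> fock_forms p" "form_norm p f = 0"
  shows "f = (\<lambda>J z. 0)"
proof -
  have "(\<Sum>J\<in>multi_indices p. (fock_norm (f J))\<^sup>2) = 0"
    using assms(2) by (simp add: form_norm_def)
  then have "form_inner p f f = 0"
    by (simp add: form_inner_def fock_inner_self flip: of_real_sum of_real_power)
  then show ?thesis
    by (rule form_inner_self_eq_0[OF assms(1)])
qed

lemma fock_norm_minus_commute: "fock_norm (\<lambda>z. f z - g z) = fock_norm (\<lambda>z. g z - f z)"
  unfolding fock_norm_def by (simp add: norm_minus_commute)

lemma Metric_space_fock_forms: "Metric_space (fock_forms p :: ('n::finite) form set) (form_dist p)"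
proof
  fix f g h :: "'n form"
  show "0 \<le> form_dist p f g"
    by (simp add: form_dist_def)
  show "form_dist p f g = form_dist p g f"
    unfolding form_dist_def form_norm_def by (subst fock_norm_minus_commute) simp
  assume f: "f \<in> fock_forms p" and g: "g \<in> fock_forms p"
  show "form_dist p f g = 0 \<longleftrightarrow> f = g"
  proof
    assume "form_dist p f g = 0"
    from form_norm_eq_0[OF fock_forms_diff[OF f g] this[unfolded form_dist_def]] show "f = g"
      by (simp add: fun_eq_iff)
  qed (simp add: form_dist_def form_norm_def fock_norm_def)
  assume h: "h \<in> fock_forms p"
  show "form_dist p f h \<le> form_dist p f g + form_dist p g h"
    using form_norm_triangle[OF fock_forms_diff[OF f g] fock_forms_diff[OF g h]]
    by (simp add: form_dist_def)
qed

text \<open>In a complete space, compactness of a closure amounts to total boundedness, which can be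
  tested on sequences.\<close>

lemma fock_forms_mcomplete: "Metric_space.mcomplete (fock_forms p :: ('n::finite) form set) (form_dist p)"
proof -
  interpret fock_metric: Metric_space "fock_forms p :: 'n form set" "form_dist p"
    by (rule Metric_space_fock_forms)
  show ?thesis
    unfolding fock_metric.mcomplete_def
  proof (intro allI impI)
    fix \<sigma> :: "nat \<Rightarrow> 'n form"
    assume C: "fock_metric.MCauchy \<sigma>"
    then have \<sigma>: "\<And>n. \<sigma> n \<in> fock_forms p"
      and small: "\<And>e. 0 < e \<Longrightarrow> \<exists>N. \<forall>m n. N \<le> m \<longrightarrow> N \<le> n \<longrightarrow> form_dist p (\<sigma> m) (\<sigma> n) < e"
      unfolding fock_metric.MCauchy_def by auto
    have "\<exists>g. g \<in> fock_space \<and> (\<lambda>n. fock_norm (\<lambda>z. \<sigma> n J z - g z)) \<longlonglongrightarrow> 0" if J: "J \<in> multi_indices p" for J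
    proof (rule fock_complete[of "\<lambda>n. \<sigma> n J"])
      show "\<sigma> n J \<in> fock_space" for n
        using \<sigma> by (rule fock_formsD)
      show "\<exists>N. \<forall>m\<ge>N. \<forall>n\<ge>N. fock_norm (\<lambda>z. \<sigma> m J z - \<sigma> n J z) < e" if "0 < e" for e
        using small[OF that] fock_norm_le_form_norm[OF J, of "\<lambda>J z. \<sigma> m J z - \<sigma> n J z" for m n]
        unfolding form_dist_def by (meson le_less_trans)
    qed blast
    then have "\<forall>J\<in>multi_indices p. \<exists>g. g \<in> fock_space \<and> (\<lambda>n. fock_norm (\<lambda>z. \<sigma> n J z - g z)) \<longlonglongrightarrow> 0"
      by blast
    from bchoice[OF this] obtain g where g: "\<And>J. J \<in> multi_indices p \<Longrightarrow> g J \<in> fock_space"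
      "\<And>J. J \<in> multi_indices p \<Longrightarrow> (\<lambda>n. fock_norm (\<lambda>z. \<sigma> n J z - g J z)) \<longlonglongrightarrow> 0"
      by blast
    \<comment> \<open>Being a form requires zero coefficients at all other index sets, where the
      choice of \<open>g\<close> is arbitrary.\<close>
    define h where "h J = (if J \<in> multi_indices p then g J else (\<lambda>z. 0))" for J
    have h: "h \<in> fock_forms p"
      using g(1) by (auto simp: fock_forms_iff h_def)
    have "(\<lambda>n. \<Sum>J\<in>multi_indices p. fock_norm (\<lambda>z. \<sigma> n J z - h J z)) \<longlonglongrightarrow> (\<Sum>J\<in>(multi_indices p :: 'n set set). 0)"
      by (intro tendsto_sum) (use g(2) in \<open>simp add: h_def\<close>)
    then have "(\<lambda>n. form_dist p (\<sigma> n) h) \<longlonglongrightarrow> 0"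
      unfolding form_dist_def
      by (intro tendsto_sandwich[of "\<lambda>n. 0" "\<lambda>n. form_norm p (\<lambda>J z. \<sigma> n J z - h J z)" _
            "\<lambda>n. \<Sum>J\<in>multi_indices p. fock_norm (\<lambda>z. \<sigma> n J z - h J z)" 0])
        (auto intro!: always_eventually form_norm_le_sum)
    then show "\<exists>x. limitin (fock_metric.mtopology) \<sigma> x sequentially"
      using h \<sigma> by (auto simp: fock_metric.limitin_metric_dist_null)
  qed
qed

section \<open>Smallness of the radial mean and extraction of Cauchy subsequences\<close>

lemma fock_nn_hcomp_le_ball:
  fixes h :: "complex ^ 'n::finite \<Rightarrow> complex"
  assumes h: "entire h" and small: "\<And>w. norm w \<le> 1 \<Longrightarrow> cmod (h w) \<le> e"
  shows "fock_nn (hcomp k h) \<le> ennreal (e\<^sup>2) * (\<integral>\<^sup>+z. ennreal ((norm (z :: complex ^ 'n) ^ k)\<^sup>2 * exp (- (norm z)\<^sup>2)) \<partial>lborel)"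
proof -
  have "fock_nn (hcomp k h) \<le> (\<integral>\<^sup>+z. ennreal (e\<^sup>2) * ennreal ((norm (z :: complex ^ 'n) ^ k)\<^sup>2 * exp (- (norm z)\<^sup>2)) \<partial>lborel)"
    unfolding fock_nn_def
  proof (rule nn_integral_mono)
    fix z :: "complex ^ 'n"
    have "(cmod (hcomp k h z))\<^sup>2 \<le> (e * norm z ^ k)\<^sup>2"
      by (intro power_mono norm_hcomp_le[OF h small]) auto
    then have "(cmod (hcomp k h z))\<^sup>2 * exp (- (norm z)\<^sup>2) \<le> e\<^sup>2 * ((norm z ^ k)\<^sup>2 * exp (- (norm z)\<^sup>2))"
      by (simp add: power_mult_distrib mult.assoc[symmetric] mult_right_mono)
    then show "ennreal ((cmod (hcomp k h z))\<^sup>2) * ennreal (exp (- (norm z)\<^sup>2)) \<le> ennreal (e\<^sup>2) * ennreal ((norm z ^ k)\<^sup>2 * exp (- (norm z)\<^sup>2))"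
      by (subst (1 2) ennreal_mult[symmetric]) (auto intro: ennreal_leI)
  qed
  then show ?thesis
    by (subst (asm) nn_integral_cmult) auto
qed

lemma gaussian_moment_finite:
  "(\<integral>\<^sup>+z. ennreal ((norm (z :: complex ^ 'n::finite) ^ k)\<^sup>2 * exp (- (norm z)\<^sup>2)) \<partial>lborel) < \<infinity>"
proof -
  let ?F = "\<lambda>z::complex ^ 'n. complex_of_real ((norm z ^ k)\<^sup>2)"
  have "integrable lborel (\<lambda>z. ?F z * of_real (exp (- (norm z)\<^sup>2)))"
  proof (rule integrable_polynomial_gaussian)
    show "cmod (?F z) \<le> 1 * (1 + norm z) ^ (k * 2)" for z
      by (simp add: norm_power power_mult[symmetric] power_mono)
  qed measurable
  from integrable_norm[OF this] show ?thesis
    by (simp add: integrable_iff_bounded norm_mult norm_power abs_mult)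
qed

text \<open>
  The components of low degree are controlled by the values on the unit ball, while the operator
  shrinks those of degree at least $K$ by the factor $1/K$.
\<close>

lemma radial_mean_small:
  fixes p K :: nat
  assumes p: "1 \<le> p" and K: "1 \<le> K"
  obtains S where "0 \<le> S"
    "\<And>h e. h \<in> fock_space \<Longrightarrow> (\<And>w. norm w \<le> 1 \<Longrightarrow> cmod (h w) \<le> e) \<Longrightarrow>
      (fock_norm (radial_mean p h :: complex ^ 'n::finite \<Rightarrow> complex))\<^sup>2 \<le> e\<^sup>2 * S + (fock_norm h)\<^sup>2 / (real K)\<^sup>2"
proof -
  define M where "M k = (\<integral>\<^sup>+z. ennreal ((norm (z :: complex ^ 'n) ^ k)\<^sup>2 * exp (- (norm z)\<^sup>2)) \<partial>lborel)" for k
  have "M k < \<infinity>" for k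
    unfolding M_def by (rule gaussian_moment_finite)
  then have "(\<Sum>k<K. M k) < \<infinity>"
    by simp
  then obtain S where S: "0 \<le> S" "(\<Sum>k<K. M k) = ennreal S"
    by (metis ennreal_cases less_irrefl infinity_ennreal_def)
  show ?thesis
  proof (rule that[OF S(1)])
    fix h :: "complex ^ 'n \<Rightarrow> complex" and e
    assume h: "h \<in> fock_space" and small: "\<And>w. norm w \<le> 1 \<Longrightarrow> cmod (h w) \<le> e"
    have eh: "entire h" using h by (rule fock_entire)
    let ?u = "radial_mean p h"
    \<comment> \<open>The tail term is kept in every degree, so that its sum is the full Parseval
      series of \<open>h\<close>.\<close>
    have "fock_nn (hcomp k ?u) \<le> (if k < K then ennreal (e\<^sup>2) * M k else 0) + ennreal (1 / (real K)\<^sup>2) * fock_nn (hcomp k h)" for k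
    proof (cases "k < K")
      case True
      have "1 \<le> (real (k + p))\<^sup>2"
        using p by (intro one_le_power) simp
      from fock_nn_hcomp_radial_mean_le[OF eh p this] have "fock_nn (hcomp k ?u) \<le> fock_nn (hcomp k h)"
        by simp
      also have "\<dots> \<le> ennreal (e\<^sup>2) * M k"
        unfolding M_def by (rule fock_nn_hcomp_le_ball[OF eh small])
      finally show ?thesis
        using True by (simp add: add_increasing2)
    next
      case False
      have "1 / (real (k + p))\<^sup>2 \<le> 1 / (real K)\<^sup>2"
        using False K by (intro divide_left_mono power_mono) auto
      then show ?thesis
        unfolding fock_nn_hcomp_radial_mean[OF eh p] using False
        by (simp add: mult_right_mono ennreal_leI)
    qed
    then have "fock_nn ?u \<le> (\<Sum>k. (if k < K then ennreal (e\<^sup>2) * M k else 0) + ennreal (1 / (real K)\<^sup>2) * fock_nn (hcomp k h))"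
      unfolding fock_nn_parseval[OF entire_radial_mean[OF eh]] by (intro suminf_le) auto
    also have "\<dots> = (\<Sum>k. if k < K then ennreal (e\<^sup>2) * M k else 0) + (\<Sum>k. ennreal (1 / (real K)\<^sup>2) * fock_nn (hcomp k h))"
      by (rule suminf_add[symmetric]) auto
    also have "(\<Sum>k. if k < K then ennreal (e\<^sup>2) * M k else 0) = (\<Sum>k<K. ennreal (e\<^sup>2) * M k)"
      by (subst suminf_finite[of "{..<K}"]) auto
    also have "\<dots> = ennreal (e\<^sup>2 * S)"
      using S by (simp add: sum_distrib_left[symmetric] ennreal_mult)
    also have "(\<Sum>k. ennreal (1 / (real K)\<^sup>2) * fock_nn (hcomp k h)) = ennreal ((fock_norm h)\<^sup>2 / (real K)\<^sup>2)"
      unfolding ennreal_suminf_cmult fock_nn_parseval[OF eh, symmetric] fock_nn_eq[OF h]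
      by (simp add: ennreal_mult[symmetric])
    finally show "(fock_norm ?u)\<^sup>2 \<le> e\<^sup>2 * S + (fock_norm h)\<^sup>2 / (real K)\<^sup>2"
      using S(1) by (simp add: fock_nn_eq radial_mean_fock[OF h p] ennreal_plus[symmetric] del: ennreal_plus)
  qed
qed

lemma radial_mean_linear:
  fixes f g :: "complex ^ 'n::finite \<Rightarrow> complex"
  assumes "entire f" "entire g"
  shows "radial_mean p (\<lambda>z. a * f z + b * g z) = (\<lambda>z. a * radial_mean p f z + b * radial_mean p g z)"
proof
  fix z :: "complex ^ 'n"
  have int: "(\<lambda>t. complex_of_real t ^ (p - 1) * h (complex_of_real t *s z)) integrable_on {0..1}"
    if "entire h" for h :: "complex ^ 'n \<Rightarrow> complex"
    by (intro integrable_continuous_interval continuous_intros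
        continuous_on_compose2[OF entire_continuous_on[OF that, of UNIV]]) auto
  have "radial_mean p (\<lambda>z. a * f z + b * g z) z =
      integral {0..1} (\<lambda>t. a * (complex_of_real t ^ (p - 1) * f (complex_of_real t *s z)) + b * (complex_of_real t ^ (p - 1) * g (complex_of_real t *s z)))"
    unfolding radial_mean_def by (simp add: algebra_simps)
  also have "\<dots> = a * radial_mean p f z + b * radial_mean p g z"
    unfolding radial_mean_def
    by (subst integral_add) ((intro integrable_on_mult_right int assms)+, simp only: integral_mult_right)
  finally show "radial_mean p (\<lambda>z. a * f z + b * g z) z = a * radial_mean p f z + b * radial_mean p g z" .
qed

lemma norm_vec_le_sum: "norm x \<le> (\<Sum>i\<in>UNIV. norm (x $ i))"
  unfolding norm_vec_def by (rule L2_set_le_sum) simp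

text \<open>A norm bound gives, through point evaluations, a uniform bound near the unit ball;
  Cauchy estimates turn it into a common Lipschitz constant, so Arzela-Ascoli applies.\<close>

lemma bounded_forms_subsequence:
  fixes b :: "nat \<Rightarrow> ('n::finite) form"
  assumes b: "\<And>n. b n \<in> fock_forms p" and A: "\<And>n. form_norm p (b n) \<le> A"
  obtains r :: "nat \<Rightarrow> nat" where "strict_mono r"
    "\<And>e. 0 < e \<Longrightarrow> \<exists>N. \<forall>m\<ge>N. \<forall>n\<ge>N. \<forall>J w. norm w \<le> 1 \<longrightarrow> cmod (b (r m) J w - b (r n) J w) < e"
proof -
  \<comment> \<open>Radius 2 leaves room for Cauchy estimates on unit balls centred in the unit
    ball.\<close>
  obtain C where C: "0 \<le> C" "\<And>f w. f \<in> fock_space \<Longrightarrow> norm (w :: complex ^ 'n) \<le> 2 \<Longrightarrow> cmod (f w) \<le> C * fock_norm f"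
    using fock_eval_bound by blast
  have A0: "0 \<le> A"
    using A[of 0] form_norm_nonneg order_trans by blast
  have fb: "b n J \<in> fock_space" for n J
    using b by (rule fock_formsD)
  have nb: "fock_norm (b n J) \<le> A" for n J
  proof (cases "J \<in> multi_indices p")
    case True
    then show ?thesis
      using fock_norm_le_form_norm A order_trans by metis
  next
    case False
    then have "b n J = (\<lambda>z. 0)"
      using b by (simp add: fock_forms_iff)
    then show ?thesis
      using A0 by (simp add: fock_norm_def)
  qed
  define L where "L = C * A"
  have L0: "0 \<le> L"
    using C(1) A0 by (simp add: L_def)
  have L: "cmod (b n J w) \<le> L" if "norm w \<le> 2" for n J w
    using C(2)[OF fb that, of n J] mult_left_mono[OF nb C(1), of n J] by (simp add: L_def)
  have lip: "cmod (b n J x - b n J y) \<le> L * norm (x - y)" if "norm x \<le> 1" "norm y \<le> 1" for n J x y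
  proof (rule differentiable_bound[of "cball 0 1" "b n J" "dir_deriv (b n J)"])
    fix z :: "complex ^ 'n"
    assume z: "z \<in> cball 0 1"
    show "(b n J has_derivative dir_deriv (b n J) z) (at z within cball 0 1)"
      by (rule has_derivative_at_withinI[OF entire_has_derivative[OF fock_entire[OF fb]]])
    show "onorm (dir_deriv (b n J) z) \<le> L"
    proof (rule onorm_bound[OF L0])
      fix v
      show "norm (dir_deriv (b n J) z v) \<le> L * norm v"
      proof (rule norm_dir_deriv_le_norm[OF fock_entire[OF fb]])
        fix w
        assume "norm (w - z) \<le> 1"
        then have "norm w \<le> 2"
          using norm_triangle_ineq[of z "w - z"] z by simp
        then show "cmod (b n J w) \<le> L"
          by (rule L)
      qed
    qed
  qed (use that in auto)
  \<comment> \<open>All coefficients are packed into one vector, so that a single subsequence serves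
    every \<open>J\<close>.\<close>
  define F :: "nat \<Rightarrow> complex ^ 'n \<Rightarrow> complex ^ ('n set)" where "F n z = (\<chi> J. b n J z)" for n z
  define c where "c = real (card (UNIV :: 'n set set))"
  have c: "0 < c"
    by (simp add: c_def card_gt_0_iff)
  obtain g r where r: "strict_mono (r :: nat \<Rightarrow> nat)"
    and lim: "\<And>e. 0 < e \<Longrightarrow> \<exists>N. \<forall>n x. n \<ge> N \<and> x \<in> cball 0 1 \<longrightarrow> norm (F (r n) x - g x) < e"
  proof (rule Arzela_Ascoli[of "cball 0 1" F "c * L"])
    show "norm (F n x) \<le> c * L" if "x \<in> cball 0 1" for n x
    proof -
      have "(\<Sum>J\<in>UNIV. norm (F n x $ J)) \<le> (\<Sum>J\<in>(UNIV :: 'n set set). L)"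
        using that by (intro sum_mono) (auto simp: F_def intro!: L)
      then show ?thesis
        using norm_vec_le_sum[of "F n x"] by (simp add: c_def)
    qed
    show "\<exists>d. 0 < d \<and> (\<forall>n y. y \<in> cball 0 1 \<and> norm (x - y) < d \<longrightarrow> norm (F n x - F n y) < e)"
      if x: "x \<in> cball 0 1" and "0 < e" for x e
    proof (intro exI conjI allI impI)
      show "0 < e / (c * L + 1)"
        using \<open>0 < e\<close> c L0 by (simp add: add_nonneg_pos)
      fix n y
      assume y: "y \<in> cball 0 1 \<and> norm (x - y) < e / (c * L + 1)"
      have "norm (F n x - F n y) \<le> (\<Sum>J\<in>UNIV. norm ((F n x - F n y) $ J))"
        by (rule norm_vec_le_sum)
      also have "\<dots> \<le> (\<Sum>J\<in>(UNIV :: 'n set set). L * norm (x - y))"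
        using x y by (intro sum_mono) (auto simp: F_def intro!: lip)
      also have "\<dots> = c * L * norm (x - y)"
        by (simp add: c_def)
      also have "\<dots> \<le> c * L * (e / (c * L + 1))"
        using y c L0 by (intro mult_left_mono) auto
      also have "\<dots> < e"
        using \<open>0 < e\<close> c L0 by (simp add: divide_less_eq add_nonneg_pos distrib_left)
      finally show "norm (F n x - F n y) < e" .
    qed
  qed auto
  have "\<exists>N. \<forall>m\<ge>N. \<forall>n\<ge>N. \<forall>J w. norm w \<le> 1 \<longrightarrow> cmod (b (r m) J w - b (r n) J w) < e" if "0 < e" for e
  proof -
    obtain N where N: "\<And>n x. n \<ge> N \<Longrightarrow> norm x \<le> 1 \<Longrightarrow> norm (F (r n) x - g x) < e / 2"
      using lim[of "e / 2"] \<open>0 < e\<close> by (auto simp del: less_divide_eq_numeral1)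
    have "cmod (b (r m) J w - b (r n) J w) < e" if "m \<ge> N" "n \<ge> N" "norm w \<le> 1" for m n J w
    proof -
      have "cmod (b (r m) J w - b (r n) J w) = norm ((F (r m) w - F (r n) w) $ J)"
        by (simp add: F_def)
      also have "\<dots> \<le> norm (F (r m) w - F (r n) w)"
        by (rule Finite_Cartesian_Product.norm_nth_le)
      also have "\<dots> < e"
        using N[OF that(1,3)] N[OF that(2,3)] norm_triangle_ineq4[of "F (r m) w - g w" "F (r n) w - g w"] by simp
      finally show ?thesis .
    qed
    then show ?thesis by blast
  qed
  with r show ?thesis
    using that by blast
qed

text \<open>The constants are chosen in the order \<open>K\<close>, \<open>S\<close>,
  \<open>e\<close>, \<open>N\<close>: \<open>K\<close> makes the high degrees small using only the
  norm bound \<open>A\<close>, \<open>S\<close> bounds the moments below degree \<open>K\<close>,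
  \<open>e\<close> balances \<open>S\<close>, and \<open>N\<close> comes from uniform convergence on
  the unit ball.\<close>

lemma form_radial_mean_subsequence:
  fixes b :: "nat \<Rightarrow> ('n::finite) form"
  assumes p: "1 \<le> p" and b: "\<And>n. b n \<in> fock_forms p" and A: "\<And>n. form_norm p (b n) \<le> A"
  shows "\<exists>r. strict_mono (r :: nat \<Rightarrow> nat) \<and>
    Metric_space.MCauchy (fock_forms p) (form_dist p) (\<lambda>n. form_radial_mean p (b (r n)))"
proof -
  interpret fock_metric: Metric_space "fock_forms p :: 'n form set" "form_dist p"
    by (rule Metric_space_fock_forms)
  obtain r where r: "strict_mono (r :: nat \<Rightarrow> nat)"
    and unif: "\<And>e. 0 < e \<Longrightarrow> \<exists>N. \<forall>m\<ge>N. \<forall>n\<ge>N. \<forall>J w. norm w \<le> 1 \<longrightarrow> cmod (b (r m) J w - b (r n) J w) < e"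
    using bounded_forms_subsequence[of b p A] b A by blast
  have fb: "b n J \<in> fock_space" for n J
    using b by (rule fock_formsD)
  have "\<exists>N. \<forall>m n. N \<le> m \<longrightarrow> N \<le> n \<longrightarrow> form_dist p (form_radial_mean p (b (r m))) (form_radial_mean p (b (r n))) < \<epsilon>"
    if "0 < \<epsilon>" for \<epsilon>
  proof -
    define c where "c = real (card (multi_indices p :: 'n set set))"
    define \<delta> where "\<delta> = \<epsilon> / (c + 1)"
    have \<delta>: "0 < \<delta>"
      using \<open>0 < \<epsilon>\<close> by (simp add: \<delta>_def c_def add_nonneg_pos)
    \<comment> \<open>A difference of two coefficients has norm at most
      \<open>2 * \<bar>A\<bar>\<close>; from degree \<open>K\<close> on, the factor
      \<open>1 / K\<close> reduces this to \<open>\<delta> / 2\<close>.\<close>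
    obtain K :: nat where K: "2 * (2 * \<bar>A\<bar> / \<delta>) < real K"
      using reals_Archimedean2 by blast
    have K1: "1 \<le> K"
    proof -
      have "0 \<le> 2 * (2 * \<bar>A\<bar> / \<delta>)" using \<delta> by simp
      with K have "0 < real K" by linarith
      then show ?thesis by simp
    qed
    have tail: "(2 * \<bar>A\<bar>)\<^sup>2 / (real K)\<^sup>2 \<le> (\<delta> / 2)\<^sup>2"
    proof -
      have "2 * \<bar>A\<bar> / real K \<le> \<delta> / 2"
        using K \<delta> K1 by (simp add: field_simps)
      then have "(2 * \<bar>A\<bar> / real K)\<^sup>2 \<le> (\<delta> / 2)\<^sup>2"
        by (intro power_mono) auto
      then show ?thesis
        by (simp add: power_divide)
    qed
    obtain S where S: "0 \<le> S"
      "\<And>h e. h \<in> fock_space \<Longrightarrow> (\<And>w. norm w \<le> 1 \<Longrightarrow> cmod (h w) \<le> e) \<Longrightarrow>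
      (fock_norm (radial_mean p h :: complex ^ 'n \<Rightarrow> complex))\<^sup>2 \<le> e\<^sup>2 * S + (fock_norm h)\<^sup>2 / (real K)\<^sup>2"
      using radial_mean_small[OF p K1] by metis
    \<comment> \<open>Chosen for \<open>e\<^sup>2 * S \<le> (\<delta> / 2)\<^sup>2\<close>, with
      \<open>S + 1\<close> in place of \<open>S\<close> to avoid division by 0.\<close>
    define e where "e = \<delta> / (2 * sqrt (S + 1))"
    have e: "0 < e"
      using \<delta> S(1) by (simp add: e_def)
    have eS: "e\<^sup>2 * S \<le> (\<delta> / 2)\<^sup>2"
    proof -
      have "e\<^sup>2 * S \<le> e\<^sup>2 * (S + 1)"
        by (intro mult_left_mono) auto
      also have "\<dots> = (e * sqrt (S + 1))\<^sup>2"
        using S(1) by (simp add: power_mult_distrib)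
      also have "e * sqrt (S + 1) = \<delta> / 2"
        using S(1) by (simp add: e_def)
      finally show ?thesis .
    qed
    obtain N where N: "\<And>m n J w. m \<ge> N \<Longrightarrow> n \<ge> N \<Longrightarrow> norm w \<le> 1 \<Longrightarrow> cmod (b (r m) J w - b (r n) J w) < e"
      using unif[OF e] by blast
    have "form_dist p (form_radial_mean p (b (r m))) (form_radial_mean p (b (r n))) < \<epsilon>" if mn: "N \<le> m" "N \<le> n" for m n
    proof -
      have comp: "fock_norm (\<lambda>z. form_radial_mean p (b (r m)) J z - form_radial_mean p (b (r n)) J z) \<le> \<delta>"
        if J: "J \<in> multi_indices p" for J
      proof -
        \<comment> \<open>The difference is written as a linear combination with coefficients 1 and
          -1 to fit \<open>radial_mean_linear\<close>.\<close>
        define h where "h z = 1 * b (r m) J z + (-1) * b (r n) J z" for z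
        have h: "h \<in> fock_space"
          unfolding h_def by (intro fock_add fock_cmult fb)
        have hsmall: "cmod (h w) \<le> e" if "norm w \<le> 1" for w
          using N[OF mn that, of J] by (simp add: h_def)
        have "fock_norm h \<le> fock_norm (b (r m) J) + fock_norm (b (r n) J)"
          using fock_norm_triangle[OF fock_cmult[OF fb, of 1] fock_cmult[OF fb, of "-1"]]
          unfolding h_def fock_norm_cmult by simp
        also have "\<dots> \<le> 2 * \<bar>A\<bar>"
          using fock_norm_le_form_norm[OF J, of "b (r m)"] fock_norm_le_form_norm[OF J, of "b (r n)"] A[of "r m"] A[of "r n"]
          by linarith
        finally have "fock_norm h \<le> 2 * \<bar>A\<bar>" .
        then have "(fock_norm h)\<^sup>2 / (real K)\<^sup>2 \<le> (2 * \<bar>A\<bar>)\<^sup>2 / (real K)\<^sup>2"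
          by (intro divide_right_mono power_mono) auto
        then have "(fock_norm (radial_mean p h))\<^sup>2 \<le> (\<delta> / 2)\<^sup>2 + (\<delta> / 2)\<^sup>2"
          using S(2)[OF h hsmall] eS tail by linarith
        also have "\<dots> \<le> \<delta>\<^sup>2"
          by (simp add: power_divide)
        finally have "fock_norm (radial_mean p h) \<le> \<delta>"
          by (rule power2_le_imp_le) (use \<delta> in simp)
        moreover have "radial_mean p h = (\<lambda>z. 1 * radial_mean p (b (r m) J) z + (-1) * radial_mean p (b (r n) J) z)"
          unfolding h_def[abs_def] by (intro radial_mean_linear fock_entire fb)
        ultimately show ?thesis
          by (simp add: form_radial_mean_def)
      qed
      have "form_dist p (form_radial_mean p (b (r m))) (form_radial_mean p (b (r n))) \<le>
          (\<Sum>J\<in>multi_indices p. fock_norm (\<lambda>z. form_radial_mean p (b (r m)) J z - form_radial_mean p (b (r n)) J z))"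
        unfolding form_dist_def by (rule form_norm_le_sum)
      also have "\<dots> \<le> (\<Sum>J\<in>(multi_indices p :: 'n set set). \<delta>)"
        by (intro sum_mono comp)
      also have "\<dots> = c * \<delta>"
        by (simp add: c_def)
      also have "\<dots> < (c + 1) * \<delta>"
        using \<delta> by simp
      also have "\<dots> = \<epsilon>"
        by (simp add: \<delta>_def c_def add_nonneg_pos add_pos_nonneg less_imp_neq[symmetric])
      finally show ?thesis .
    qed
    then show ?thesis by blast
  qed
  moreover have "range (\<lambda>n. form_radial_mean p (b (r n))) \<subseteq> fock_forms p"
    using form_radial_mean_fock[OF p b] by auto
  ultimately show ?thesis
    using r unfolding fock_metric.MCauchy_def by blast
qed

theorem theorem4p6:
  fixes p :: nat
  assumes "1 \<le> p" and "p \<le> CARD('n::{finite,linorder})"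
  shows "compact_operator p (inverse_laplacian p :: 'n form \<Rightarrow> 'n form)"
proof -
  interpret fock_metric: Metric_space "fock_forms p :: 'n form set" "form_dist p"
    by (rule Metric_space_fock_forms)
  show ?thesis
    unfolding compact_operator_def
  proof (intro conjI allI impI)
    let ?T = "inverse_laplacian p :: 'n form \<Rightarrow> 'n form"
    note T = inverse_laplacian_eq[OF assms(1)]
    show maps: "?T \<in> fock_forms p \<rightarrow> fock_forms p"
      using form_radial_mean_fock[OF assms(1)] by (auto simp: T)
    show "linear_on_forms p ?T"
      unfolding linear_on_forms_def
    proof (intro ballI allI)
      fix f g :: "'n form" and a b
      assume f: "f \<in> fock_forms p" and g: "g \<in> fock_forms p"
      have "(\<lambda>z. a * f J z + b * g J z) \<in> fock_space" for J
        by (intro fock_add fock_cmult fock_formsD[OF f] fock_formsD[OF g])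
      then have "(\<lambda>J z. a * f J z + b * g J z) \<in> fock_forms p"
        using f g by (simp add: fock_forms_iff)
      then show "?T (\<lambda>J z. a * f J z + b * g J z) = (\<lambda>J z. a * ?T f J z + b * ?T g J z)"
        using f g by (simp add: T form_radial_mean_def radial_mean_linear fock_entire fock_formsD[OF f] fock_formsD[OF g])
    qed
    fix B :: "'n form set"
    assume "fock_metric.mbounded B"
    then obtain c R where B: "B \<subseteq> fock_metric.mcball c R"
      unfolding fock_metric.mbounded_def by blast
    have Bsub: "B \<subseteq> fock_forms p"
      using B by auto
    have bound: "form_norm p f \<le> form_norm p c + R" if "f \<in> B" for f
    proof -
      have f: "f \<in> fock_forms p" and c: "c \<in> fock_forms p" and d: "form_dist p f c \<le> R"
        using that B by (auto simp: fock_metric.commute)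
      have "form_norm p (\<lambda>J z. (f J z - c J z) + c J z) \<le> form_dist p f c + form_norm p c"
        unfolding form_dist_def by (rule form_norm_triangle[OF fock_forms_diff[OF f c] c])
      with d show ?thesis by simp
    qed
    have "fock_metric.mtotally_bounded (?T ` B)"
      unfolding fock_metric.mtotally_bounded_sequentially
    proof (intro conjI allI impI)
      show "?T ` B \<subseteq> fock_forms p"
        using maps Bsub by auto
      fix \<sigma> :: "nat \<Rightarrow> 'n form"
      assume "range \<sigma> \<subseteq> ?T ` B"
      \<comment> \<open>Preimages in \<open>B\<close> form a norm-bounded sequence, to which
        \<open>form_radial_mean_subsequence\<close> applies.\<close>
      then have "\<forall>n. \<exists>f. f \<in> B \<and> \<sigma> n = ?T f" by blast
      then obtain b where b: "\<And>n. b n \<in> B" "\<And>n. \<sigma> n = ?T (b n)" by metis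
      have "\<sigma> n = form_radial_mean p (b n)" for n
        using b(2)[of n] T[of "b n"] b(1)[of n] Bsub by auto
      then show "\<exists>r. strict_mono r \<and> fock_metric.MCauchy (\<sigma> \<circ> r)"
        using form_radial_mean_subsequence[OF assms(1), of b "form_norm p c + R"] b(1) Bsub bound
        by (auto simp: o_def)
    qed
    then show "compactin (fock_metric.mtopology) (fock_metric.mtopology closure_of (?T ` B))"
      using fock_metric.mtotally_bounded_eq_compact_closure_of[OF fock_forms_mcomplete] by blast
  qed
qed

end
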